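(* Let $g\in W_0$ have stable integer shifts and let $\Lambda\subseteq\mathbb{R}$ be a relatively separated set. The following are equivalent: (a) $\Lambda$ is a sampling set of $V^p(g)$ for some $p\in[1,\infty]$. (b) $\Lambda$ is a sampling set of $V^p(g)$ for all $p\in[1,\infty]$. (c) Every $\Gamma\in W_{\mathbb{Z}}(\Lambda)$ is a sampling set for $V^\infty(g)$. (d) Every $\Gamma\in W_{\mathbb{Z}}(\Lambda)$ is a uniqueness set for $V^\infty(g)$. (e) For every $\Gamma\in W_{\mathbb{Z}}(\Lambda)$, the matrix $P_\Gamma(g)=(g(\gamma-k))_{\gamma\in\Gamma,k\in\mathbb{Z}}$ defines a bounded injective operator from $\ell^\infty(\mathbb{Z})$ to $\ell^\infty(\Gamma)$. (f) For every $\Gamma\in W_{\mathbb{Z}}(\Lambda)$, the matrix $P_\Gamma(g)'=(g(\gamma-k))_{k\in\mathbb{Z},\gamma\in\Gamma}$ defines an operator $\ell^1(\Gamma)\to\ell^1(\mathbb{Z})$ with dense range.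
   Context: $W_0=W(C,\ell_1)$ is the space of continuous functions $g:\mathbb{R}\to\mathbb{C}$ with $\|g\|_W=\sum_{k\in\mathbb{Z}}\max_{x\in[k,k+1]}|g(x)|<\infty$. For $1\le p\le\infty$, $V^p(g)=\{\sum_{k\in\mathbb{Z}}c_kg(\cdot-k):c\in\ell^p(\mathbb{Z})\}$. $g\in W_0$ has stable integer shifts if it satisfies any of the following equivalent conditions: for some (equivalently all) $p\in[1,\infty]$ there is $C_p>0$ with $\|\sum_kc_kg(\cdot-k)\|_p\ge C_p\|c\|_p$ for all $c\in\ell^p(\mathbb{Z})$; $\sum_kc_kg(\cdot-k)\ne0$ for every $c\in\ell^\infty(\mathbb{Z})\setminus\{0\}$; $\sum_{k\in\mathbb{Z}}|\hat g(\xi+k)|^2>0$ for every $\xi\in\mathbb{R}$, where $\hat g(\xi)=\int_{\mathbb{R}}g(x)e^{-2\pi ix\xi}dx$. A set $\Lambda\subseteq\mathbb{R}$ is relatively separated if $\max_{x\in\mathbb{R}}\#(\Lambda\cap[x,x+1])<\infty$. A relatively separated set $\Lambda$ is a sampling set for $V^p(g)$, $1\le p<\infty$, if there are $A_p,B_p>0$ with $A_p\|f\|_p^p\le\sum_{\lambda\in\Lambda}|f(\lambda)|^p\le B_p\|f\|_p^p$ for all $f\in V^p(g)$; for $p=\infty$ the requirement is $A_\infty\|f\|_\infty\le\sup_{\lambda\in\Lambda}|f(\lambda)|\le B_\infty\|f\|_\infty$ for all $f\in V^\infty(g)$ (with supremum over the empty set equal to $0$). $\Lambda$ is a uniqueness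 set for $V^p(g)$ if $f\in V^p(g)$ and $f(\lambda)=0$ for all $\lambda\in\Lambda$ imply $f=0$. Weak convergence of sets: a sequence $\{\Lambda_n:n\ge1\}$ of subsets of $\mathbb{R}$ converges weakly to $\Lambda\subseteq\mathbb{R}$ if for every open bounded interval $(a,b)$ and every $\varepsilon>0$ there exists $n_0\in\mathbb{N}$ such that for all $n\ge n_0$: $\Lambda_n\cap(a,b)\subseteq\Lambda+(-\varepsilon,\varepsilon)$ and $\Lambda\cap(a,b)\subseteq\Lambda_n+(-\varepsilon,\varepsilon)$. $W_{\mathbb{Z}}(\Lambda)$ is the collection of all weak limits of integer translates of $\Lambda$: $\Gamma\in W_{\mathbb{Z}}(\Lambda)$ if there is a sequence $\{k_n\}\subseteq\mathbb{Z}$ such that $\Lambda+k_n$ converges weakly to $\Gamma$. If $\Lambda$ is relatively separated, so is every $\Gamma\in W_{\mathbb{Z}}(\Lambda)$. *)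

theory Defs
  imports "HOL-Analysis.Analysis" "HOL-Probability.Essential_Supremum"
begin

text \<open>
  Exponents \<open>1 \<le> p \<le> \<infinity>\<close> are elements of \<^typ>\<open>ennreal\<close>, and norms take values in \<^typ>\<open>ennreal\<close>,
  so that no divergent sum or integral is silently given the value \<open>0\<close>.
\<close>

definition epowr :: "ennreal \<Rightarrow> real \<Rightarrow> ennreal" where
  "epowr x a = (if x = \<infinity> then \<infinity> else ennreal (enn2real x powr a))"

definition Lp_norm :: "ennreal \<Rightarrow> (real \<Rightarrow> complex) \<Rightarrow> ennreal" where
  "Lp_norm p f =
    (if p = \<infinity> then esssup lborel (\<lambda>x. ennreal (norm (f x)))
     else epowr (\<integral>\<^sup>+x. ennreal (norm (f x) powr enn2real p) \<partial>lborel) (1 / enn2real p))"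

definition ellp_norm :: "ennreal \<Rightarrow> 'i set \<Rightarrow> ('i \<Rightarrow> complex) \<Rightarrow> ennreal" where
  "ellp_norm p I c =
    (if p = \<infinity> then (SUP i\<in>I. ennreal (norm (c i)))
     else epowr (\<Sum>\<^sub>\<infinity>i\<in>I. ennreal (norm (c i) powr enn2real p)) (1 / enn2real p))"

text \<open>
  Families indexed by \<open>I\<close> are represented by functions that vanish outside \<open>I\<close>, so that each
  family has exactly one representative.
\<close>

definition ellp :: "ennreal \<Rightarrow> 'i set \<Rightarrow> ('i \<Rightarrow> complex) set" where
  "ellp p I = {c. (\<forall>i. i \<notin> I \<longrightarrow> c i = 0) \<and> ellp_norm p I c < \<infinity>}"

text \<open>The supremum below is the maximum in the norm of \<open>W(C, \<ell>\<^sub>1)\<close>, as \<open>g\<close> is continuous.\<close>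

definition W0 :: "(real \<Rightarrow> complex) set" where
  "W0 = {g. continuous_on UNIV g \<and>
            (\<lambda>k::int. SUP x\<in>{of_int k..of_int k + 1}. norm (g x)) summable_on UNIV}"

text \<open>
  For \<open>g \<in> W0\<close> and bounded \<open>c\<close> the following series converges absolutely at every point.
\<close>

definition shift_sum :: "(real \<Rightarrow> complex) \<Rightarrow> (int \<Rightarrow> complex) \<Rightarrow> real \<Rightarrow> complex" where
  "shift_sum g c x = (\<Sum>\<^sub>\<infinity>k. c k * g (x - of_int k))"

definition V_space :: "ennreal \<Rightarrow> (real \<Rightarrow> complex) \<Rightarrow> (real \<Rightarrow> complex) set" where
  "V_space p g = shift_sum g ` ellp p UNIV"

text \<open>
  Of the equivalent descriptions of stability (for \<open>g \<in> W0\<close>), this is the norm inequality for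
  some exponent.
\<close>

definition stable_integer_shifts :: "(real \<Rightarrow> complex) \<Rightarrow> bool" where
  "stable_integer_shifts g \<longleftrightarrow>
    (\<exists>p\<ge>1. \<exists>C::real. C > 0 \<and>
      (\<forall>c\<in>ellp p UNIV. Lp_norm p (shift_sum g c) \<ge> ennreal C * ellp_norm p UNIV c))"

definition relatively_separated :: "real set \<Rightarrow> bool" where
  "relatively_separated \<Lambda> \<longleftrightarrow>
    (\<exists>N::nat. \<forall>x. finite (\<Lambda> \<inter> {x..x + 1}) \<and> card (\<Lambda> \<inter> {x..x + 1}) \<le> N)"

text \<open>In \<^typ>\<open>ennreal\<close> the supremum of the empty set is \<open>0\<close>.\<close>

definition sampling_set :: "ennreal \<Rightarrow> (real \<Rightarrow> complex) \<Rightarrow> real set \<Rightarrow> bool" where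
  "sampling_set p g \<Lambda> \<longleftrightarrow> relatively_separated \<Lambda> \<and>
    (\<exists>A B::real. A > 0 \<and> B > 0 \<and>
      (if p = \<infinity> then
         (\<forall>f\<in>V_space p g. ennreal A * Lp_norm p f \<le> (SUP \<mu>\<in>\<Lambda>. ennreal (norm (f \<mu>))) \<and>
                    (SUP \<mu>\<in>\<Lambda>. ennreal (norm (f \<mu>))) \<le> ennreal B * Lp_norm p f)
       else
         (\<forall>f\<in>V_space p g. ennreal A * epowr (Lp_norm p f) (enn2real p)
                      \<le> (\<Sum>\<^sub>\<infinity>\<mu>\<in>\<Lambda>. ennreal (norm (f \<mu>) powr enn2real p)) \<and>
                    (\<Sum>\<^sub>\<infinity>\<mu>\<in>\<Lambda>. ennreal (norm (f \<mu>) powr enn2real p))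
                      \<le> ennreal B * epowr (Lp_norm p f) (enn2real p))))"

definition uniqueness_set :: "ennreal \<Rightarrow> (real \<Rightarrow> complex) \<Rightarrow> real set \<Rightarrow> bool" where
  "uniqueness_set p g \<Lambda> \<longleftrightarrow> (\<forall>f\<in>V_space p g. (\<forall>\<mu>\<in>\<Lambda>. f \<mu> = 0) \<longrightarrow> f = (\<lambda>x. 0))"

text \<open>The sums \<open>\<Gamma> + {- \<epsilon><..<\<epsilon>}\<close> below are Minkowski sums.\<close>

definition weakly_converges :: "(nat \<Rightarrow> real set) \<Rightarrow> real set \<Rightarrow> bool" where
  "weakly_converges L \<Gamma> \<longleftrightarrow>
    (\<forall>a b \<epsilon>. a < b \<and> \<epsilon> > 0 \<longrightarrow>
      (\<exists>n0. \<forall>n\<ge>n0. L n \<inter> {a<..<b} \<subseteq> \<Gamma> + {- \<epsilon><..<\<epsilon>} \<and>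
                    \<Gamma> \<inter> {a<..<b} \<subseteq> L n + {- \<epsilon><..<\<epsilon>}))"

definition W\<^sub>Z :: "real set \<Rightarrow> real set set" where
  "W\<^sub>Z \<Lambda> = {\<Gamma>. \<exists>k :: nat \<Rightarrow> int. weakly_converges (\<lambda>n. (\<lambda>x. x + of_int (k n)) ` \<Lambda>) \<Gamma>}"

text \<open>
  A matrix with rows indexed by \<open>I\<close> and columns indexed by \<open>J\<close>, acting on families indexed by \<open>J\<close>.
\<close>

definition mat_apply ::
    "('i \<Rightarrow> 'j \<Rightarrow> complex) \<Rightarrow> 'i set \<Rightarrow> 'j set \<Rightarrow> ('j \<Rightarrow> complex) \<Rightarrow> 'i \<Rightarrow> complex" where
  "mat_apply M I J c i = (if i \<in> I then (\<Sum>\<^sub>\<infinity>j\<in>J. M i j * c j) else 0)"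

definition defines_operator ::
    "ennreal \<Rightarrow> ('i \<Rightarrow> 'j \<Rightarrow> complex) \<Rightarrow> 'i set \<Rightarrow> 'j set \<Rightarrow> bool" where
  "defines_operator p M I J \<longleftrightarrow>
    (\<forall>c\<in>ellp p J. (\<forall>i\<in>I. (\<lambda>j. M i j * c j) summable_on J) \<and> mat_apply M I J c \<in> ellp p I)"

definition bounded_operator ::
    "ennreal \<Rightarrow> ('i \<Rightarrow> 'j \<Rightarrow> complex) \<Rightarrow> 'i set \<Rightarrow> 'j set \<Rightarrow> bool" where
  "bounded_operator p M I J \<longleftrightarrow>
    (\<exists>B::real. \<forall>c\<in>ellp p J. ellp_norm p I (mat_apply M I J c) \<le> ennreal B * ellp_norm p J c)"

definition injective_operator ::
    "ennreal \<Rightarrow> ('i \<Rightarrow> 'j \<Rightarrow> complex) \<Rightarrow> 'i set \<Rightarrow> 'j set \<Rightarrow> bool" where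
  "injective_operator p M I J \<longleftrightarrow> inj_on (mat_apply M I J) (ellp p J)"

definition dense_range ::
    "ennreal \<Rightarrow> ('i \<Rightarrow> 'j \<Rightarrow> complex) \<Rightarrow> 'i set \<Rightarrow> 'j set \<Rightarrow> bool" where
  "dense_range p M I J \<longleftrightarrow>
    (\<forall>d\<in>ellp p I. \<forall>\<epsilon>::real. \<epsilon> > 0 \<longrightarrow>
      (\<exists>c\<in>ellp p J. ellp_norm p I (\<lambda>i. d i - mat_apply M I J c i) < ennreal \<epsilon>))"

definition P_mat :: "(real \<Rightarrow> complex) \<Rightarrow> real \<Rightarrow> int \<Rightarrow> complex" where
  "P_mat g \<gamma> k = g (\<gamma> - of_int k)"

definition P_mat_transpose :: "(real \<Rightarrow> complex) \<Rightarrow> int \<Rightarrow> real \<Rightarrow> complex" where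
  "P_mat_transpose g k \<gamma> = g (\<gamma> - of_int k)"

end

theory Submission
  imports Defs "HOL-Complex_Analysis.Great_Picard"
begin

text \<open>
  Let \<open>S j c\<close> be the supremum of \<open>\<bar>\<Sum>\<^sub>k c\<^sub>k g(x - k)\<bar>\<close> over the sampling points in the cell
  \<open>[j, j + 1)\<close>; it is a seminorm in \<open>c\<close>, dominated by the convolution of \<open>\<bar>c\<bar>\<close> with a summable
  sequence. Sampling for \<open>V\<^sup>p(g)\<close> means that \<open>c \<mapsto> (S j c)\<^sub>j\<close> is bounded below on \<open>\<ell>\<^sup>p\<close>, and
  following Sjoestrand such a bound can be localised: testing it on \<open>c\<close> times the window
  \<open>\<theta>\<^bsup>\<bar>k - m\<bar>\<^esup>\<close> costs a commutator error that is a convolution of the local norms whose total mass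
  tends to \<open>0\<close> as \<open>\<theta> \<rightarrow> 1\<close>. Taking the norm of any other exponent in \<open>m\<close> and absorbing the error
  makes the lower bound independent of the exponent, and taking limits in the localised bound
  carries it over to weak limits. With the integral over a cell in place of the supremum, the same
  principle gives stability of the shifts for all exponents. Conversely, if \<open>\<Lambda>\<close> is not sampling for
  \<open>V\<^sup>\<infinity>(g)\<close>, almost vanishing normalised coefficients, shifted so that they are large at \<open>0\<close>, converge
  along a subsequence to a nonzero function that vanishes on a weak limit of translates of \<open>\<Lambda>\<close>.
  The last equivalence is the duality of \<open>\<ell>\<^sup>1\<close> and \<open>\<ell>\<^sup>\<infinity>\<close>.
\<close>

section \<open>Powers and sums of extended nonnegative reals\<close>

text \<open>One seminorm per unit cell turns the sampling norms into norms of sequences over the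
  integers, so a single translation-invariant setting serves all exponents.

  Stability is assumed at one unspecified exponent, whereas sampling at exponent p is measured
  against the L^p norm of the function. The change of exponent acts on coefficient sequences and
  cell seminorms, not on L^p norms, and cell suprema cannot be bounded by an L^p norm before
  stability at p is known. Hence a detour: cell suprema dominate the L^q norm, so stability at q
  bounds them from below; after a change of exponent this gives injectivity on bounded coefficients;
  compactness turns injectivity into a lower bound for cell means at exponent infinity; and cell
  means, after a second change of exponent, are dominated by the L^p norm through Jensen's
  inequality.

  Weak convergence only sees bounded intervals, so a global supremum over sampling points need not
  pass to the limit. In the localised inequality the window makes far cells negligible, and what
  remains is uniform continuity on a compact interval.\<close>

lemma epowr_ennreal: "0 \<le> x \<Longrightarrow> epowr (ennreal x) a = ennreal (x powr a)"
  by (simp add: epowr_def)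

lemma epowr_top [simp]: "epowr top a = top"
  by (simp add: epowr_def)

lemma epowr_zero [simp]: "epowr 0 a = 0"
  by (simp add: epowr_def)

lemma epowr_1 [simp]: "epowr x 1 = x"
  by (cases x) (auto simp: epowr_def)

lemma epowr_one [simp]: "epowr 1 a = 1"
  by (simp add: epowr_def)

lemma epowr_mono: "0 \<le> a \<Longrightarrow> x \<le> y \<Longrightarrow> epowr x a \<le> epowr y a"
  by (cases x; cases y) (auto simp: epowr_ennreal top_unique intro!: ennreal_leI powr_mono2)

lemma epowr_mult: "0 < a \<Longrightarrow> epowr (x * y) a = epowr x a * epowr y a"
proof (cases x; cases y)
  fix r s :: real
  assume "0 < a" "0 \<le> r" "x = ennreal r" "0 \<le> s" "y = ennreal s"
  then show ?thesis
    by (simp add: epowr_ennreal powr_mult flip: ennreal_mult)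
next
  fix r :: real
  assume "0 < a" "0 \<le> r" "x = ennreal r" "y = top"
  then show ?thesis
    by (cases "r = 0") (auto simp: epowr_ennreal ennreal_mult_top)
next
  fix r :: real
  assume "0 < a" "0 \<le> r" "y = ennreal r" "x = top"
  then show ?thesis
    by (cases "r = 0") (auto simp: epowr_ennreal ennreal_top_mult)
qed auto

lemma epowr_epowr_inverse [simp]:
  assumes "0 < a"
  shows "epowr (epowr x a) (1 / a) = x" "epowr (epowr x (1 / a)) a = x"
  using assms by (cases x; simp add: epowr_ennreal powr_powr)+

lemma epowr_le_iff: "0 < a \<Longrightarrow> epowr x (1 / a) \<le> y \<longleftrightarrow> x \<le> epowr y a"
  by (metis epowr_epowr_inverse epowr_mono less_imp_le zero_less_divide_1_iff)

lemma measurable_epowr [measurable]: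
  "f \<in> borel_measurable M \<Longrightarrow> (\<lambda>x. epowr (f x) a) \<in> borel_measurable M"
  unfolding epowr_def by (intro measurable_If) simp_all

text \<open>Convexity of the power function: the graph lies above its tangent at \<open>t\<close>.
  The negative constant of the tangent stands on the other side, because subtraction in
  \<open>ennreal\<close> truncates.\<close>

lemma epowr_tangent:
  assumes "0 < t" "1 \<le> r"
  shows "ennreal (r * t powr (r - 1)) * y \<le> epowr y r + ennreal ((r - 1) * t powr r)"
proof (cases y)
  case (real u)
  have "r * t powr (r - 1) * u \<le> u powr r + (r - 1) * t powr r"
  proof (cases "u = 0")
    case False
    then have u: "u > 0" using real by simp
    \<comment> \<open>Weighted arithmetic-geometric mean of \<open>(u / t) powr r\<close> and 1,
      with weights \<open>1 / r\<close> and \<open>1 - 1 / r\<close>.\<close>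
    have "((u / t) powr r) powr (1 / r) * 1 powr (1 - 1 / r) \<le> 1 / r * (u / t) powr r + (1 - 1 / r) * 1"
      using assms u by (intro Youngs_inequality_0) (auto simp: field_simps)
    then have "u / t \<le> 1 / r * (u / t) powr r + (1 - 1 / r)"
      using assms u by (simp add: powr_powr)
    then have "r * (u / t) \<le> r * (1 / r * (u / t) powr r + (1 - 1 / r))"
      using assms by (intro mult_left_mono) auto
    also have "\<dots> = (u / t) powr r + (r - 1)"
      using assms by (simp add: distrib_left right_diff_distrib)
    finally have "r * (u / t) \<le> (u / t) powr r + (r - 1)" .
    then have "t powr r * (r * (u / t)) \<le> t powr r * ((u / t) powr r + (r - 1))"
      by (intro mult_left_mono) auto
    moreover have "t powr r * (u / t) powr r = u powr r"
      using assms u by (simp add: powr_divide)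
    moreover have "t powr r * (r * (u / t)) = r * t powr (r - 1) * u"
      using assms by (simp add: powr_diff)
    ultimately show ?thesis by (simp add: algebra_simps)
  qed (use assms in simp)
  then show ?thesis
    using real assms by (simp add: epowr_ennreal ennreal_leI flip: ennreal_mult ennreal_plus)
qed simp

text \<open>The tangent inequality is integrated against the probability density \<open>p\<close>
  and used with the point of tangency at the mean.\<close>

lemma Jensen_epowr:
  assumes [measurable]: "p \<in> borel_measurable M" "y \<in> borel_measurable M"
    and p: "(\<integral>\<^sup>+x. p x \<partial>M) = 1" and r: "1 \<le> r"
  shows "epowr (\<integral>\<^sup>+x. p x * y x \<partial>M) r \<le> (\<integral>\<^sup>+x. p x * epowr (y x) r \<partial>M)" (is "epowr ?I r \<le> ?J")
proof -
  have key: "ennreal (r * t powr (r - 1)) * ?I \<le> ?J + ennreal ((r - 1) * t powr r)" if "0 < t" for t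
  proof -
    have "ennreal (r * t powr (r - 1)) * ?I = (\<integral>\<^sup>+x. p x * (ennreal (r * t powr (r - 1)) * y x) \<partial>M)"
      by (simp add: nn_integral_cmult[symmetric] mult_ac)
    also have "\<dots> \<le> (\<integral>\<^sup>+x. p x * (epowr (y x) r + ennreal ((r - 1) * t powr r)) \<partial>M)"
      by (intro nn_integral_mono mult_left_mono epowr_tangent that r) auto
    also have "\<dots> = ?J + (\<integral>\<^sup>+x. p x * ennreal ((r - 1) * t powr r) \<partial>M)"
      by (simp add: nn_integral_add distrib_left)
    also have "(\<integral>\<^sup>+x. p x * ennreal ((r - 1) * t powr r) \<partial>M) = ennreal ((r - 1) * t powr r)"
      by (simp add: nn_integral_multc p)
    finally show ?thesis .
  qed
  show ?thesis
  proof (cases ?I)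
    case (real t)
    show ?thesis
    proof (cases "t = 0")
      case False
      then have t: "0 < t" using real by simp
      \<comment> \<open>With \<open>t\<close> equal to the mean, the linear term is the wanted power
        plus exactly the constant that is to be cancelled.\<close>
      have "ennreal (r * t powr (r - 1)) * ?I = ennreal (t powr r) + ennreal ((r - 1) * t powr r)"
        using t r unfolding real
        by (simp add: powr_diff algebra_simps flip: ennreal_mult ennreal_plus)
      with key[OF t] have "ennreal (t powr r) + ennreal ((r - 1) * t powr r) \<le> ?J + ennreal ((r - 1) * t powr r)"
        by simp
      then have "ennreal (t powr r) \<le> ?J"
        by (simp add: ennreal_add_left_cancel_le add.commute)
      then show ?thesis using t unfolding real by (simp add: epowr_ennreal)
    qed (simp add: real)
  next
    case top
    \<comment> \<open>An infinite mean is no point of tangency, but any tangent of positive slope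
      already forces the right-hand side to be infinite.\<close>
    with key[of 1] r have "?J = top"
      by (auto simp: ennreal_mult_top top_unique)
    then show ?thesis by simp
  qed
qed

section \<open>Unordered sums as integrals against counting measure, where Fubini and the
  convergence theorems apply\<close>

lemma infsum_ennreal_eq_nn_integral:
  fixes f :: "'a \<Rightarrow> ennreal"
  assumes "countable I"
  shows "(\<Sum>\<^sub>\<infinity>i\<in>I. f i) = (\<integral>\<^sup>+i. f i \<partial>count_space I)"
proof -
  have sup: "(\<Sum>\<^sub>\<infinity>i\<in>I. f i) = (SUP F\<in>{F. finite F \<and> F \<subseteq> I}. sum f F)"
    by (simp add: nonneg_infsum_complete)
  show ?thesis
  proof (rule antisym)
    show "(\<Sum>\<^sub>\<infinity>i\<in>I. f i) \<le> (\<integral>\<^sup>+i. f i \<partial>count_space I)"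
      unfolding sup
    proof (rule SUP_least, clarify)
      fix F assume F: "finite F" "F \<subseteq> I"
      have "sum f F = (\<integral>\<^sup>+i. f i \<partial>count_space F)"
        by (simp add: nn_integral_count_space_finite F)
      also have "\<dots> \<le> (\<integral>\<^sup>+i. f i \<partial>count_space I)"
        using F by (subst (1 2) nn_integral_count_space_indicator)
          (auto intro!: nn_integral_mono simp: split: split_indicator)
      finally show "sum f F \<le> (\<integral>\<^sup>+i. f i \<partial>count_space I)" .
    qed
    show "(\<integral>\<^sup>+i. f i \<partial>count_space I) \<le> (\<Sum>\<^sub>\<infinity>i\<in>I. f i)"
    proof (cases "finite I")
      case False
      define e where "e = from_nat_into I"
      have e: "bij_betw e UNIV I"
        unfolding e_def using assms False by (rule bij_betw_from_nat_into)
      have "(\<integral>\<^sup>+i. f i \<partial>count_space I) = (\<Sum>n. f (e n))"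
        by (simp add: nn_integral_bij_count_space[OF e, symmetric] nn_integral_count_space_nat)
      also have "\<dots> \<le> (\<Sum>\<^sub>\<infinity>i\<in>I. f i)"
        unfolding suminf_eq_SUP
      proof (rule SUP_least)
        fix n
        have "(\<Sum>i<n. f (e i)) = sum f (e ` {..<n})"
          using e by (subst sum.reindex) (auto simp: bij_betw_def intro: inj_on_subset)
        also have "\<dots> \<le> (\<Sum>\<^sub>\<infinity>i\<in>I. f i)"
          unfolding sup using e by (intro SUP_upper) (auto simp: bij_betw_def)
        finally show "(\<Sum>i<n. f (e i)) \<le> (\<Sum>\<^sub>\<infinity>i\<in>I. f i)" .
      qed
      finally show ?thesis .
    qed (simp add: nn_integral_count_space_finite)
  qed
qed

lemma sum_le_nn_integral_count_space:
  fixes f :: "'a \<Rightarrow> ennreal"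
  assumes "finite F" "F \<subseteq> I"
  shows "sum f F \<le> (\<integral>\<^sup>+i. f i \<partial>count_space I)"
proof -
  have "sum f F = (\<integral>\<^sup>+i. f i * indicator F i \<partial>count_space I)"
    using assms by (subst nn_integral_count_space'[of F]) (auto simp: indicator_def)
  also have "\<dots> \<le> (\<integral>\<^sup>+i. f i \<partial>count_space I)"
    by (intro nn_integral_mono) (auto split: split_indicator)
  finally show ?thesis .
qed

lemma abs_summable_on_ennreal:
  fixes f :: "'a \<Rightarrow> 'b :: banach"
  assumes "(\<integral>\<^sup>+i. ennreal (norm (f i)) \<partial>count_space I) < \<infinity>"
  shows "(\<lambda>i. norm (f i)) summable_on I"
proof (rule nonneg_bdd_above_summable_on)
  show "bdd_above (sum (\<lambda>i. norm (f i)) ` {F. F \<subseteq> I \<and> finite F})"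
  proof (rule bdd_aboveI2)
    fix F assume "F \<in> {F. F \<subseteq> I \<and> finite F}"
    then have "ennreal (\<Sum>i\<in>F. norm (f i)) \<le> (\<integral>\<^sup>+i. ennreal (norm (f i)) \<partial>count_space I)"
      using sum_le_nn_integral_count_space[of F I "\<lambda>i. ennreal (norm (f i))"] by simp
    then show "(\<Sum>i\<in>F. norm (f i)) \<le> enn2real (\<integral>\<^sup>+i. ennreal (norm (f i)) \<partial>count_space I)"
      using assms by (metis enn2real_ennreal enn2real_mono infinity_ennreal_def sum_nonneg norm_ge_zero)
  qed
qed auto

lemma norm_infsum_le_nn_integral:
  fixes f :: "'a \<Rightarrow> 'b :: banach"
  shows "ennreal (norm (\<Sum>\<^sub>\<infinity>i\<in>I. f i)) \<le> (\<integral>\<^sup>+i. ennreal (norm (f i)) \<partial>count_space I)" (is "_ \<le> ?M")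
proof (cases "?M < \<infinity>")
  case True
  then have "(\<lambda>i. norm (f i)) summable_on I" by (rule abs_summable_on_ennreal)
  then have "(f has_sum (\<Sum>\<^sub>\<infinity>i\<in>I. f i)) I"
    by (simp add: abs_summable_summable)
  then have lim: "((\<lambda>F. norm (sum f F)) \<longlongrightarrow> norm (\<Sum>\<^sub>\<infinity>i\<in>I. f i)) (finite_subsets_at_top I)"
    unfolding has_sum_def by (intro tendsto_norm)
  have "norm (\<Sum>\<^sub>\<infinity>i\<in>I. f i) \<le> enn2real ?M"
  proof (rule tendsto_upperbound[OF lim])
    show "\<forall>\<^sub>F F in finite_subsets_at_top I. norm (sum f F) \<le> enn2real ?M"
    proof (rule eventually_finite_subsets_at_top_weakI)
      fix F assume F: "finite F" "F \<subseteq> I"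
      have "ennreal (norm (sum f F)) \<le> ennreal (\<Sum>i\<in>F. norm (f i))"
        by (intro ennreal_leI norm_sum)
      also have "\<dots> \<le> ?M"
        using sum_le_nn_integral_count_space[of F I "\<lambda>i. ennreal (norm (f i))"] F by simp
      finally show "norm (sum f F) \<le> enn2real ?M"
        using True by (metis enn2real_ennreal enn2real_mono infinity_ennreal_def norm_ge_zero)
    qed
  qed simp
  then have "ennreal (norm (\<Sum>\<^sub>\<infinity>i\<in>I. f i)) \<le> ennreal (enn2real ?M)"
    by (rule ennreal_leI)
  then show ?thesis using True by (metis ennreal_enn2real infinity_ennreal_def)
qed (simp add: not_less top_unique)

lemma nn_integral_count_space_infsum:
  assumes "countable I" "f summable_on I" "\<And>i. i \<in> I \<Longrightarrow> 0 \<le> f i"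
  shows "(\<integral>\<^sup>+i. ennreal (f i) \<partial>count_space I) = ennreal (infsum f I)"
proof -
  have "(\<integral>\<^sup>+i. ennreal (f i) \<partial>count_space I) = (SUP F\<in>{F. finite F \<and> F \<subseteq> I}. \<Sum>i\<in>F. ennreal (f i))"
    using assms(1) by (simp add: infsum_ennreal_eq_nn_integral[symmetric] nonneg_infsum_complete)
  also have "\<dots> = (SUP F\<in>{F. finite F \<and> F \<subseteq> I}. ennreal (sum f F))"
    using assms(3) by (intro SUP_cong refl sum_ennreal) auto
  also have "\<dots> = ennreal (infsum f I)"
    by (rule infsum_nonneg_is_SUPREMUM_ennreal[OF assms(2,3), symmetric])
  finally show ?thesis .
qed

section \<open>Translation-invariant norms and the \<open>\<ell>\<^sup>p\<close> norms\<close>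

abbreviation Sig :: "('i \<Rightarrow> ennreal) \<Rightarrow> ennreal" where
  "Sig f \<equiv> \<integral>\<^sup>+i. f i \<partial>count_space UNIV"

lemma Sig_shift: "Sig (\<lambda>i::int. f (i + s)) = Sig f"
  by (rule nn_integral_bij_count_space) (auto intro!: bij_betwI[where g = "\<lambda>i. i - s"])

lemma Sig_reflect: "Sig (\<lambda>i::int. f (s - i)) = Sig f"
  by (rule nn_integral_bij_count_space) (auto intro!: bij_betwI[where g = "\<lambda>i. s - i"])

lemma Sig_swap:
  fixes f :: "'i::countable \<Rightarrow> 'j \<Rightarrow> ennreal"
  shows "Sig (\<lambda>i. Sig (f i)) = Sig (\<lambda>j. Sig (\<lambda>i. f i j))"
  by (rule nn_integral_count_space_nn_integral[symmetric]) auto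

text \<open>The properties that all \<open>\<ell>\<close> norms share, exponent infinity included.
  Countable subadditivity makes convolution inequalities immediate. The last two axioms place
  \<open>N\<close> between the supremum norm and the sum norm: a sequence of finite norm is bounded,
  and a bounded sequence times a summable window has finite norm.\<close>

locale shift_norm =
  fixes N :: "(int \<Rightarrow> ennreal) \<Rightarrow> ennreal"
  assumes mono: "(\<And>i. x i \<le> y i) \<Longrightarrow> N x \<le> N y"
    and countable_subadd: "N (\<lambda>i. Sig (\<lambda>s::int. X s i)) \<le> Sig (\<lambda>s. N (X s))"
    and cmult: "N (\<lambda>i. t * x i) = t * N x"
    and shift: "N (\<lambda>i. x (i + s)) = N x"
    and point_le: "x i \<le> N x"
    and le_Sig: "N x \<le> Sig x"
begin

text \<open>A family with two nonzero members, placed at the indices 0 and 1.\<close>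

lemma subadd: "N (\<lambda>i. x i + y i) \<le> N x + N y"
proof -
  define z :: "int \<Rightarrow> int \<Rightarrow> ennreal" where
    "z s = (if s = 0 then x else if s = 1 then y else (\<lambda>_. 0))" for s
  have N0: "N (\<lambda>_. 0) = 0"
    using cmult[of 0 "\<lambda>_. 0"] by simp
  have 1: "Sig (\<lambda>s. z s i) = x i + y i" for i
    by (subst nn_integral_count_space'[of "{0, 1}"]) (auto simp: z_def)
  have "Sig (\<lambda>s. N (z s)) = N x + N y"
    by (subst nn_integral_count_space'[of "{0, 1}"]) (auto simp: z_def N0)
  with countable_subadd[of z] show ?thesis
    by (simp add: 1)
qed

text \<open>A convolution is a superposition of translates, and all translates have the same
  norm.\<close>

lemma convolution_le:
  "N (\<lambda>m. Sig (\<lambda>s. h s * x (m - s))) \<le> Sig h * N x"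
proof -
  have "N (\<lambda>m. Sig (\<lambda>s. h s * x (m - s))) \<le> Sig (\<lambda>s. N (\<lambda>m. h s * x (m - s)))"
    by (rule countable_subadd)
  also have "\<dots> = Sig (\<lambda>s. h s * N x)"
    using shift[of x "- s" for s] by (simp add: cmult)
  finally show ?thesis by (simp add: nn_integral_multc)
qed

end

text \<open>Takes extended nonnegative sequences, because it is also applied to cell seminorms and
  to convolutions whose finiteness is not known in advance.\<close>

definition ell_norm :: "ennreal \<Rightarrow> ('i \<Rightarrow> ennreal) \<Rightarrow> ennreal" where
  "ell_norm p x = (if p = \<infinity> then (SUP i. x i)
     else epowr (Sig (\<lambda>i. epowr (x i) (enn2real p))) (1 / enn2real p))"

lemma ellp_norm_eq_ell_norm:
  fixes c :: "'i::countable \<Rightarrow> complex"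
  shows "ellp_norm p UNIV c = ell_norm p (\<lambda>i. ennreal (norm (c i)))"
  by (simp add: ellp_norm_def ell_norm_def epowr_ennreal infsum_ennreal_eq_nn_integral)

lemma one_le_enn2real: "1 \<le> p \<Longrightarrow> p \<noteq> \<infinity> \<Longrightarrow> 1 \<le> enn2real p"
  by (cases p) (auto simp: ennreal_le_iff2 simp flip: ennreal_1)

lemma epowr_ell_norm:
  "1 \<le> p \<Longrightarrow> p \<noteq> \<infinity> \<Longrightarrow> epowr (ell_norm p x) (enn2real p) = Sig (\<lambda>i. epowr (x i) (enn2real p))"
  using one_le_enn2real[of p] by (simp add: ell_norm_def)

lemma ell_norm_le_iff:
  "1 \<le> p \<Longrightarrow> p \<noteq> \<infinity> \<Longrightarrow>
    ell_norm p x \<le> y \<longleftrightarrow> Sig (\<lambda>i. epowr (x i) (enn2real p)) \<le> epowr y (enn2real p)"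
  using one_le_enn2real[of p] by (simp add: ell_norm_def epowr_le_iff)

lemma ell_norm_point_le:
  assumes "1 \<le> p"
  shows "x i \<le> ell_norm p x"
proof (cases "p = \<infinity>")
  case False
  have "epowr (x i) (enn2real p) \<le> Sig (\<lambda>i. epowr (x i) (enn2real p))"
    by (rule nn_integral_ge_point) simp
  then have "epowr (epowr (x i) (enn2real p)) (1 / enn2real p) \<le> ell_norm p x"
    unfolding ell_norm_def using False by (auto intro: epowr_mono)
  then show ?thesis using one_le_enn2real[OF assms False] by simp
qed (auto simp: ell_norm_def intro: SUP_upper)

lemma ell_norm_cmult:
  assumes "1 \<le> p"
  shows "ell_norm p (\<lambda>i. t * x i) = t * ell_norm p x"
proof (cases "p = \<infinity>")
  case False
  then show ?thesis using one_le_enn2real[OF assms False]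
    by (simp add: ell_norm_def epowr_mult nn_integral_cmult)
qed (simp add: ell_norm_def SUP_mult_left_ennreal)

lemma ell_norm_mono:
  assumes "1 \<le> p" "\<And>i. x i \<le> y i"
  shows "ell_norm p x \<le> ell_norm p y"
proof (cases "p = \<infinity>")
  case False
  then show ?thesis using one_le_enn2real[OF assms(1) False] assms(2)
    by (auto simp: ell_norm_def intro!: epowr_mono nn_integral_mono)
qed (auto simp: ell_norm_def intro!: SUP_mono assms)

text \<open>With \<open>\<alpha> s\<close> the norm of \<open>x s\<close> and \<open>?A\<close> the
  sum of these norms, the sum over \<open>s\<close> is \<open>?A\<close> times an average, with
  weights \<open>\<alpha> s / ?A\<close>, of the normalised sequences
  \<open>x s / \<alpha> s\<close>. Jensen moves the power inside the average, and after exchanging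
  the sums each normalised sequence contributes at most 1.\<close>

lemma ell_norm_Minkowski:
  fixes x :: "'j::countable \<Rightarrow> 'i::countable \<Rightarrow> ennreal"
  assumes p: "1 \<le> p"
  shows "ell_norm p (\<lambda>i. Sig (\<lambda>s. x s i)) \<le> Sig (\<lambda>s. ell_norm p (x s))" (is "?L \<le> ?A")
proof (cases "p = \<infinity>")
  case True
  then show ?thesis
    by (auto simp: ell_norm_def intro!: SUP_least nn_integral_mono SUP_upper)
next
  case False
  define r where "r = enn2real p"
  have r: "1 \<le> r" unfolding r_def by (rule one_le_enn2real[OF p False])
  consider "?A = top" | "?A = 0" | "?A \<noteq> 0" "?A \<noteq> top" by blast
  then show ?thesis
  proof cases
    case 2
    then have "ell_norm p (x s) = 0" for s
      by (metis (no_types, lifting) UNIV_I le_zero_eq nn_integral_ge_point)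
    then have "x s i = 0" for s i
      using ell_norm_point_le[OF p, of "x s" i] by (metis le_zero_eq)
    then show ?thesis using False by (simp add: ell_norm_def)
  next
    case 3
    define \<alpha> where "\<alpha> s = ell_norm p (x s)" for s
    have \<alpha>_fin: "\<alpha> s \<noteq> top" for s
      using 3(2) nn_integral_ge_point[of s UNIV \<alpha>] by (auto simp: \<alpha>_def top_unique)
    have x_zero: "x s i = 0" if "\<alpha> s = 0" for s i
      using ell_norm_point_le[OF p, of "x s" i] that by (simp add: \<alpha>_def)
    have norm_1: "Sig (\<lambda>s. \<alpha> s / ?A) = 1"
      using 3 by (simp add: nn_integral_divide \<alpha>_def ennreal_divide_self less_top)
    have split: "x s i = ?A * ((\<alpha> s / ?A) * (x s i / \<alpha> s))" for s i
    proof (cases "\<alpha> s = 0")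
      case False
      have "?A * ((\<alpha> s / ?A) * (x s i / \<alpha> s)) = (?A / ?A) * ((\<alpha> s / \<alpha> s) * x s i)"
        by (simp add: ennreal_times_divide mult_ac divide_ennreal_def)
      then show ?thesis
        using 3 False \<alpha>_fin by (simp add: ennreal_divide_self less_top)
    qed (simp add: x_zero)
    have "Sig (\<lambda>i. epowr (Sig (\<lambda>s. x s i)) r)
        = Sig (\<lambda>i. epowr (?A * Sig (\<lambda>s. (\<alpha> s / ?A) * (x s i / \<alpha> s))) r)"
      by (subst split) (simp add: nn_integral_cmult)
    also have "\<dots> = epowr ?A r * Sig (\<lambda>i. epowr (Sig (\<lambda>s. (\<alpha> s / ?A) * (x s i / \<alpha> s))) r)"
      using r by (simp add: epowr_mult nn_integral_cmult)
    also have "\<dots> \<le> epowr ?A r * Sig (\<lambda>i. Sig (\<lambda>s. (\<alpha> s / ?A) * epowr (x s i / \<alpha> s) r))"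
      by (intro mult_left_mono nn_integral_mono Jensen_epowr norm_1 r) auto
    also have "Sig (\<lambda>i. Sig (\<lambda>s. (\<alpha> s / ?A) * epowr (x s i / \<alpha> s) r))
        = Sig (\<lambda>s. (\<alpha> s / ?A) * Sig (\<lambda>i. epowr (x s i / \<alpha> s) r))"
      by (subst Sig_swap) (simp add: nn_integral_cmult)
    also have "epowr ?A r * \<dots> \<le> epowr ?A r * Sig (\<lambda>s. (\<alpha> s / ?A) * 1)"
    proof (intro nn_integral_mono mult_left_mono)
      fix s
      have "ell_norm p (\<lambda>i. x s i / \<alpha> s) = \<alpha> s / \<alpha> s"
        using ell_norm_cmult[OF p, of "inverse (\<alpha> s)" "x s"]
        by (simp add: divide_ennreal_def mult.commute \<alpha>_def)
      \<comment> \<open>Only an inequality, since the quotient is 0 rather than 1 when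
        \<open>\<alpha> s = 0\<close>.\<close>
      also have "\<dots> \<le> 1"
        using \<alpha>_fin[of s] by (cases "\<alpha> s = 0") (auto simp: ennreal_divide_self less_top)
      finally show "Sig (\<lambda>i. epowr (x s i / \<alpha> s) r) \<le> 1"
        using p False by (simp add: ell_norm_le_iff r_def)
    qed auto
    finally have "Sig (\<lambda>i. epowr (Sig (\<lambda>s. x s i)) r) \<le> epowr ?A r"
      by (simp add: norm_1)
    then show ?thesis using p False by (simp add: ell_norm_le_iff r_def)
  qed simp
qed

text \<open>Minkowski's inequality for the decomposition of \<open>x\<close> into its one-point
  pieces.\<close>

lemma ell_norm_le_Sig:
  fixes x :: "'i::countable \<Rightarrow> ennreal"
  assumes p: "1 \<le> p"
  shows "ell_norm p x \<le> Sig x"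
proof -
  have "ell_norm p (\<lambda>i. Sig (\<lambda>s. x s * indicator {s} i)) \<le> Sig (\<lambda>s. ell_norm p (\<lambda>i. x s * indicator {s} i))"
    by (rule ell_norm_Minkowski[OF p])
  moreover have "Sig (\<lambda>s. x s * indicator {s} i) = x i" for i
    by (subst nn_integral_count_space'[of "{i}"]) auto
  moreover have "ell_norm p (\<lambda>i. x s * indicator {s} i) \<le> x s" for s
  proof (cases "p = \<infinity>")
    case False
    have "Sig (\<lambda>i. epowr (x s * indicator {s} i) (enn2real p)) = epowr (x s) (enn2real p)"
      by (subst nn_integral_count_space'[of "{s}"]) auto
    then show ?thesis using p False by (simp add: ell_norm_le_iff)
  qed (auto simp: ell_norm_def intro!: SUP_least split: split_indicator)
  ultimately show ?thesis
    by (auto intro: order_trans[OF _ nn_integral_mono])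
qed

lemma shift_norm_ell_norm:
  assumes "1 \<le> p"
  shows "shift_norm (ell_norm p)"
proof
  fix x :: "int \<Rightarrow> ennreal" and s :: int
  have "surj (\<lambda>i. i + s)"
    by (metis surjI diff_add_cancel)
  then have "(SUP i. x (i + s)) = (SUP i. x i)"
    using image_image[of x "\<lambda>i. i + s" UNIV] by simp
  then show "ell_norm p (\<lambda>i. x (i + s)) = ell_norm p x"
    using Sig_shift[of "\<lambda>i. epowr (x i) (enn2real p)" s] by (simp add: ell_norm_def)
qed (use assms in \<open>auto intro: ell_norm_mono ell_norm_Minkowski ell_norm_cmult ell_norm_point_le ell_norm_le_Sig\<close>)

section \<open>Transfer of lower bounds between exponents\<close>

lemma bounded_range_mult:
  fixes c :: "'i \<Rightarrow> complex"
  assumes "bounded (range c)"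
  shows "bounded (range (\<lambda>k. z * c k))"
  using bounded_linear_image[OF assms bounded_linear_mult_right[of z]] by (simp add: image_image)

text \<open>The instances are the supremum over the sampling points of a cell and the integral over
  a cell. \<open>S_le\<close> expresses off-diagonal decay: \<open>S j\<close> sees the coefficient
  at \<open>k\<close> with weight \<open>w (j - k)\<close>, and the summability of \<open>w\<close>
  is what makes the commutator with a slowly varying window small.\<close>

locale local_seminorms =
  fixes S :: "int \<Rightarrow> (int \<Rightarrow> complex) \<Rightarrow> ennreal" and w :: "int \<Rightarrow> ennreal"
  assumes w_finite: "Sig w < \<infinity>"
    and S_add: "bounded (range c) \<Longrightarrow> bounded (range d) \<Longrightarrow> S j (\<lambda>k. c k + d k) \<le> S j c + S j d"
    and S_scale: "bounded (range c) \<Longrightarrow> 0 \<le> t \<Longrightarrow> S j (\<lambda>k. of_real t * c k) \<le> ennreal t * S j c"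
    and S_le: "bounded (range c) \<Longrightarrow> S j c \<le> Sig (\<lambda>k. w (j - k) * ennreal (norm (c k)))"

section \<open>Exponential windows and their commutators with local seminorms\<close>

definition exp_window :: "real \<Rightarrow> int \<Rightarrow> int \<Rightarrow> real" where
  "exp_window \<theta> m l = \<theta> ^ nat \<bar>l - m\<bar>"

lemma exp_window_nonneg: "0 < \<theta> \<Longrightarrow> 0 \<le> exp_window \<theta> m l"
  by (simp add: exp_window_def)

lemma exp_window_le_1: "0 < \<theta> \<Longrightarrow> \<theta> < 1 \<Longrightarrow> exp_window \<theta> m l \<le> 1"
  by (simp add: exp_window_def power_le_one)

lemma exp_window_self [simp]: "exp_window \<theta> m m = 1"
  by (simp add: exp_window_def)

text \<open>By the triangle inequality in the exponent, each of the two window values is at least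
  \<open>\<theta> ^ nat \<bar>j - l\<bar>\<close> times the other, so they differ by at most the
  complementary fraction of the larger one. The sum of both on the right avoids asking which is
  larger.\<close>

lemma exp_window_diff:
  assumes "0 < \<theta>" "\<theta> < 1"
  shows "\<bar>exp_window \<theta> m l - exp_window \<theta> m j\<bar>
    \<le> (1 - \<theta> ^ nat \<bar>j - l\<bar>) * (exp_window \<theta> m l + exp_window \<theta> m j)"
proof -
  have le: "\<theta> ^ nat \<bar>j - l\<bar> * exp_window \<theta> m l \<le> exp_window \<theta> m j" for j l
  proof -
    have "\<theta> ^ nat \<bar>j - l\<bar> * exp_window \<theta> m l = \<theta> ^ (nat \<bar>j - l\<bar> + nat \<bar>l - m\<bar>)"
      by (simp add: exp_window_def power_add)
    also have "\<dots> \<le> \<theta> ^ nat \<bar>j - m\<bar>"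
      using assms by (intro power_decreasing) auto
    finally show ?thesis by (simp add: exp_window_def)
  qed
  have 1: "\<theta> ^ nat \<bar>j - l\<bar> * exp_window \<theta> m l \<le> exp_window \<theta> m j"
    by (rule le)
  have 2: "\<theta> ^ nat \<bar>j - l\<bar> * exp_window \<theta> m j \<le> exp_window \<theta> m l"
    using le[of l j] by (simp add: abs_minus_commute)
  have 3: "\<theta> ^ nat \<bar>j - l\<bar> \<le> 1"
    using assms by (simp add: power_le_one)
  have "0 \<le> (1 - \<theta> ^ nat \<bar>j - l\<bar>) * exp_window \<theta> m j"
       "0 \<le> (1 - \<theta> ^ nat \<bar>j - l\<bar>) * exp_window \<theta> m l"
    using 3 assms by (intro mult_nonneg_nonneg exp_window_nonneg; simp)+
  with 1 2 show ?thesis unfolding abs_le_iff by (simp add: algebra_simps)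
qed

text \<open>Comparison with a geometric series in which every \<open>n\<close> is counted at both
  \<open>n\<close> and \<open>- n\<close>; that 0 is counted twice is harmless for an upper
  bound.\<close>

lemma Sig_exp_window_finite:
  assumes "0 < \<theta>" "\<theta> < 1"
  shows "Sig (\<lambda>l. ennreal (exp_window \<theta> 0 l)) < \<infinity>"
proof -
  have "Sig (\<lambda>l. ennreal (exp_window \<theta> 0 l))
     \<le> Sig (\<lambda>l. Sig (\<lambda>n::nat. ennreal (\<theta> ^ n) * (indicator {l} (int n) + indicator {l} (- int n))))"
  proof (rule nn_integral_mono)
    fix l
    have "ennreal (exp_window \<theta> 0 l) \<le> ennreal (\<theta> ^ nat \<bar>l\<bar>) *
        (indicator {l} (int (nat \<bar>l\<bar>)) + indicator {l} (- int (nat \<bar>l\<bar>)))"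
      by (cases "l \<ge> 0") (auto simp: exp_window_def abs_if indicator_def distrib_left)
    also have "\<dots> \<le> Sig (\<lambda>n::nat. ennreal (\<theta> ^ n) * (indicator {l} (int n) + indicator {l} (- int n)))"
      by (rule nn_integral_ge_point) simp
    finally show "ennreal (exp_window \<theta> 0 l) \<le> \<dots>" .
  qed
  also have "\<dots> = Sig (\<lambda>n. Sig (\<lambda>l. ennreal (\<theta> ^ n) * (indicator {l} (int n) + indicator {l} (- int n))))"
    by (rule Sig_swap)
  also have "\<dots> = Sig (\<lambda>n. ennreal (\<theta> ^ n) * 2)"
  proof (rule nn_integral_cong)
    fix n :: nat
    have "Sig (\<lambda>l. indicator {l} (int n) + indicator {l} (- int n)) =
        Sig (\<lambda>l. indicator {int n} l) + Sig (\<lambda>l. indicator {- int n} l)"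
      by (subst nn_integral_add[symmetric]) (auto intro!: nn_integral_cong simp: indicator_def)
    also have "\<dots> = 2" by simp
    finally show "Sig (\<lambda>l. ennreal (\<theta> ^ n) * (indicator {l} (int n) + indicator {l} (- int n))) = ennreal (\<theta> ^ n) * 2"
      by (simp add: nn_integral_cmult)
  qed
  also have "\<dots> = ennreal (1 / (1 - \<theta>)) * 2"
    using assms
    by (simp add: nn_integral_multc nn_integral_count_space_nat suminf_ennreal2 summable_geometric suminf_geometric)
  also have "\<dots> < \<infinity>"
    by (simp add: ennreal_mult_less_top)
  finally show ?thesis .
qed

lemma exp_window_shift: "exp_window \<theta> m l = exp_window \<theta> 0 (m - l)"
  by (simp add: exp_window_def abs_minus_commute)

text \<open>The convolution kernel of the commutator error: off-diagonal decay times the relative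
  variation of the window over distance \<open>s\<close>.\<close>

definition defect :: "(int \<Rightarrow> ennreal) \<Rightarrow> real \<Rightarrow> int \<Rightarrow> ennreal" where
  "defect w \<theta> s = w s * ennreal (1 - \<theta> ^ nat \<bar>s\<bar>)"

definition window_norm :: "((int \<Rightarrow> ennreal) \<Rightarrow> ennreal) \<Rightarrow> real \<Rightarrow> (int \<Rightarrow> ennreal) \<Rightarrow> int \<Rightarrow> ennreal" where
  "window_norm N \<theta> x m = N (\<lambda>l. ennreal (exp_window \<theta> m l) * x l)"

lemma bounded_window:
  fixes c :: "int \<Rightarrow> complex"
  assumes "bounded (range c)" "0 < \<theta>" "\<theta> < 1"
  shows "bounded (range (\<lambda>k. of_real (exp_window \<theta> m k) * c k))"
proof -
  obtain B where B: "\<And>k. norm (c k) \<le> B"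
    using assms(1) by (auto simp: bounded_iff)
  have "norm (of_real (exp_window \<theta> m k) * c k) \<le> 1 * B" for k
    unfolding norm_mult using assms(2,3)
    by (intro mult_mono B) (auto simp: exp_window_nonneg exp_window_le_1)
  then show ?thesis by (auto simp: bounded_iff)
qed

lemma point_le_window_norm:
  assumes "shift_norm N"
  shows "x m \<le> window_norm N \<theta> x m"
  using shift_norm.point_le[OF assms, of "\<lambda>l. ennreal (exp_window \<theta> m l) * x l" m]
  by (simp add: window_norm_def)

text \<open>The place where exponents are exchanged. The inner norm is bounded by the sum norm,
  which turns the windowed norm into a convolution with a summable kernel, and any outer norm
  tolerates that. As the window is 1 at its centre, the outer norm of
  \<open>window_norm N \<theta> x\<close> is therefore equivalent to that of \<open>x\<close>,
  whatever \<open>N\<close> is.\<close>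

lemma norm_window_norm_le:
  assumes N: "shift_norm N" and N': "shift_norm N'" and \<theta>: "0 < \<theta>" "\<theta> < 1"
  shows "N' (window_norm N \<theta> x) \<le> Sig (\<lambda>l. ennreal (exp_window \<theta> 0 l)) * N' x"
proof -
  interpret N: shift_norm N by (rule N)
  interpret N': shift_norm N' by (rule N')
  have "N' (window_norm N \<theta> x) \<le> N' (\<lambda>m. Sig (\<lambda>s. ennreal (exp_window \<theta> 0 s) * x (m - s)))"
  proof (rule N'.mono)
    fix m
    have "window_norm N \<theta> x m \<le> Sig (\<lambda>l. ennreal (exp_window \<theta> m l) * x l)"
      unfolding window_norm_def by (rule N.le_Sig)
    also have "\<dots> = Sig (\<lambda>s. ennreal (exp_window \<theta> 0 s) * x (m - s))"
      using Sig_reflect[of "\<lambda>l. ennreal (exp_window \<theta> m l) * x l" m]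
      by (simp add: exp_window_shift[of _ m])
    finally show "window_norm N \<theta> x m \<le> \<dots>" .
  qed
  also have "\<dots> \<le> Sig (\<lambda>l. ennreal (exp_window \<theta> 0 l)) * N' x"
    by (rule N'.convolution_le)
  finally show ?thesis .
qed

text \<open>Moving the error term to the left requires a subtraction; finiteness of \<open>X\<close>
  allows it to be carried out in the reals.\<close>

lemma absorb_ennreal:
  fixes A e X Y :: ennreal
  assumes "A * X \<le> Y + e * X" "X < \<infinity>" "2 * e \<le> A" "A < \<infinity>"
  shows "(A / 2) * X \<le> Y"
proof (cases "Y = top")
  case False
  obtain a where a: "A = ennreal a" "a \<ge> 0" using assms(4) by (cases A) auto
  obtain x where x: "X = ennreal x" "x \<ge> 0" using assms(2) by (cases X) auto
  obtain y where y: "Y = ennreal y" "y \<ge> 0" using False by (cases Y) auto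
  have "e \<noteq> top" using assms(3,4) by (auto simp: ennreal_mult_top top_unique)
  then obtain f where f: "e = ennreal f" "f \<ge> 0" by (cases e) auto
  have "a * x \<le> y + f * x"
    using assms(1) a x y f by (simp flip: ennreal_mult ennreal_plus)
  moreover have "2 * f \<le> a"
    using assms(3) a f by (metis ennreal_le_iff ennreal_mult ennreal_numeral zero_le_numeral)
  then have "2 * f * x \<le> a * x" using x by (intro mult_right_mono) auto
  ultimately have "a / 2 * x \<le> y" by simp
  then have "ennreal (a / 2 * x) \<le> ennreal y" by (rule ennreal_leI)
  moreover have "ennreal (a / 2) = ennreal a / 2"
    using a by (metis divide_ennreal ennreal_numeral zero_le_numeral zero_less_numeral)
  ultimately have "ennreal a / 2 * ennreal x \<le> ennreal y"
    using a x by (subst (asm) ennreal_mult) auto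
  then show ?thesis using a x y by simp
qed simp

context local_seminorms
begin

text \<open>Dominated convergence in \<open>s\<close> with majorant \<open>w\<close>: for fixed
  \<open>s\<close> the variation factor tends to 0 as \<open>\<theta>\<close> tends to 1.\<close>

lemma defect_small:
  assumes "0 < \<epsilon>"
  obtains \<theta> where "0 < \<theta>" "\<theta> < 1" "Sig (defect w \<theta>) < \<epsilon>"
proof -
  define \<theta> :: "nat \<Rightarrow> real" where "\<theta> n = 1 - 1 / (real n + 2)" for n
  have \<theta>: "0 < \<theta> n" "\<theta> n < 1" for n
    by (auto simp: \<theta>_def field_simps)
  have "(\<lambda>n. \<theta> n) \<longlonglongrightarrow> 1" unfolding \<theta>_def by real_asymp
  then have lim: "(\<lambda>n. ennreal (1 - \<theta> n ^ nat \<bar>s\<bar>)) \<longlonglongrightarrow> 0" for s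
    by (intro tendsto_eq_intros | simp)+
  have w_top: "w s \<noteq> top" for s
    using w_finite nn_integral_ge_point[of s UNIV w] by (auto simp: top_unique)
  have "(\<lambda>n. Sig (defect w (\<theta> n))) \<longlonglongrightarrow> Sig (\<lambda>_::int. 0)"
  proof (rule nn_integral_dominated_convergence[where w = w])
    show "AE s in count_space UNIV. defect w (\<theta> n) s \<le> w s" for n
      using \<theta>[of n] mult_left_mono[of "ennreal (1 - \<theta> n ^ k)" 1 "w s" for s k] by (auto simp: defect_def AE_count_space)
    show "AE s in count_space UNIV. (\<lambda>n. defect w (\<theta> n) s) \<longlonglongrightarrow> 0"
      using ennreal_tendsto_cmult[OF _ lim, of "w s" for s] w_top
      by (simp add: defect_def AE_count_space less_top)
  qed (use w_finite in auto)
  then have "\<forall>\<^sub>F n in sequentially. Sig (defect w (\<theta> n)) < \<epsilon>"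
    using assms by (intro order_tendstoD(2)) auto
  then obtain n where "Sig (defect w (\<theta> n)) < \<epsilon>"
    by (auto simp: eventually_sequentially)
  with \<theta>[of n] that show ?thesis by blast
qed

text \<open>On cell \<open>j\<close> the window is frozen at its value in \<open>j\<close>; the
  seminorm of the remaining product is estimated by the off-diagonal decay and the variation of the
  window.\<close>

lemma S_window:
  assumes c: "bounded (range c)" and \<theta>: "0 < \<theta>" "\<theta> < 1"
  shows "S j (\<lambda>k. of_real (exp_window \<theta> m k) * c k)
    \<le> ennreal (exp_window \<theta> m j) * S j c +
      Sig (\<lambda>s. defect w \<theta> s * (ennreal (exp_window \<theta> m (j - s)) * ennreal (norm (c (j - s)))
                            + ennreal (exp_window \<theta> (m - s) (j - s)) * ennreal (norm (c (j - s)))))"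
proof -
  let ?\<psi> = "exp_window \<theta> m"
  define d where "d k = of_real (?\<psi> k - ?\<psi> j) * c k" for k
  have bw: "bounded (range (\<lambda>k. of_real (?\<psi> k) * c k))"
    by (rule bounded_window[OF c \<theta>])
  have bc: "bounded (range (\<lambda>k. of_real (?\<psi> j) * c k))"
    by (rule bounded_range_mult[OF c])
  have bd: "bounded (range d)"
    unfolding d_def using bounded_minus_comp[of "\<lambda>k. of_real (?\<psi> k) * c k" UNIV, OF bw bc]
    by (simp add: left_diff_distrib)
  have "S j (\<lambda>k. of_real (?\<psi> k) * c k) = S j (\<lambda>k. of_real (?\<psi> j) * c k + d k)"
    by (simp add: d_def left_diff_distrib)
  also have "\<dots> \<le> S j (\<lambda>k. of_real (?\<psi> j) * c k) + S j d"
    by (rule S_add[OF bc bd])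
  also have "\<dots> \<le> ennreal (?\<psi> j) * S j c + Sig (\<lambda>k. w (j - k) * ennreal (norm (d k)))"
    by (intro add_mono S_scale S_le c bd exp_window_nonneg \<theta>)
  also have "Sig (\<lambda>k. w (j - k) * ennreal (norm (d k))) = Sig (\<lambda>s. w s * ennreal (norm (d (j - s))))"
    using Sig_reflect[of "\<lambda>k. w (j - k) * ennreal (norm (d k))" j] by simp
  also have "\<dots> \<le> Sig (\<lambda>s. defect w \<theta> s * (ennreal (?\<psi> (j - s)) * ennreal (norm (c (j - s)))
                            + ennreal (exp_window \<theta> (m - s) (j - s)) * ennreal (norm (c (j - s)))))"
  proof (rule nn_integral_mono)
    fix s
    have "norm (d (j - s)) = \<bar>?\<psi> (j - s) - ?\<psi> j\<bar> * norm (c (j - s))"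
      by (simp add: d_def norm_mult del: of_real_diff)
    also have "\<dots> \<le> ((1 - \<theta> ^ nat \<bar>s\<bar>) * (?\<psi> (j - s) + ?\<psi> j)) * norm (c (j - s))"
      using exp_window_diff[OF \<theta>, of m "j - s" j] by (intro mult_right_mono) auto
    \<comment> \<open>Moving the centre of the window along with the point lets the whole error term
      be a translate by \<open>s\<close>, so that translation invariance of the norm later produces
      the windowed norm centred at \<open>m - s\<close>.\<close>
    also have "?\<psi> j = exp_window \<theta> (m - s) (j - s)"
      by (simp add: exp_window_def)
    finally have "ennreal (norm (d (j - s)))
        \<le> ennreal ((1 - \<theta> ^ nat \<bar>s\<bar>) * (?\<psi> (j - s) + exp_window \<theta> (m - s) (j - s)) * norm (c (j - s)))"
      by (rule ennreal_leI)
    also have "\<dots> = ennreal (1 - \<theta> ^ nat \<bar>s\<bar>) * (ennreal (?\<psi> (j - s)) * ennreal (norm (c (j - s)))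
                            + ennreal (exp_window \<theta> (m - s) (j - s)) * ennreal (norm (c (j - s))))"
      using \<theta> by (simp add: exp_window_nonneg power_le_one distrib_right algebra_simps flip: ennreal_mult ennreal_plus)
    finally show "w s * ennreal (norm (d (j - s))) \<le> defect w \<theta> s * (ennreal (?\<psi> (j - s)) * ennreal (norm (c (j - s)))
                            + ennreal (exp_window \<theta> (m - s) (j - s)) * ennreal (norm (c (j - s))))"
      unfolding defect_def mult.assoc by (rule mult_left_mono) simp
  qed
  finally show ?thesis by (simp add: add_left_mono)
qed

text \<open>The global bound is tested on the windowed sequence. This has finite
  \<open>N\<close>-norm for every bounded \<open>c\<close>, because the window is summable, so a
  bound assumed only for sequences of finite norm becomes available for all bounded ones.\<close>

lemma localized_lower_bound:
  assumes N: "shift_norm N"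
    and lower: "\<And>c. N (\<lambda>k. ennreal (norm (c k))) < \<infinity> \<Longrightarrow>
      A * N (\<lambda>k. ennreal (norm (c k))) \<le> N (\<lambda>j. S j c)"
    and c: "bounded (range c)" and \<theta>: "0 < \<theta>" "\<theta> < 1"
  defines "a \<equiv> window_norm N \<theta> (\<lambda>k. ennreal (norm (c k)))"
  shows "A * a m \<le> window_norm N \<theta> (\<lambda>j. S j c) m + Sig (\<lambda>s. defect w \<theta> s * (a m + a (m - s)))"
proof -
  interpret shift_norm N by (rule N)
  let ?\<psi> = "exp_window \<theta> m"
  let ?b = "\<lambda>k. of_real (?\<psi> k) * c k"
  have norm_b: "(\<lambda>k. ennreal (norm (?b k))) = (\<lambda>k. ennreal (?\<psi> k) * ennreal (norm (c k)))"
    using \<theta> by (auto simp: norm_mult exp_window_nonneg ennreal_mult')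
  obtain B where B: "\<And>k. norm (c k) \<le> B"
    using c by (auto simp: bounded_iff)
  have "N (\<lambda>k. ennreal (norm (?b k))) \<le> Sig (\<lambda>k. ennreal (?\<psi> k) * ennreal (norm (c k)))"
    unfolding norm_b by (rule le_Sig)
  also have "\<dots> \<le> Sig (\<lambda>k. ennreal (?\<psi> k) * ennreal B)"
    by (intro nn_integral_mono mult_left_mono ennreal_leI B) auto
  also have "\<dots> = Sig (\<lambda>k. ennreal (exp_window \<theta> 0 k)) * ennreal B"
    using Sig_reflect[of "\<lambda>k. ennreal (exp_window \<theta> 0 k)" m]
    by (simp add: nn_integral_multc exp_window_shift[of _ m])
  also have "\<dots> < \<infinity>"
    using Sig_exp_window_finite[OF \<theta>] by (simp add: ennreal_mult_less_top)
  finally have fin: "N (\<lambda>k. ennreal (norm (?b k))) < \<infinity>" .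
  have "A * a m = A * N (\<lambda>k. ennreal (norm (?b k)))"
    unfolding norm_b a_def window_norm_def ..
  also have "\<dots> \<le> N (\<lambda>j. S j ?b)"
    by (rule lower[OF fin])
  also have "\<dots> \<le> N (\<lambda>j. ennreal (?\<psi> j) * S j c +
      Sig (\<lambda>s. defect w \<theta> s * (ennreal (?\<psi> (j - s)) * ennreal (norm (c (j - s)))
                            + ennreal (exp_window \<theta> (m - s) (j - s)) * ennreal (norm (c (j - s))))))"
    by (rule mono[OF S_window[OF c \<theta>]])
  also have "\<dots> \<le> N (\<lambda>j. ennreal (?\<psi> j) * S j c) +
      N (\<lambda>j. Sig (\<lambda>s. defect w \<theta> s * (ennreal (?\<psi> (j - s)) * ennreal (norm (c (j - s)))
                            + ennreal (exp_window \<theta> (m - s) (j - s)) * ennreal (norm (c (j - s))))))"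
    by (rule subadd)
  also have "\<dots> \<le> window_norm N \<theta> (\<lambda>j. S j c) m + Sig (\<lambda>s. defect w \<theta> s * (a m + a (m - s)))"
  proof (rule add_mono)
    have "N (\<lambda>j. Sig (\<lambda>s. defect w \<theta> s * (ennreal (?\<psi> (j - s)) * ennreal (norm (c (j - s)))
                            + ennreal (exp_window \<theta> (m - s) (j - s)) * ennreal (norm (c (j - s))))))
      \<le> Sig (\<lambda>s. N (\<lambda>j. defect w \<theta> s * (ennreal (?\<psi> (j - s)) * ennreal (norm (c (j - s)))
                            + ennreal (exp_window \<theta> (m - s) (j - s)) * ennreal (norm (c (j - s))))))"
      by (rule countable_subadd)
    also have "\<dots> = Sig (\<lambda>s. defect w \<theta> s * N (\<lambda>l. ennreal (?\<psi> l) * ennreal (norm (c l))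
                            + ennreal (exp_window \<theta> (m - s) l) * ennreal (norm (c l))))"
      using shift[of "\<lambda>l. ennreal (?\<psi> l) * ennreal (norm (c l))
                            + ennreal (exp_window \<theta> (m - s) l) * ennreal (norm (c l))" "- s" for s]
      by (simp add: cmult)
    also have "\<dots> \<le> Sig (\<lambda>s. defect w \<theta> s * (a m + a (m - s)))"
      unfolding a_def window_norm_def by (intro nn_integral_mono mult_left_mono subadd) auto
    finally show "N (\<lambda>j. Sig (\<lambda>s. defect w \<theta> s * (ennreal (?\<psi> (j - s)) * ennreal (norm (c (j - s)))
                            + ennreal (exp_window \<theta> (m - s) (j - s)) * ennreal (norm (c (j - s)))))) \<le> \<dots>" .
  qed (simp add: window_norm_def)
  finally show ?thesis .
qed

text \<open>The localised inequality is indexed by the centre \<open>m\<close>, and nothing ties the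
  norm taken in \<open>m\<close> to the norm used inside the window.\<close>

theorem lower_bound_transfer:
  fixes A :: real
  assumes N: "shift_norm N" and N': "shift_norm N'"
    and A: "0 < A"
    and lower: "\<And>c. N (\<lambda>k. ennreal (norm (c k))) < \<infinity> \<Longrightarrow>
      ennreal A * N (\<lambda>k. ennreal (norm (c k))) \<le> N (\<lambda>j. S j c)"
  shows "\<exists>A'>0. \<forall>c. N' (\<lambda>k. ennreal (norm (c k))) < \<infinity> \<longrightarrow>
      ennreal A' * N' (\<lambda>k. ennreal (norm (c k))) \<le> N' (\<lambda>j. S j c)"
proof -
  interpret N: shift_norm N by (rule N)
  interpret N': shift_norm N' by (rule N')
  \<comment> \<open>The error enters twice, through \<open>a m\<close> and through its translates,
    so a defect below \<open>A / 4\<close> leaves an error of at most half of \<open>A\<close>, as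
    absorption requires.\<close>
  obtain \<theta> where \<theta>: "0 < \<theta>" "\<theta> < 1" "Sig (defect w \<theta>) < ennreal (A / 4)"
    using defect_small[of "ennreal (A / 4)"] A by auto
  define H where "H = Sig (\<lambda>l. ennreal (exp_window \<theta> 0 l))"
  have H: "H < \<infinity>" unfolding H_def by (rule Sig_exp_window_finite[OF \<theta>(1,2)])
  have H1: "1 \<le> H"
    using nn_integral_ge_point[of 0 UNIV "\<lambda>l. ennreal (exp_window \<theta> 0 l)"] by (simp add: H_def)
  obtain h where h: "H = ennreal h" "h > 0"
    using H H1 by (cases H) (auto simp: ennreal_1[symmetric] simp del: ennreal_1)
  show ?thesis
  proof (intro exI conjI allI impI)
    \<comment> \<open>The factor 1/2 is lost in the absorption, and \<open>h\<close>, the total mass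
      of the window, when the windowed seminorms are replaced by the plain ones.\<close>
    show "0 < A / 2 / h" using A h by simp
    fix c :: "int \<Rightarrow> complex"
    let ?c = "\<lambda>k. ennreal (norm (c k))"
    assume fin: "N' ?c < \<infinity>"
    have "bounded (range c)"
    proof -
      have "ennreal (norm (c k)) \<le> ennreal (enn2real (N' ?c))" for k
        using N'.point_le[of ?c k] fin by (simp add: less_top)
      then have "norm (c k) \<le> enn2real (N' ?c)" for k
        by (simp add: ennreal_le_iff)
      then show ?thesis by (auto simp: bounded_iff)
    qed
    define a where "a = window_norm N \<theta> ?c"
    note loc = localized_lower_bound[OF N lower \<open>bounded (range c)\<close> \<theta>(1,2), simplified, folded a_def]
    have "ennreal A * N' a = N' (\<lambda>m. ennreal A * a m)"
      by (rule N'.cmult[symmetric])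
    also have "\<dots> \<le> N' (\<lambda>m. window_norm N \<theta> (\<lambda>j. S j c) m + Sig (\<lambda>s. defect w \<theta> s * (a m + a (m - s))))"
      by (rule N'.mono[OF loc])
    also have "\<dots> \<le> N' (window_norm N \<theta> (\<lambda>j. S j c)) + N' (\<lambda>m. Sig (\<lambda>s. defect w \<theta> s * (a m + a (m - s))))"
      by (rule N'.subadd)
    also have "\<dots> \<le> H * N' (\<lambda>j. S j c) + (2 * Sig (defect w \<theta>)) * N' a"
    proof (rule add_mono)
      show "N' (window_norm N \<theta> (\<lambda>j. S j c)) \<le> H * N' (\<lambda>j. S j c)"
        unfolding H_def by (rule norm_window_norm_le[OF N N' \<theta>(1,2)])
      have "N' (\<lambda>m. Sig (\<lambda>s. defect w \<theta> s * (a m + a (m - s))))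
          = N' (\<lambda>m. Sig (defect w \<theta>) * a m + Sig (\<lambda>s. defect w \<theta> s * a (m - s)))"
        by (simp add: distrib_left nn_integral_add nn_integral_multc)
      also have "\<dots> \<le> N' (\<lambda>m. Sig (defect w \<theta>) * a m) + N' (\<lambda>m. Sig (\<lambda>s. defect w \<theta> s * a (m - s)))"
        by (rule N'.subadd)
      also have "\<dots> \<le> Sig (defect w \<theta>) * N' a + Sig (defect w \<theta>) * N' a"
        by (intro add_mono N'.convolution_le) (simp add: N'.cmult)
      finally show "N' (\<lambda>m. Sig (\<lambda>s. defect w \<theta> s * (a m + a (m - s)))) \<le> (2 * Sig (defect w \<theta>)) * N' a"
        by (simp add: mult_2 distrib_right)
    qed
    finally have main: "ennreal A * N' a \<le> H * N' (\<lambda>j. S j c) + (2 * Sig (defect w \<theta>)) * N' a" .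
    have "N' a \<le> H * N' ?c"
      unfolding a_def H_def by (rule norm_window_norm_le[OF N N' \<theta>(1,2)])
    also have "\<dots> < \<infinity>" using H fin by (simp add: ennreal_mult_less_top)
    finally have "N' a < \<infinity>" .
    moreover have "2 * (2 * Sig (defect w \<theta>)) \<le> ennreal A"
    proof -
      have "2 * (2 * Sig (defect w \<theta>)) = 4 * Sig (defect w \<theta>)" by (simp flip: mult.assoc)
      also have "\<dots> \<le> 4 * ennreal (A / 4)" using \<theta>(3) by (intro mult_left_mono) auto
      also have "\<dots> = ennreal A"
        by (metis ennreal_mult' ennreal_numeral nonzero_mult_div_cancel_left times_divide_eq_right zero_le_numeral zero_neq_numeral)
      finally show ?thesis .
    qed
    ultimately have "(ennreal A / 2) * N' a \<le> H * N' (\<lambda>j. S j c)"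
      using absorb_ennreal[OF main] by simp
    moreover have "N' ?c \<le> N' a"
      unfolding a_def by (intro N'.mono point_le_window_norm[OF N])
    ultimately have le: "(ennreal A / 2) * N' ?c \<le> H * N' (\<lambda>j. S j c)"
      by (meson mult_left_mono order_trans zero_le)
    have "ennreal (A / 2 / h) * N' ?c = ennreal (1 / h) * ((ennreal A / 2) * N' ?c)"
    proof -
      have "ennreal (A / 2 / h) = ennreal (1 / h) * ennreal (A / 2)"
        using A h by (subst ennreal_mult[symmetric]) auto
      also have "ennreal (A / 2) = ennreal A / 2"
        using A by (metis divide_ennreal ennreal_numeral less_imp_le zero_less_numeral)
      finally show ?thesis by (simp add: mult.assoc)
    qed
    also have "\<dots> \<le> ennreal (1 / h) * (H * N' (\<lambda>j. S j c))"
      by (intro mult_left_mono le) simp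
    also have "\<dots> = N' (\<lambda>j. S j c)"
      using h by (simp flip: mult.assoc ennreal_mult)
    finally show "ennreal (A / 2 / h) * N' ?c \<le> N' (\<lambda>j. S j c)" .
  qed
qed

lemma norm_S_le:
  assumes N: "shift_norm N" and c: "bounded (range c)"
  shows "N (\<lambda>j. S j c) \<le> Sig w * N (\<lambda>k. ennreal (norm (c k)))"
proof -
  interpret shift_norm N by (rule N)
  have "S j c \<le> Sig (\<lambda>s. w s * ennreal (norm (c (j - s))))" for j
    using S_le[OF c, of j] Sig_reflect[of "\<lambda>k. w (j - k) * ennreal (norm (c k))" j] by simp
  then have "N (\<lambda>j. S j c) \<le> N (\<lambda>j. Sig (\<lambda>s. w s * ennreal (norm (c (j - s)))))"
    by (rule mono)
  also have "\<dots> \<le> Sig w * N (\<lambda>k. ennreal (norm (c k)))"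
    by (rule convolution_le)
  finally show ?thesis .
qed

end

section \<open>Shift sums of a generator in \<open>W\<^sub>0\<close>\<close>

lemma ennreal_norm_triangle: "ennreal (norm (a + b)) \<le> ennreal (norm a) + ennreal (norm b)"
  by (metis ennreal_leI ennreal_plus norm_ge_zero norm_triangle_ineq)

definition cell :: "int \<Rightarrow> real set" where
  "cell j = {of_int j..<of_int j + 1}"

lemma in_cell_iff: "x \<in> cell j \<longleftrightarrow> \<lfloor>x\<rfloor> = j"
  by (auto simp: cell_def floor_eq_iff)

lemma cell_borel [measurable]: "cell j \<in> sets borel"
  by (simp add: cell_def)

text \<open>The measure is left general because both Lebesgue measure and the counting measure on a
  sampling set are cut into cells.\<close>

lemma nn_integral_cells:
  assumes [measurable]: "f \<in> borel_measurable M" and cells: "\<And>j. cell j \<inter> space M \<in> sets M"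
  shows "(\<integral>\<^sup>+x. f x \<partial>M) = Sig (\<lambda>j. \<integral>\<^sup>+x. f x * indicator (cell j) x \<partial>M)"
proof -
  have "(\<integral>\<^sup>+x. f x \<partial>M) = (\<integral>\<^sup>+x. Sig (\<lambda>j. f x * indicator (cell j) x) \<partial>M)"
  proof (rule nn_integral_cong)
    fix x
    show "f x = Sig (\<lambda>j. f x * indicator (cell j) x)"
      by (subst nn_integral_count_space'[of "{\<lfloor>x\<rfloor>}"]) (auto simp: in_cell_iff indicator_def)
  qed
  also have "\<dots> = Sig (\<lambda>j. \<integral>\<^sup>+x. f x * indicator (cell j) x \<partial>M)"
  proof (rule nn_integral_count_space_nn_integral)
    fix j
    show "(\<lambda>x. f x * indicator (cell j) x) \<in> borel_measurable M"
      using cells by (intro borel_measurable_times_ennreal assms borel_measurable_indicator') (auto simp: Int_def conj_commute)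
  qed auto
  finally show ?thesis .
qed

definition wmax :: "(real \<Rightarrow> complex) \<Rightarrow> int \<Rightarrow> ennreal" where
  "wmax g k = ennreal (SUP x\<in>{of_int k..of_int k + 1}. norm (g x))"

lemma diff_int_in_unit_interval:
  "x - of_int k \<in> {real_of_int (\<lfloor>x\<rfloor> - k)..real_of_int (\<lfloor>x\<rfloor> - k) + 1}"
  unfolding atLeastAtMost_iff of_int_diff using floor_correct[of x] by linarith

text \<open>Besides sampling sets, \<open>L = UNIV\<close> occurs: the full cell suprema dominate
  the L^p norms.\<close>

definition samp :: "(real \<Rightarrow> complex) \<Rightarrow> real set \<Rightarrow> int \<Rightarrow> (int \<Rightarrow> complex) \<Rightarrow> ennreal" where
  "samp g L j c = (SUP x\<in>L \<inter> cell j. ennreal (norm (shift_sum g c x)))"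

text \<open>Cells have length 1, so this is a mean value. It is bounded by the p-th power mean and
  by the essential supremum, which makes it the counterpart of \<open>samp\<close> for lower bounds
  of L^p norms.\<close>

definition cellint :: "(real \<Rightarrow> complex) \<Rightarrow> int \<Rightarrow> (int \<Rightarrow> complex) \<Rightarrow> ennreal" where
  "cellint g j c = (\<integral>\<^sup>+x. ennreal (norm (shift_sum g c x)) * indicator (cell j) x \<partial>lborel)"

section \<open>Absolute convergence, translation and continuity of shift sums\<close>

context
  fixes g :: "real \<Rightarrow> complex"
  assumes g: "g \<in> W0"
begin

lemma W0_continuous: "continuous_on UNIV g"
  using g by (simp add: W0_def)

lemma W0_bdd_above: "bdd_above ((\<lambda>x. norm (g x)) ` {of_int k..of_int k + 1})"
  by (intro bounded_imp_bdd_above compact_imp_bounded compact_continuous_image continuous_on_norm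
      continuous_on_subset[OF W0_continuous]) auto

lemma norm_le_wmax: "x \<in> {of_int k..of_int k + 1} \<Longrightarrow> ennreal (norm (g x)) \<le> wmax g k"
  unfolding wmax_def by (intro ennreal_leI cSUP_upper W0_bdd_above)

lemma Sig_wmax_finite: "Sig (wmax g) < \<infinity>"
proof -
  let ?s = "\<lambda>k::int. SUP x\<in>{of_int k..of_int k + 1}. norm (g x)"
  have s: "?s summable_on UNIV" using g by (simp add: W0_def)
  have pos: "0 \<le> ?s k" for k
    using cSUP_upper[OF _ W0_bdd_above[of k], of "of_int k"] by (auto intro: order_trans[OF norm_ge_zero])
  then have "Sig (wmax g) = ennreal (infsum ?s UNIV)"
    unfolding wmax_def using s by (intro nn_integral_count_space_infsum) auto
  then show ?thesis by simp
qed

lemma Sig_terms_le: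
  "Sig (\<lambda>k. ennreal (norm (c k * g (x - of_int k)))) \<le> Sig (\<lambda>k. wmax g (\<lfloor>x\<rfloor> - k) * ennreal (norm (c k)))"
proof (rule nn_integral_mono)
  fix k
  have "ennreal (norm (g (x - of_int k))) \<le> wmax g (\<lfloor>x\<rfloor> - k)"
    by (rule norm_le_wmax[OF diff_int_in_unit_interval])
  then show "ennreal (norm (c k * g (x - of_int k))) \<le> wmax g (\<lfloor>x\<rfloor> - k) * ennreal (norm (c k))"
    by (simp add: norm_mult ennreal_mult mult.commute mult_left_mono)
qed

lemma Sig_wmax_bounded_le:
  assumes "\<And>k. norm (c k) \<le> B"
  shows "Sig (\<lambda>k. wmax g (j - k) * ennreal (norm (c k))) \<le> Sig (wmax g) * ennreal B"
proof -
  have "Sig (\<lambda>k. wmax g (j - k) * ennreal (norm (c k))) \<le> Sig (\<lambda>k. wmax g (j - k) * ennreal B)"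
    by (intro nn_integral_mono mult_left_mono ennreal_leI assms) auto
  also have "\<dots> = Sig (wmax g) * ennreal B"
    by (simp add: nn_integral_multc Sig_reflect)
  finally show ?thesis .
qed

lemma shift_sum_abs_summable:
  assumes "bounded (range c)"
  shows "(\<lambda>k. norm (c k * g (x - of_int k))) summable_on UNIV"
proof (rule abs_summable_on_ennreal)
  obtain B where B: "\<And>k. norm (c k) \<le> B"
    using assms by (auto simp: bounded_iff)
  have "Sig (\<lambda>k. ennreal (norm (c k * g (x - of_int k)))) \<le> Sig (wmax g) * ennreal B"
    by (rule order_trans[OF Sig_terms_le Sig_wmax_bounded_le[OF B]])
  also have "\<dots> < \<infinity>"
    using Sig_wmax_finite by (simp add: ennreal_mult_less_top)
  finally show "Sig (\<lambda>k. ennreal (norm (c k * g (x - of_int k)))) < \<infinity>" .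
qed

lemma shift_sum_summable:
  "bounded (range c) \<Longrightarrow> (\<lambda>k. c k * g (x - of_int k)) summable_on UNIV"
  by (rule abs_summable_summable[OF shift_sum_abs_summable])

lemma norm_shift_sum_le:
  "ennreal (norm (shift_sum g c x)) \<le> Sig (\<lambda>k. wmax g (\<lfloor>x\<rfloor> - k) * ennreal (norm (c k)))"
  unfolding shift_sum_def by (rule order_trans[OF norm_infsum_le_nn_integral Sig_terms_le])

lemma shift_sum_add:
  "bounded (range c) \<Longrightarrow> bounded (range d) \<Longrightarrow>
    shift_sum g (\<lambda>k. c k + d k) x = shift_sum g c x + shift_sum g d x"
  unfolding shift_sum_def by (simp add: distrib_right infsum_add shift_sum_summable)

lemma shift_sum_scale: "shift_sum g (\<lambda>k. z * c k) x = z * shift_sum g c x"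
  unfolding shift_sum_def by (simp add: mult.assoc infsum_cmult_right')

lemma shift_sum_zero [simp]: "shift_sum g (\<lambda>_. 0) = (\<lambda>_. 0)"
  by (simp add: shift_sum_def fun_eq_iff)

lemma shift_sum_translate: "shift_sum g (\<lambda>k. c (k + K)) x = shift_sum g c (x + of_int K)"
proof -
  have "bij (\<lambda>k::int. k + K)"
    by (rule bij_betwI[where g = "\<lambda>k. k - K"]) auto
  from infsum_reindex_bij_betw[OF this, of "\<lambda>k. c k * g (x + of_int K - of_int k)"]
  show ?thesis by (simp add: shift_sum_def algebra_simps)
qed

text \<open>Dominated convergence in \<open>k\<close>, with coefficients and points varying
  together. Once \<open>X n\<close> is within distance 1 of \<open>x\<close>, its floor differs from
  that of \<open>x\<close> by at most 1, so the sum of three neighbouring translates of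
  \<open>wmax g\<close> is a majorant.\<close>

lemma shift_sum_tendsto:
  assumes B: "\<And>n k. norm (C n k) \<le> B" and C: "\<And>k. (\<lambda>n. C n k) \<longlonglongrightarrow> c k" and X: "X \<longlonglongrightarrow> x"
  shows "(\<lambda>n. shift_sum g (C n) (X n)) \<longlonglongrightarrow> shift_sum g c x"
proof -
  obtain n0 where n0: "\<And>n. n \<ge> n0 \<Longrightarrow> \<bar>X n - x\<bar> < 1"
    using LIMSEQ_D[OF X zero_less_one] by auto
  have cB: "norm (c k) \<le> B" for k
    by (rule Lim_norm_ubound[OF _ C]) (auto simp: B)
  have bC: "bounded (range (C n))" and bc: "bounded (range c)" for n
    using B cB by (auto simp: bounded_iff)
  define D where "D n k = C (n + n0) k * g (X (n + n0) - of_int k) - c k * g (x - of_int k)" for n k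
  define M where "M k = ennreal B * (wmax g (\<lfloor>x\<rfloor> - 1 - k) + wmax g (\<lfloor>x\<rfloor> - k) + wmax g (\<lfloor>x\<rfloor> + 1 - k))" for k
  have wm: "ennreal (norm (a * g (y - of_int k))) \<le> M k" if "norm a \<le> B" "\<bar>y - x\<bar> < 1" for a y k
  proof -
    have "\<lfloor>y\<rfloor> \<in> {\<lfloor>x\<rfloor> - 1, \<lfloor>x\<rfloor>, \<lfloor>x\<rfloor> + 1}"
      using that(2) by (auto simp: abs_less_iff) linarith
    then have "wmax g (\<lfloor>y\<rfloor> - k) \<le> wmax g (\<lfloor>x\<rfloor> - 1 - k) + wmax g (\<lfloor>x\<rfloor> - k) + wmax g (\<lfloor>x\<rfloor> + 1 - k)"
      by (auto simp: add_increasing add_increasing2)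
    moreover have "ennreal (norm (g (y - of_int k))) \<le> wmax g (\<lfloor>y\<rfloor> - k)"
      by (rule norm_le_wmax[OF diff_int_in_unit_interval])
    ultimately have "ennreal (norm (g (y - of_int k))) \<le> wmax g (\<lfloor>x\<rfloor> - 1 - k) + wmax g (\<lfloor>x\<rfloor> - k) + wmax g (\<lfloor>x\<rfloor> + 1 - k)"
      by (rule order_trans[rotated])
    then show ?thesis
      unfolding M_def norm_mult ennreal_mult[OF norm_ge_zero norm_ge_zero]
      by (intro mult_mono ennreal_leI that) auto
  qed
  have "(\<lambda>n. Sig (\<lambda>k. ennreal (norm (D n k)))) \<longlonglongrightarrow> Sig (\<lambda>_::int. 0)"
  proof (rule nn_integral_dominated_convergence[where w = "\<lambda>k. M k + M k"])
    show "AE k in count_space UNIV. ennreal (norm (D n k)) \<le> M k + M k" for n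
    proof (rule AE_I2)
      fix k
      have "ennreal (norm (D n k)) \<le> ennreal (norm (C (n + n0) k * g (X (n + n0) - of_int k)) + norm (c k * g (x - of_int k)))"
        unfolding D_def by (intro ennreal_leI norm_triangle_ineq4)
      also have "\<dots> \<le> M k + M k"
        by (subst ennreal_plus, simp, simp, intro add_mono wm B cB n0) auto
      finally show "ennreal (norm (D n k)) \<le> M k + M k" .
    qed
    have "Sig M = ennreal B * (Sig (wmax g) + Sig (wmax g) + Sig (wmax g))"
      unfolding M_def by (simp add: nn_integral_cmult nn_integral_add Sig_reflect)
    also have "\<dots> < \<infinity>"
      using Sig_wmax_finite by (simp add: ennreal_mult_less_top)
    finally show "Sig (\<lambda>k. M k + M k) < \<infinity>"
      by (simp add: nn_integral_add)
    show "AE k in count_space UNIV. (\<lambda>n. ennreal (norm (D n k))) \<longlonglongrightarrow> 0"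
    proof (rule AE_I2)
      fix k
      have gc: "isCont g y" for y
        using W0_continuous by (simp add: continuous_on_eq_continuous_at)
      have "(\<lambda>n. g (X n - of_int k)) \<longlonglongrightarrow> g (x - of_int k)"
        by (intro isCont_tendsto_compose[OF gc] tendsto_intros X)
      then have "(\<lambda>n. C n k * g (X n - of_int k)) \<longlonglongrightarrow> c k * g (x - of_int k)"
        by (intro tendsto_mult C)
      then have "(\<lambda>n. D n k) \<longlonglongrightarrow> c k * g (x - of_int k) - c k * g (x - of_int k)"
        unfolding D_def by (intro tendsto_diff tendsto_const LIMSEQ_ignore_initial_segment)
      then have "(\<lambda>n. ennreal (norm (D n k))) \<longlonglongrightarrow> ennreal (norm (0::complex))"
        by (intro tendsto_ennrealI tendsto_norm) simp
      then show "(\<lambda>n. ennreal (norm (D n k))) \<longlonglongrightarrow> 0" by simp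
    qed
  qed auto
  then have lim0: "(\<lambda>n. Sig (\<lambda>k. ennreal (norm (D n k)))) \<longlonglongrightarrow> 0" by simp
  have D_sum: "shift_sum g (C (n + n0)) (X (n + n0)) - shift_sum g c x = (\<Sum>\<^sub>\<infinity>k. D n k)" for n
    unfolding shift_sum_def D_def
    using infsum_add[OF shift_sum_summable[OF bC[of "n + n0"], of "X (n + n0)"]
        summable_on_uminus[THEN iffD2, OF shift_sum_summable[OF bc, of x]]]
    by (simp add: infsum_uminus)
  have "(\<lambda>n. ennreal (norm (shift_sum g (C (n + n0)) (X (n + n0)) - shift_sum g c x))) \<longlonglongrightarrow> 0"
    unfolding D_sum
    by (rule tendsto_sandwich[OF _ _ tendsto_const lim0]) (auto intro: always_eventually norm_infsum_le_nn_integral)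
  then have "(\<lambda>n. norm (shift_sum g (C (n + n0)) (X (n + n0)) - shift_sum g c x)) \<longlonglongrightarrow> 0"
    using tendsto_ennreal_iff[of "\<lambda>n. norm (shift_sum g (C (n + n0)) (X (n + n0)) - shift_sum g c x)" sequentially 0]
    by simp
  then have "(\<lambda>n. shift_sum g (C (n + n0)) (X (n + n0)) - shift_sum g c x) \<longlonglongrightarrow> 0"
    by (rule tendsto_norm_zero_cancel)
  then have "(\<lambda>n. shift_sum g (C (n + n0)) (X (n + n0))) \<longlonglongrightarrow> shift_sum g c x"
    by (simp add: LIM_zero_iff)
  then show ?thesis by (rule LIMSEQ_offset)
qed

lemma shift_sum_continuous:
  assumes "bounded (range c)"
  shows "continuous_on UNIV (shift_sum g c)"
proof -
  obtain B where B: "\<And>k. norm (c k) \<le> B"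
    using assms by (auto simp: bounded_iff)
  show ?thesis
    unfolding continuous_on_sequentially o_def
    using shift_sum_tendsto[of "\<lambda>_. c" B c] B by auto
qed

lemma shift_sum_measurable: "bounded (range c) \<Longrightarrow> shift_sum g c \<in> borel_measurable borel"
  by (intro borel_measurable_continuous_onI shift_sum_continuous)

section \<open>Suprema and integrals over cells as local seminorms, and their relation to
  \<open>Lp_norm\<close>\<close>

lemma local_seminorms_samp: "local_seminorms (samp g L) (wmax g)"
proof
  show "Sig (wmax g) < \<infinity>" by (rule Sig_wmax_finite)
  fix c :: "int \<Rightarrow> complex" and j assume c: "bounded (range c)"
  show "samp g L j c \<le> Sig (\<lambda>k. wmax g (j - k) * ennreal (norm (c k)))"
    unfolding samp_def
  proof (rule SUP_least)
    fix x assume "x \<in> L \<inter> cell j"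
    then show "ennreal (norm (shift_sum g c x)) \<le> Sig (\<lambda>k. wmax g (j - k) * ennreal (norm (c k)))"
      using norm_shift_sum_le[of c x] by (simp add: in_cell_iff)
  qed
  show "samp g L j (\<lambda>k. of_real t * c k) \<le> ennreal t * samp g L j c" if "0 \<le> t" for t
    unfolding samp_def shift_sum_scale norm_mult using that
    by (auto intro!: SUP_least mult_left_mono SUP_upper simp: ennreal_mult)
  fix d :: "int \<Rightarrow> complex" assume d: "bounded (range d)"
  show "samp g L j (\<lambda>k. c k + d k) \<le> samp g L j c + samp g L j d"
    unfolding samp_def
  proof (rule SUP_least)
    fix x assume x: "x \<in> L \<inter> cell j"
    have "ennreal (norm (shift_sum g (\<lambda>k. c k + d k) x))
        \<le> ennreal (norm (shift_sum g c x)) + ennreal (norm (shift_sum g d x))"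
      unfolding shift_sum_add[OF c d] by (rule ennreal_norm_triangle)
    also have "\<dots> \<le> (SUP x\<in>L \<inter> cell j. ennreal (norm (shift_sum g c x)))
        + (SUP x\<in>L \<inter> cell j. ennreal (norm (shift_sum g d x)))"
      using x by (intro add_mono SUP_upper)
    finally show "ennreal (norm (shift_sum g (\<lambda>k. c k + d k) x)) \<le> \<dots>" .
  qed
qed

lemma emeasure_cell: "emeasure lborel (cell j) = 1"
  by (simp add: cell_def)

lemma nn_integral_cell_const:
  "(\<integral>\<^sup>+x. K * indicator (cell j) x \<partial>lborel) = K"
  by (subst nn_integral_cmult_indicator) (simp_all add: emeasure_cell)

lemma local_seminorms_cellint: "local_seminorms (cellint g) (wmax g)"
proof
  show "Sig (wmax g) < \<infinity>" by (rule Sig_wmax_finite)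
  fix c :: "int \<Rightarrow> complex" and j assume c: "bounded (range c)"
  note [measurable] = shift_sum_measurable[OF c]
  have "cellint g j c \<le> (\<integral>\<^sup>+x. Sig (\<lambda>k. wmax g (j - k) * ennreal (norm (c k))) * indicator (cell j) x \<partial>lborel)"
    unfolding cellint_def
  proof (rule nn_integral_mono)
    fix x
    show "ennreal (norm (shift_sum g c x)) * indicator (cell j) x
        \<le> Sig (\<lambda>k. wmax g (j - k) * ennreal (norm (c k))) * indicator (cell j) x"
      using norm_shift_sum_le[of c x] by (auto simp: in_cell_iff split: split_indicator)
  qed
  then show "cellint g j c \<le> Sig (\<lambda>k. wmax g (j - k) * ennreal (norm (c k)))"
    by (simp add: nn_integral_cell_const)
  show "cellint g j (\<lambda>k. of_real t * c k) \<le> ennreal t * cellint g j c" if "0 \<le> t" for t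
    unfolding cellint_def shift_sum_scale norm_mult using that
    by (simp add: ennreal_mult mult.assoc nn_integral_cmult)
  fix d :: "int \<Rightarrow> complex" assume d: "bounded (range d)"
  note [measurable] = shift_sum_measurable[OF d]
  have "cellint g j (\<lambda>k. c k + d k) \<le> (\<integral>\<^sup>+x. ennreal (norm (shift_sum g c x)) * indicator (cell j) x
      + ennreal (norm (shift_sum g d x)) * indicator (cell j) x \<partial>lborel)"
    unfolding cellint_def shift_sum_add[OF c d] distrib_right[symmetric]
    by (intro nn_integral_mono mult_right_mono ennreal_norm_triangle) simp
  then show "cellint g j (\<lambda>k. c k + d k) \<le> cellint g j c + cellint g j d"
    by (simp add: cellint_def nn_integral_add)
qed

text \<open>On a cell of measure 1 a function is bounded by its supremum there.\<close>

lemma Lp_norm_shift_sum_le: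
  assumes p: "1 \<le> p" and c: "bounded (range c)"
  shows "Lp_norm p (shift_sum g c) \<le> ell_norm p (\<lambda>j. samp g UNIV j c)"
proof -
  note [measurable] = shift_sum_measurable[OF c]
  have le: "ennreal (norm (shift_sum g c x)) \<le> samp g UNIV \<lfloor>x\<rfloor> c" for x
    unfolding samp_def by (rule SUP_upper) (simp add: in_cell_iff)
  show ?thesis
  proof (cases "p = \<infinity>")
    case True
    have "ennreal (norm (shift_sum g c x)) \<le> (SUP j. samp g UNIV j c)" for x
      by (rule order_trans[OF le]) (rule SUP_upper, simp)
    then show ?thesis
      by (auto simp: True Lp_norm_def ell_norm_def)
  next
    case False
    let ?r = "enn2real p"
    have r: "1 \<le> ?r" by (rule one_le_enn2real[OF p False])
    have "(\<integral>\<^sup>+x. ennreal (norm (shift_sum g c x) powr ?r) \<partial>lborel)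
      = Sig (\<lambda>j. \<integral>\<^sup>+x. ennreal (norm (shift_sum g c x) powr ?r) * indicator (cell j) x \<partial>lborel)"
      by (rule nn_integral_cells) auto
    also have "\<dots> \<le> Sig (\<lambda>j. \<integral>\<^sup>+x. epowr (samp g UNIV j c) ?r * indicator (cell j) x \<partial>lborel)"
    proof (intro nn_integral_mono)
      fix j x
      show "ennreal (norm (shift_sum g c x) powr ?r) * indicator (cell j) x
        \<le> epowr (samp g UNIV j c) ?r * indicator (cell j) x"
        using epowr_mono[OF _ le[of x], of ?r] r
        by (auto simp: in_cell_iff epowr_ennreal split: split_indicator)
    qed
    also have "\<dots> = Sig (\<lambda>j. epowr (samp g UNIV j c) ?r)"
      by (simp add: nn_integral_cell_const)
    finally show ?thesis
      unfolding Lp_norm_def ell_norm_def using False r by (auto intro!: epowr_mono)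
  qed
qed

text \<open>For finite exponents, Jensen's inequality on each cell with its indicator as probability
  density.\<close>

lemma ell_norm_cellint_le:
  assumes p: "1 \<le> p" and c: "bounded (range c)"
  shows "ell_norm p (\<lambda>j. cellint g j c) \<le> Lp_norm p (shift_sum g c)"
proof -
  note [measurable] = shift_sum_measurable[OF c]
  show ?thesis
  proof (cases "p = \<infinity>")
    case True
    have "cellint g j c \<le> esssup lborel (\<lambda>x. ennreal (norm (shift_sum g c x)))" for j
    proof -
      have "cellint g j c \<le> (\<integral>\<^sup>+x. esssup lborel (\<lambda>x. ennreal (norm (shift_sum g c x))) * indicator (cell j) x \<partial>lborel)"
        unfolding cellint_def
        using esssup_AE[of "\<lambda>x. ennreal (norm (shift_sum g c x))" lborel]
        by (intro nn_integral_mono_AE) (auto elim!: eventually_mono intro: mult_right_mono)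
      then show ?thesis by (simp add: nn_integral_cell_const)
    qed
    then show ?thesis
      by (auto simp: True Lp_norm_def ell_norm_def intro: SUP_least)
  next
    case False
    let ?r = "enn2real p"
    have r: "1 \<le> ?r" by (rule one_le_enn2real[OF p False])
    have "Sig (\<lambda>j. epowr (cellint g j c) ?r)
        \<le> Sig (\<lambda>j. \<integral>\<^sup>+x. ennreal (norm (shift_sum g c x) powr ?r) * indicator (cell j) x \<partial>lborel)"
    proof (rule nn_integral_mono)
      fix j
      have "epowr (\<integral>\<^sup>+x. indicator (cell j) x * ennreal (norm (shift_sum g c x)) \<partial>lborel) ?r
         \<le> (\<integral>\<^sup>+x. indicator (cell j) x * epowr (ennreal (norm (shift_sum g c x))) ?r \<partial>lborel)"
        by (rule Jensen_epowr[OF _ _ _ r]) (auto simp: emeasure_cell)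
      then show "epowr (cellint g j c) ?r
          \<le> (\<integral>\<^sup>+x. ennreal (norm (shift_sum g c x) powr ?r) * indicator (cell j) x \<partial>lborel)"
        by (simp add: cellint_def epowr_ennreal mult.commute)
    qed
    also have "\<dots> = (\<integral>\<^sup>+x. ennreal (norm (shift_sum g c x) powr ?r) \<partial>lborel)"
      by (rule nn_integral_cells[symmetric]) auto
    finally show ?thesis
      unfolding Lp_norm_def ell_norm_def using False r by (auto intro!: epowr_mono)
  qed
qed

end

section \<open>Stability for all exponents and sampling\<close>

text \<open>Stated for coefficients instead of functions: in this form the exponent can be changed,
  and stability translates it into a sampling inequality.\<close>

definition lower_bounded :: "(int \<Rightarrow> (int \<Rightarrow> complex) \<Rightarrow> ennreal) \<Rightarrow> ennreal \<Rightarrow> bool" where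
  "lower_bounded S p \<longleftrightarrow> (\<exists>A::real. A > 0 \<and>
    (\<forall>c. ell_norm p (\<lambda>k. ennreal (norm (c k))) < \<infinity> \<longrightarrow>
      ennreal A * ell_norm p (\<lambda>k. ennreal (norm (c k))) \<le> ell_norm p (\<lambda>j. S j c)))"

lemma (in local_seminorms) lower_bounded_transfer:
  assumes "1 \<le> p" "1 \<le> q" "lower_bounded S p"
  shows "lower_bounded S q"
  using lower_bound_transfer[OF shift_norm_ell_norm[OF assms(1)] shift_norm_ell_norm[OF assms(2)]] assms(3)
  unfolding lower_bounded_def by blast

lemma bounded_if_ell_norm_finite:
  fixes c :: "'i \<Rightarrow> complex"
  assumes "1 \<le> p" "ell_norm p (\<lambda>k. ennreal (norm (c k))) < \<infinity>"
  shows "bounded (range c)"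
proof -
  let ?M = "ell_norm p (\<lambda>k. ennreal (norm (c k)))"
  have "ennreal (norm (c k)) \<le> ennreal (enn2real ?M)" for k
    using ell_norm_point_le[OF assms(1), of "\<lambda>k. ennreal (norm (c k))" k] assms(2) by (simp add: less_top)
  then have "norm (c k) \<le> enn2real ?M" for k
    by (simp add: ennreal_le_iff)
  then show ?thesis by (auto simp: bounded_iff)
qed

lemma ell_norm_finite_if_bounded:
  fixes c :: "'i \<Rightarrow> complex"
  assumes "bounded (range c)"
  shows "ell_norm \<infinity> (\<lambda>k. ennreal (norm (c k))) < \<infinity>"
proof -
  obtain B where B: "\<And>k. norm (c k) \<le> B"
    using assms by (auto simp: bounded_iff)
  have "ell_norm \<infinity> (\<lambda>k. ennreal (norm (c k))) \<le> ennreal B"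
    by (auto simp: ell_norm_def intro!: SUP_least ennreal_leI B)
  then show ?thesis by (auto intro: le_less_trans)
qed

lemma ellp_UNIV_iff:
  fixes c :: "'i::countable \<Rightarrow> complex"
  shows "c \<in> ellp p UNIV \<longleftrightarrow> ell_norm p (\<lambda>k. ennreal (norm (c k))) < \<infinity>"
  by (simp add: ellp_def ellp_norm_eq_ell_norm)

text \<open>Each normalised coefficient sequence is recentred at a place \<open>K n\<close> where it
  is large, so that the pointwise limit cannot vanish at 0. The seminorms are evaluated at the
  sequences before recentring: how \<open>S\<close> behaves under translation is left to each
  application.\<close>

lemma (in local_seminorms) minimizing_sequence:
  assumes "\<not> lower_bounded S \<infinity>"
  obtains C :: "nat \<Rightarrow> int \<Rightarrow> complex" and K c where
    "\<And>n k. norm (C n k) \<le> 1" "\<And>k. (\<lambda>n. C n (k + K n)) \<longlonglongrightarrow> c k" "c 0 \<noteq> 0"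
    "(\<lambda>n. SUP j. S j (C n)) \<longlonglongrightarrow> 0"
proof -
  \<comment> \<open>The lower bound fails in particular with constant
    \<open>1 / (real n + 1)\<close>. The value 1/2 replaces the supremum 1, which need not be
    attained.\<close>
  have "\<exists>C k. (\<forall>l. norm (C l) \<le> 1) \<and> norm (C k) \<ge> 1 / 2 \<and> (SUP j. S j C) \<le> ennreal (1 / (real n + 1))" for n
  proof -
    have "0 < 1 / (real n + 1)" by simp
    with assms obtain c where c: "ell_norm \<infinity> (\<lambda>k. ennreal (norm (c k))) < \<infinity>"
        "\<not> ennreal (1 / (real n + 1)) * ell_norm \<infinity> (\<lambda>k. ennreal (norm (c k))) \<le> ell_norm \<infinity> (\<lambda>j. S j c)"
      unfolding lower_bounded_def by blast
    define M where "M = (SUP k. ennreal (norm (c k)))"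
    obtain m where m: "M = ennreal m" "m \<ge> 0"
    proof (cases M)
      case top
      then show ?thesis using c(1) by (simp add: ell_norm_def flip: M_def)
    qed
    have lt: "(SUP j. S j c) < ennreal (1 / (real n + 1)) * ennreal m"
      using c(2) m by (simp add: ell_norm_def M_def)
    then have "m > 0" using m by (cases "m = 0") auto
    have bc: "bounded (range c)" using bounded_if_ell_norm_finite[OF _ c(1)] by simp
    have cm: "norm (c k) \<le> m" for k
    proof -
      have "ennreal (norm (c k)) \<le> M" unfolding M_def by (rule SUP_upper) simp
      then show ?thesis using m by simp
    qed
    have "ennreal (m / 2) < M" using m \<open>m > 0\<close> by (simp add: ennreal_less_iff)
    then obtain k where k: "ennreal (m / 2) < ennreal (norm (c k))"
      unfolding M_def less_SUP_iff by auto
    then have k: "m / 2 < norm (c k)" using \<open>m > 0\<close> by (simp add: ennreal_less_iff)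
    have "S j (\<lambda>k. of_real (1 / m) * c k) \<le> ennreal (1 / (real n + 1))" for j
    proof -
      have "S j (\<lambda>k. of_real (1 / m) * c k) \<le> ennreal (1 / m) * S j c"
        using \<open>m > 0\<close> by (intro S_scale bc) simp
      also have "\<dots> \<le> ennreal (1 / m) * (ennreal (1 / (real n + 1)) * ennreal m)"
      proof (rule mult_left_mono)
        have "S j c \<le> (SUP j. S j c)" by (rule SUP_upper) simp
        then show "S j c \<le> ennreal (1 / (real n + 1)) * ennreal m" using lt by simp
      qed simp
      also have "\<dots> = ennreal (1 / (real n + 1))"
        using \<open>m > 0\<close> by (simp flip: ennreal_mult)
      finally show ?thesis .
    qed
    then show ?thesis
      using cm k \<open>m > 0\<close>
      by (intro exI[of _ "\<lambda>k. of_real (1 / m) * c k"] exI[of _ k])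
         (auto simp: norm_mult norm_divide divide_simps intro!: SUP_least)
  qed
  then obtain C K where CK: "\<And>n l. norm (C n l) \<le> 1" "\<And>n. norm (C n (K n)) \<ge> 1 / 2"
      "\<And>n::nat. (SUP j. S j (C n)) \<le> ennreal (1 / (real n + 1))"
    by metis
  \<comment> \<open>A diagonal subsequence: coefficients bounded by 1 converge at all of the
    countably many indices simultaneously.\<close>
  obtain r where r: "strict_mono r" and conv: "\<And>k. \<exists>l. (\<lambda>n. C (r n) (k + K (r n))) \<longlonglongrightarrow> l"
    using function_convergent_subsequence[of "UNIV :: int set" "\<lambda>n k. C n (k + K n)" 1] CK(1) by auto
  then obtain c where c: "\<And>k. (\<lambda>n. C (r n) (k + K (r n))) \<longlonglongrightarrow> c k" by metis
  show ?thesis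
  proof
    show "norm ((C \<circ> r) n k) \<le> 1" for n k using CK(1) by simp
    show "(\<lambda>n. (C \<circ> r) n (k + (K \<circ> r) n)) \<longlonglongrightarrow> c k" for k using c by simp
    have "1 / 2 \<le> norm (c 0)"
      by (rule tendsto_lowerbound[OF tendsto_norm[OF c[of 0]]]) (use CK(2) in \<open>auto intro!: always_eventually\<close>)
    then show "c 0 \<noteq> 0" by auto
    have le: "(SUP j. S j (C (r n))) \<le> ennreal (1 / (real n + 1))" for n
    proof -
      have "1 / (real (r n) + 1) \<le> 1 / (real n + 1)"
        using seq_suble[OF r, of n] by (intro divide_left_mono) auto
      then show ?thesis by (intro order_trans[OF CK(3)] ennreal_leI)
    qed
    have "(\<lambda>n. 1 / (real n + 1)) \<longlonglongrightarrow> 0" by real_asymp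
    then have "(\<lambda>n. ennreal (1 / (real n + 1))) \<longlonglongrightarrow> 0"
      using tendsto_ennrealI by fastforce
    then show "(\<lambda>n. SUP j. S j ((C \<circ> r) n)) \<longlonglongrightarrow> 0"
      by (rule tendsto_sandwich[OF _ _ tendsto_const, rotated 2]) (auto simp: le)
  qed
qed

text \<open>The set where \<open>f\<close> does not vanish is open and a null set, hence
  empty.\<close>

lemma continuous_zero_if_nn_integral_zero:
  fixes f :: "real \<Rightarrow> complex"
  assumes f: "continuous_on UNIV f" and int: "(\<integral>\<^sup>+x. ennreal (norm (f x)) \<partial>lborel) = 0"
  shows "f = (\<lambda>_. 0)"
proof -
  have [measurable]: "f \<in> borel_measurable borel"
    using f by (rule borel_measurable_continuous_onI)
  have "AE x in lborel. f x = 0"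
    using int by (subst (asm) nn_integral_0_iff_AE) auto
  then have "{x. f x \<noteq> 0} \<in> null_sets lborel"
    by (subst (asm) AE_iff_null) auto
  then have "negligible {x. f x \<noteq> 0}"
    by (simp add: negligible_iff_null_sets null_sets_completionI)
  moreover have "open {x. f x \<noteq> 0}"
    using f by (intro open_Collect_neq continuous_intros)
  ultimately have "{x. f x \<noteq> 0} = {}"
    using open_not_negligible by blast
  then show ?thesis by auto
qed

section \<open>Stability at one exponent implies stability at every exponent\<close>

context
  fixes g :: "real \<Rightarrow> complex"
  assumes g: "g \<in> W0" and stable: "stable_integer_shifts g"
begin

lemma lower_bounded_samp_UNIV:
  assumes "1 \<le> p"
  shows "lower_bounded (samp g UNIV) p"
proof -
  obtain q C where q: "1 \<le> q" "C > 0"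
    and C: "\<And>c. c \<in> ellp q UNIV \<Longrightarrow> ennreal C * ellp_norm q UNIV c \<le> Lp_norm q (shift_sum g c)"
    using stable unfolding stable_integer_shifts_def by blast
  have "lower_bounded (samp g UNIV) q"
    unfolding lower_bounded_def
  proof (intro exI conjI allI impI)
    fix c :: "int \<Rightarrow> complex"
    assume fin: "ell_norm q (\<lambda>k. ennreal (norm (c k))) < \<infinity>"
    have "ennreal C * ell_norm q (\<lambda>k. ennreal (norm (c k))) \<le> Lp_norm q (shift_sum g c)"
      using C[of c] fin by (simp add: ellp_UNIV_iff ellp_norm_eq_ell_norm)
    also have "\<dots> \<le> ell_norm q (\<lambda>j. samp g UNIV j c)"
      by (intro Lp_norm_shift_sum_le g q bounded_if_ell_norm_finite[OF q(1) fin])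
    finally show "ennreal C * ell_norm q (\<lambda>k. ennreal (norm (c k))) \<le> ell_norm q (\<lambda>j. samp g UNIV j c)" .
  qed (rule q)
  then show ?thesis
    using local_seminorms.lower_bounded_transfer[OF local_seminorms_samp[OF g] q(1) assms] by blast
qed

text \<open>The bound by cell suprema at exponent infinity. It identifies a function with its
  bounded coefficients and supplies the contradiction in both compactness arguments.\<close>

lemma shift_sum_eq_zero_iff:
  assumes "bounded (range c)"
  shows "shift_sum g c = (\<lambda>_. 0) \<longleftrightarrow> c = (\<lambda>_. 0)"
proof
  assume zero: "shift_sum g c = (\<lambda>_. 0)"
  obtain A where A: "A > 0" "\<And>c. ell_norm \<infinity> (\<lambda>k. ennreal (norm (c k))) < \<infinity> \<Longrightarrow>
      ennreal A * ell_norm \<infinity> (\<lambda>k. ennreal (norm (c k))) \<le> ell_norm \<infinity> (\<lambda>j. samp g UNIV j c)"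
    using lower_bounded_samp_UNIV[of \<infinity>] unfolding lower_bounded_def by auto
  have "ell_norm \<infinity> (\<lambda>j. samp g UNIV j c) = 0"
    using zero by (auto simp: ell_norm_def samp_def SUP_eq_const intro!: antisym SUP_least)
  with A(2)[OF ell_norm_finite_if_bounded[OF assms]] A(1)
  have "ell_norm \<infinity> (\<lambda>k. ennreal (norm (c k))) = 0" by simp
  then have "ennreal (norm (c k)) \<le> 0" for k
    using ell_norm_point_le[of \<infinity> "\<lambda>k. ennreal (norm (c k))" k] by simp
  then show "c = (\<lambda>_. 0)" by auto
qed (simp add: shift_sum_zero[OF g])

lemma cellint_translate:
  assumes c: "bounded (range c)"
  shows "cellint g j (\<lambda>k. c (k + K)) = cellint g (j + K) c"
proof -
  note [measurable] = shift_sum_measurable[OF g c]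
  have "cellint g (j + K) c = (\<integral>\<^sup>+x. ennreal (norm (shift_sum g c (of_int K + 1 * x))) * indicator (cell (j + K)) (of_int K + 1 * x) \<partial>lborel)"
    unfolding cellint_def by (subst nn_integral_real_affine[of _ 1 "of_int K"]) auto
  also have "\<dots> = cellint g j (\<lambda>k. c (k + K))"
    unfolding cellint_def shift_sum_translate[OF g]
    by (intro nn_integral_cong) (auto simp: in_cell_iff indicator_def add.commute)
  finally show ?thesis ..
qed

text \<open>Exponent infinity comes first because bounded coefficients have pointwise convergent
  subsequences. The limit function has vanishing mean modulus on every cell, hence is zero by
  continuity, against the injectivity on bounded coefficients.\<close>

lemma lower_bounded_cellint:
  assumes "1 \<le> p"
  shows "lower_bounded (cellint g) p"
proof -
  interpret local_seminorms "cellint g" "wmax g"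
    by (rule local_seminorms_cellint[OF g])
  have "lower_bounded (cellint g) \<infinity>"
  proof (rule ccontr)
    assume "\<not> lower_bounded (cellint g) \<infinity>"
    then show False
    proof (rule minimizing_sequence)
      fix C :: "nat \<Rightarrow> int \<Rightarrow> complex" and K c
      assume C: "\<And>n k. norm (C n k) \<le> 1" "\<And>k. (\<lambda>n. C n (k + K n)) \<longlonglongrightarrow> c k" "c 0 \<noteq> 0"
        "(\<lambda>n. SUP j. cellint g j (C n)) \<longlonglongrightarrow> 0"
      have bC: "bounded (range (C n))" "bounded (range (\<lambda>k. C n (k + K n)))" for n
        using C(1) by (auto simp: bounded_iff)
      have "norm (c k) \<le> 1" for k
        by (rule Lim_norm_ubound[OF _ C(2)]) (auto simp: C(1))
      then have bc: "bounded (range c)" by (auto simp: bounded_iff)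
      have zero: "cellint g j c = 0" for j
      proof -
        note [measurable] = shift_sum_measurable[OF g bC(2)]
        have "cellint g j c = (\<integral>\<^sup>+x. liminf (\<lambda>n. ennreal (norm (shift_sum g (\<lambda>k. C n (k + K n)) x)) * indicator (cell j) x) \<partial>lborel)"
          unfolding cellint_def
        proof (rule nn_integral_cong)
          fix x
          have "(\<lambda>n. shift_sum g (\<lambda>k. C n (k + K n)) x) \<longlonglongrightarrow> shift_sum g c x"
            by (rule shift_sum_tendsto[OF g C(1) C(2) tendsto_const])
          then have "(\<lambda>n. ennreal (norm (shift_sum g (\<lambda>k. C n (k + K n)) x)) * indicator (cell j) x)
              \<longlonglongrightarrow> ennreal (norm (shift_sum g c x)) * indicator (cell j) x"
            by (auto intro!: tendsto_ennrealI tendsto_norm split: split_indicator)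
          then show "ennreal (norm (shift_sum g c x)) * indicator (cell j) x
              = liminf (\<lambda>n. ennreal (norm (shift_sum g (\<lambda>k. C n (k + K n)) x)) * indicator (cell j) x)"
            by (simp add: lim_imp_Liminf)
        qed
        \<comment> \<open>Fatou's lemma; recentring the coefficients only moves the integral to
          another cell, so the supremum over all cells still controls it.\<close>
        also have "\<dots> \<le> liminf (\<lambda>n. cellint g j (\<lambda>k. C n (k + K n)))"
          unfolding cellint_def by (rule nn_integral_liminf) simp
        also have "\<dots> \<le> liminf (\<lambda>n. SUP j. cellint g j (C n))"
          unfolding cellint_translate[OF bC(1)]
          by (intro Liminf_mono always_eventually allI SUP_upper) simp
        also have "\<dots> = 0"
          using C(4) by (simp add: lim_imp_Liminf)
        finally show ?thesis by simp
      qed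
      note [measurable] = shift_sum_measurable[OF g bc]
      have "(\<integral>\<^sup>+x. ennreal (norm (shift_sum g c x)) \<partial>lborel) = Sig (\<lambda>j. cellint g j c)"
        unfolding cellint_def by (rule nn_integral_cells) auto
      then have "(\<integral>\<^sup>+x. ennreal (norm (shift_sum g c x)) \<partial>lborel) = 0"
        by (simp add: zero)
      then have "shift_sum g c = (\<lambda>_. 0)"
        by (rule continuous_zero_if_nn_integral_zero[OF shift_sum_continuous[OF g bc]])
      with shift_sum_eq_zero_iff[OF bc] C(3) show False by simp
    qed
  qed
  then show ?thesis
    using lower_bounded_transfer[of \<infinity> p] assms by simp
qed

theorem stable_all_exponents:
  assumes p: "1 \<le> p"
  obtains D :: real where "D > 0" "\<And>c. ell_norm p (\<lambda>k. ennreal (norm (c k))) < \<infinity> \<Longrightarrow>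
    ennreal D * ell_norm p (\<lambda>k. ennreal (norm (c k))) \<le> Lp_norm p (shift_sum g c)"
proof -
  obtain D where D: "D > 0" "\<And>c. ell_norm p (\<lambda>k. ennreal (norm (c k))) < \<infinity> \<Longrightarrow>
    ennreal D * ell_norm p (\<lambda>k. ennreal (norm (c k))) \<le> ell_norm p (\<lambda>j. cellint g j c)"
    using lower_bounded_cellint[OF p] unfolding lower_bounded_def by auto
  show ?thesis
  proof (rule that[OF D(1)])
    fix c :: "int \<Rightarrow> complex"
    assume fin: "ell_norm p (\<lambda>k. ennreal (norm (c k))) < \<infinity>"
    show "ennreal D * ell_norm p (\<lambda>k. ennreal (norm (c k))) \<le> Lp_norm p (shift_sum g c)"
      by (rule order_trans[OF D(2)[OF fin] ell_norm_cellint_le[OF g p bounded_if_ell_norm_finite[OF p fin]]])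
  qed
qed

end

section \<open>Sampling sums over relatively separated sets and lower bounds on coefficients\<close>

lemma relatively_separated_countable:
  assumes "relatively_separated \<Lambda>"
  shows "countable \<Lambda>"
proof -
  have "countable (\<Union>j::int. \<Lambda> \<inter> {of_int j..of_int j + 1})"
    using assms by (intro countable_UN) (auto simp: relatively_separated_def intro: countable_finite)
  moreover have "\<Lambda> \<subseteq> (\<Union>j::int. \<Lambda> \<inter> {of_int j..of_int j + 1})"
  proof
    fix x assume "x \<in> \<Lambda>"
    then have "x \<in> \<Lambda> \<inter> {of_int \<lfloor>x\<rfloor>..of_int \<lfloor>x\<rfloor> + 1}"
      using floor_correct[of x] by auto
    then show "x \<in> (\<Union>j::int. \<Lambda> \<inter> {of_int j..of_int j + 1})" by blast
  qed
  ultimately show ?thesis by (rule countable_subset[rotated])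
qed

text \<open>Within a cell, a sum of nonnegative terms is at least its largest term and at most the
  number of terms times the largest. For an empty cell both quantities are 0.\<close>

lemma sampling_sum_bounds:
  fixes f :: "real \<Rightarrow> complex" and r :: real
  assumes \<Lambda>: "relatively_separated \<Lambda>" and r: "0 < r"
    and N: "\<And>x. finite (\<Lambda> \<inter> {x..x + 1}) \<and> card (\<Lambda> \<inter> {x..x + 1}) \<le> N"
  defines "s \<equiv> \<lambda>j. SUP x\<in>\<Lambda> \<inter> cell j. ennreal (norm (f x))"
  shows "Sig (\<lambda>j. epowr (s j) r) \<le> (\<Sum>\<^sub>\<infinity>x\<in>\<Lambda>. ennreal (norm (f x) powr r))"
    and "(\<Sum>\<^sub>\<infinity>x\<in>\<Lambda>. ennreal (norm (f x) powr r)) \<le> ennreal (real N) * Sig (\<lambda>j. epowr (s j) r)"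
proof -
  define T where "T j = (\<integral>\<^sup>+x. ennreal (norm (f x) powr r) * indicator (cell j) x \<partial>count_space \<Lambda>)" for j
  have sum_eq: "(\<Sum>\<^sub>\<infinity>x\<in>\<Lambda>. ennreal (norm (f x) powr r)) = Sig T"
    unfolding infsum_ennreal_eq_nn_integral[OF relatively_separated_countable[OF \<Lambda>]] T_def
    by (rule nn_integral_cells) auto
  have le1: "epowr (s j) r \<le> T j" for j
  proof -
    have "s j \<le> epowr (T j) (1 / r)"
      unfolding s_def
    proof (rule SUP_least)
      fix x assume x: "x \<in> \<Lambda> \<inter> cell j"
      then have "ennreal (norm (f x) powr r) * indicator (cell j) x \<le> T j"
        unfolding T_def by (intro nn_integral_ge_point) simp
      then have "epowr (ennreal (norm (f x))) r \<le> T j"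
        using x by (simp add: epowr_ennreal)
      then have "epowr (epowr (ennreal (norm (f x))) r) (1 / r) \<le> epowr (T j) (1 / r)"
        using r by (intro epowr_mono) auto
      then show "ennreal (norm (f x)) \<le> epowr (T j) (1 / r)"
        using r by simp
    qed
    then have "epowr (s j) r \<le> epowr (epowr (T j) (1 / r)) r"
      using r by (intro epowr_mono) auto
    then show ?thesis using r by simp
  qed
  have le2: "T j \<le> ennreal (real N) * epowr (s j) r" for j
  proof -
    have fin: "finite (\<Lambda> \<inter> cell j)"
      using N[of "of_int j"] by (rule_tac finite_subset[of _ "\<Lambda> \<inter> {of_int j..of_int j + 1}"]) (auto simp: cell_def)
    have "T j = (\<Sum>x\<in>\<Lambda> \<inter> cell j. ennreal (norm (f x) powr r))"
      unfolding T_def by (subst nn_integral_count_space'[of "\<Lambda> \<inter> cell j"]) (auto simp: fin)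
    also have "\<dots> \<le> (\<Sum>x\<in>\<Lambda> \<inter> cell j. epowr (s j) r)"
    proof (rule sum_mono)
      fix x assume "x \<in> \<Lambda> \<inter> cell j"
      then have "ennreal (norm (f x)) \<le> s j" unfolding s_def by (rule SUP_upper)
      from epowr_mono[OF _ this, of r] r show "ennreal (norm (f x) powr r) \<le> epowr (s j) r"
        by (simp add: epowr_ennreal)
    qed
    also have "\<dots> = ennreal (real (card (\<Lambda> \<inter> cell j))) * epowr (s j) r"
      by (simp add: ennreal_of_nat_eq_real_of_nat)
    also have "\<dots> \<le> ennreal (real N) * epowr (s j) r"
    proof (intro mult_right_mono ennreal_leI)
      have "card (\<Lambda> \<inter> cell j) \<le> card (\<Lambda> \<inter> {of_int j..of_int j + 1})"
        using N[of "of_int j"] by (intro card_mono) (auto simp: cell_def)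
      then show "real (card (\<Lambda> \<inter> cell j)) \<le> real N" using N[of "of_int j"] by simp
    qed simp
    finally show ?thesis .
  qed
  show "Sig (\<lambda>j. epowr (s j) r) \<le> (\<Sum>\<^sub>\<infinity>x\<in>\<Lambda>. ennreal (norm (f x) powr r))"
    unfolding sum_eq by (intro nn_integral_mono le1)
  show "(\<Sum>\<^sub>\<infinity>x\<in>\<Lambda>. ennreal (norm (f x) powr r)) \<le> ennreal (real N) * Sig (\<lambda>j. epowr (s j) r)"
    unfolding sum_eq by (subst nn_integral_cmult[symmetric]) (auto intro: nn_integral_mono le2)
qed

lemma SUP_samp: "ell_norm \<infinity> (\<lambda>j. samp g \<Lambda> j c) = (SUP x\<in>\<Lambda>. ennreal (norm (shift_sum g c x)))"
proof -
  have "ennreal (norm (shift_sum g c x)) \<le> (SUP j. samp g \<Lambda> j c)" if "x \<in> \<Lambda>" for x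
  proof -
    have "ennreal (norm (shift_sum g c x)) \<le> samp g \<Lambda> \<lfloor>x\<rfloor> c"
      unfolding samp_def using that by (intro SUP_upper) (simp add: in_cell_iff)
    also have "\<dots> \<le> (SUP j. samp g \<Lambda> j c)" by (rule SUP_upper) simp
    finally show ?thesis .
  qed
  then show ?thesis
    by (auto simp: ell_norm_def samp_def intro!: antisym SUP_least SUP_upper)
qed

text \<open>Here \<open>X\<close> stands for the coefficient norm, \<open>L\<close> for the function
  norm, \<open>Y\<close> for the norm of the cell suprema and \<open>T\<close> for the sampled sum.
  \<open>X\<close> and \<open>L\<close> are equivalent, so are \<open>T\<close> and the r-th power
  of \<open>Y\<close>, and the upper sampling bound follows from \<open>Y\<close> being bounded by
  \<open>X\<close>. Exponent infinity is the case \<open>r = 1\<close> with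
  \<open>T = Y\<close>.\<close>

lemma power_bounds_iff_norm_bound:
  fixes X L Y T :: "'c \<Rightarrow> ennreal" and r D W N :: real
  assumes r: "0 < r" and pos: "0 < D" "0 < W" "0 < N"
    and DX: "\<And>c. c \<in> V \<Longrightarrow> ennreal D * X c \<le> L c"
    and LW: "\<And>c. c \<in> V \<Longrightarrow> L c \<le> ennreal W * X c"
    and YW: "\<And>c. c \<in> V \<Longrightarrow> Y c \<le> ennreal W * X c"
    and YT: "\<And>c. c \<in> V \<Longrightarrow> epowr (Y c) r \<le> T c"
    and TN: "\<And>c. c \<in> V \<Longrightarrow> T c \<le> ennreal N * epowr (Y c) r"
  shows "(\<exists>A B::real. A > 0 \<and> B > 0 \<and> (\<forall>c\<in>V. ennreal A * epowr (L c) r \<le> T c \<and> T c \<le> ennreal B * epowr (L c) r))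
    \<longleftrightarrow> (\<exists>A::real. A > 0 \<and> (\<forall>c\<in>V. ennreal A * X c \<le> Y c))"
proof
  assume "\<exists>A B::real. A > 0 \<and> B > 0 \<and> (\<forall>c\<in>V. ennreal A * epowr (L c) r \<le> T c \<and> T c \<le> ennreal B * epowr (L c) r)"
  then obtain A where A: "A > 0" "\<And>c. c \<in> V \<Longrightarrow> ennreal A * epowr (L c) r \<le> T c" by blast
  \<comment> \<open>\<open>D\<close> is lost between coefficients and function, \<open>N\<close>
    between the sampled sum and the cell suprema; the r-th root undoes the power.\<close>
  define a where "a = D * (A / N) powr (1 / r)"
  have "a > 0" using A pos by (simp add: a_def)
  moreover have "ennreal a * X c \<le> Y c" if c: "c \<in> V" for c
  proof -
    have ar: "epowr (ennreal a) r = ennreal (1 / N) * ennreal A * ennreal (D powr r)"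
      using A pos r by (simp add: a_def epowr_ennreal powr_mult powr_powr mult_ac flip: ennreal_mult)
    have "epowr (ennreal a * X c) r = ennreal (1 / N) * (ennreal A * epowr (ennreal D * X c) r)"
      using r pos by (simp add: epowr_mult ar mult.assoc epowr_ennreal)
    also have "\<dots> \<le> ennreal (1 / N) * (ennreal A * epowr (L c) r)"
      using r by (intro mult_left_mono epowr_mono DX c) auto
    also have "\<dots> \<le> ennreal (1 / N) * (ennreal N * epowr (Y c) r)"
      by (intro mult_left_mono order_trans[OF A(2)[OF c] TN[OF c]]) auto
    also have "\<dots> = epowr (Y c) r"
      using pos by (simp flip: mult.assoc ennreal_mult)
    finally have "epowr (epowr (ennreal a * X c) r) (1 / r) \<le> epowr (epowr (Y c) r) (1 / r)"
      using r by (intro epowr_mono[of "1 / r"]) auto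
    then show ?thesis using r by simp
  qed
  ultimately show "\<exists>A::real. A > 0 \<and> (\<forall>c\<in>V. ennreal A * X c \<le> Y c)" by blast
next
  assume "\<exists>A::real. A > 0 \<and> (\<forall>c\<in>V. ennreal A * X c \<le> Y c)"
  then obtain a where a: "a > 0" "\<And>c. c \<in> V \<Longrightarrow> ennreal a * X c \<le> Y c" by blast
  define A where "A = (a / W) powr r"
  define B where "B = N * (W / D) powr r"
  have A: "ennreal A * epowr (L c) r \<le> T c" if c: "c \<in> V" for c
  proof -
    have "ennreal A * epowr (L c) r = epowr (ennreal (a / W) * L c) r"
      using a pos r by (simp add: A_def epowr_mult epowr_ennreal)
    also have "ennreal (a / W) * L c \<le> ennreal (a / W) * (ennreal W * X c)"
      by (intro mult_left_mono LW c) auto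
    also have "ennreal (a / W) * (ennreal W * X c) = ennreal a * X c"
      using a pos by (simp flip: mult.assoc ennreal_mult)
    also have "\<dots> \<le> Y c" by (rule a(2)[OF c])
    finally have "ennreal A * epowr (L c) r \<le> epowr (Y c) r"
      using r by (simp add: epowr_mono)
    then show ?thesis by (rule order_trans[OF _ YT[OF c]])
  qed
  have B: "T c \<le> ennreal B * epowr (L c) r" if c: "c \<in> V" for c
  proof -
    have "ennreal W * X c = ennreal (W / D) * (ennreal D * X c)"
      using pos by (simp flip: mult.assoc ennreal_mult)
    also have "\<dots> \<le> ennreal (W / D) * L c"
      by (intro mult_left_mono DX c) auto
    finally have "Y c \<le> ennreal (W / D) * L c"
      by (rule order_trans[OF YW[OF c]])
    then have "epowr (Y c) r \<le> epowr (ennreal (W / D) * L c) r"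
      using r by (intro epowr_mono) auto
    then have "ennreal N * epowr (Y c) r \<le> ennreal N * epowr (ennreal (W / D) * L c) r"
      by (intro mult_left_mono) auto
    also have "\<dots> = ennreal B * epowr (L c) r"
      using pos r by (simp add: B_def epowr_mult epowr_ennreal ennreal_mult mult.assoc)
    finally show ?thesis by (rule order_trans[OF TN[OF c]])
  qed
  have "A > 0" "B > 0" using a pos by (auto simp: A_def B_def)
  with A B show "\<exists>A B::real. A > 0 \<and> B > 0 \<and> (\<forall>c\<in>V. ennreal A * epowr (L c) r \<le> T c \<and> T c \<le> ennreal B * epowr (L c) r)"
    by blast
qed

theorem sampling_set_iff_lower_bounded:
  assumes g: "g \<in> W0" and stable: "stable_integer_shifts g"
    and \<Lambda>: "relatively_separated \<Lambda>" and p: "1 \<le> p"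
  shows "sampling_set p g \<Lambda> \<longleftrightarrow> lower_bounded (samp g \<Lambda>) p"
proof -
  let ?X = "\<lambda>c::int \<Rightarrow> complex. ell_norm p (\<lambda>k. ennreal (norm (c k)))"
  let ?L = "\<lambda>c. Lp_norm p (shift_sum g c)"
  let ?Y = "\<lambda>c. ell_norm p (\<lambda>j. samp g \<Lambda> j c)"
  let ?V = "{c. ?X c < \<infinity>}"
  obtain N0 where N0: "\<And>x. finite (\<Lambda> \<inter> {x..x + 1}) \<and> card (\<Lambda> \<inter> {x..x + 1}) \<le> N0"
    using \<Lambda> unfolding relatively_separated_def by blast
  obtain D where D: "D > 0" "\<And>c. c \<in> ?V \<Longrightarrow> ennreal D * ?X c \<le> ?L c"
    using stable_all_exponents[OF g stable p] by auto
  \<comment> \<open>The added 1 makes the constant positive even if \<open>wmax g\<close> has total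
    mass 0.\<close>
  define W where "W = enn2real (Sig (wmax g)) + 1"
  have W: "W > 0" "Sig (wmax g) \<le> ennreal W"
    using Sig_wmax_finite[OF g] unfolding W_def
    by (auto intro: add_nonneg_pos simp: ennreal_plus less_top)
  have samp_le: "ell_norm p (\<lambda>j. samp g L j c) \<le> ennreal W * ?X c" if "c \<in> ?V" for c L
  proof -
    have "ell_norm p (\<lambda>j. samp g L j c) \<le> Sig (wmax g) * ?X c"
      using that by (intro local_seminorms.norm_S_le[OF local_seminorms_samp[OF g]] shift_norm_ell_norm p
        bounded_if_ell_norm_finite[OF p]) auto
    also have "\<dots> \<le> ennreal W * ?X c" by (intro mult_right_mono W) simp
    finally show ?thesis .
  qed
  have L_le: "?L c \<le> ennreal W * ?X c" if "c \<in> ?V" for c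
    using that by (intro order_trans[OF Lp_norm_shift_sum_le[OF g p] samp_le] bounded_if_ell_norm_finite[OF p]) auto
  have V: "(\<forall>f\<in>V_space p g. P f) \<longleftrightarrow> (\<forall>c\<in>?V. P (shift_sum g c))" for P
    by (auto simp: V_space_def ellp_UNIV_iff)
  have lb: "lower_bounded (samp g \<Lambda>) p \<longleftrightarrow> (\<exists>A::real. A > 0 \<and> (\<forall>c\<in>?V. ennreal A * ?X c \<le> ?Y c))"
    by (simp add: lower_bounded_def)
  show ?thesis
  proof (cases "p = \<infinity>")
    case True
    have "(\<exists>A B::real. A > 0 \<and> B > 0 \<and> (\<forall>c\<in>?V. ennreal A * epowr (?L c) 1 \<le> ?Y c \<and> ?Y c \<le> ennreal B * epowr (?L c) 1))
      \<longleftrightarrow> (\<exists>A::real. A > 0 \<and> (\<forall>c\<in>?V. ennreal A * ?X c \<le> ?Y c))"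
      by (rule power_bounds_iff_norm_bound[where D = D and W = W and N = 1])
         (use D W L_le samp_le in auto)
    then show ?thesis
      unfolding lb sampling_set_def V using \<Lambda> by (simp add: True SUP_samp[simplified])
  next
    case False
    let ?r = "enn2real p"
    have r: "1 \<le> ?r" by (rule one_le_enn2real[OF p False])
    have "(\<exists>A B::real. A > 0 \<and> B > 0 \<and> (\<forall>c\<in>?V.
        ennreal A * epowr (?L c) ?r \<le> (\<Sum>\<^sub>\<infinity>x\<in>\<Lambda>. ennreal (norm (shift_sum g c x) powr ?r)) \<and>
        (\<Sum>\<^sub>\<infinity>x\<in>\<Lambda>. ennreal (norm (shift_sum g c x) powr ?r)) \<le> ennreal B * epowr (?L c) ?r))
      \<longleftrightarrow> (\<exists>A::real. A > 0 \<and> (\<forall>c\<in>?V. ennreal A * ?X c \<le> ?Y c))"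
    proof (rule power_bounds_iff_norm_bound[where D = D and W = W and N = "real N0 + 1"])
      fix c
      have s: "epowr (?Y c) ?r = Sig (\<lambda>j. epowr (samp g \<Lambda> j c) ?r)"
        by (rule epowr_ell_norm[OF p False])
      show "epowr (?Y c) ?r \<le> (\<Sum>\<^sub>\<infinity>x\<in>\<Lambda>. ennreal (norm (shift_sum g c x) powr ?r))"
        unfolding s unfolding samp_def using r by (intro sampling_sum_bounds(1)[OF \<Lambda> _ N0]) auto
      have "(\<Sum>\<^sub>\<infinity>x\<in>\<Lambda>. ennreal (norm (shift_sum g c x) powr ?r)) \<le> ennreal (real N0) * epowr (?Y c) ?r"
        unfolding s unfolding samp_def using r by (intro sampling_sum_bounds(2)[OF \<Lambda> _ N0]) auto
      also have "\<dots> \<le> ennreal (real N0 + 1) * epowr (?Y c) ?r"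
        by (intro mult_right_mono ennreal_leI) auto
      finally show "(\<Sum>\<^sub>\<infinity>x\<in>\<Lambda>. ennreal (norm (shift_sum g c x) powr ?r)) \<le> ennreal (real N0 + 1) * epowr (?Y c) ?r" .
    qed (use D W L_le samp_le r in auto)
    then show ?thesis
      unfolding lb sampling_set_def V using \<Lambda> False by simp
  qed
qed

section \<open>Weak limits\<close>

lemma in_plus_interval_iff:
  fixes A :: "real set"
  shows "x \<in> A + {- \<epsilon><..<\<epsilon>} \<longleftrightarrow> (\<exists>a\<in>A. \<bar>x - a\<bar> < \<epsilon>)"
proof
  assume "\<exists>a\<in>A. \<bar>x - a\<bar> < \<epsilon>"
  then obtain a where "a \<in> A" "\<bar>x - a\<bar> < \<epsilon>" by blast
  then have "a + (x - a) \<in> A + {- \<epsilon><..<\<epsilon>}"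
    by (intro set_plus_intro) auto
  then show "x \<in> A + {- \<epsilon><..<\<epsilon>}" by simp
qed (force simp: set_plus_def)

lemma weakly_converges_iff:
  "weakly_converges L \<Gamma> \<longleftrightarrow> (\<forall>a b \<epsilon>. a < b \<and> \<epsilon> > 0 \<longrightarrow>
    (\<forall>\<^sub>F n in sequentially. (\<forall>x\<in>L n \<inter> {a<..<b}. \<exists>y\<in>\<Gamma>. \<bar>x - y\<bar> < \<epsilon>) \<and>
       (\<forall>x\<in>\<Gamma> \<inter> {a<..<b}. \<exists>y\<in>L n. \<bar>x - y\<bar> < \<epsilon>)))"
  unfolding weakly_converges_def eventually_sequentially subset_iff in_plus_interval_iff Ball_def ..

lemma weakly_convergesD:
  assumes "weakly_converges L \<Gamma>" "a < b" "\<epsilon> > 0"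
  shows "\<forall>\<^sub>F n in sequentially. (\<forall>x\<in>L n \<inter> {a<..<b}. \<exists>y\<in>\<Gamma>. \<bar>x - y\<bar> < \<epsilon>) \<and>
       (\<forall>x\<in>\<Gamma> \<inter> {a<..<b}. \<exists>y\<in>L n. \<bar>x - y\<bar> < \<epsilon>)"
  using assms unfolding weakly_converges_iff by blast

lemma card_inter_length_3:
  fixes \<Lambda> :: "real set"
  assumes "\<And>x. finite (\<Lambda> \<inter> {x..x + 1}) \<and> card (\<Lambda> \<inter> {x..x + 1}) \<le> N"
  shows "finite (\<Lambda> \<inter> {x..x + 3})" "card (\<Lambda> \<inter> {x..x + 3}) \<le> 3 * N"
proof -
  let ?I = "\<lambda>x. \<Lambda> \<inter> {x..x + 1}"
  have sub: "\<Lambda> \<inter> {x..x + 3} \<subseteq> ?I x \<union> (?I (x + 1) \<union> ?I (x + 2))"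
    by auto
  have fin: "finite (?I x \<union> (?I (x + 1) \<union> ?I (x + 2)))"
    using assms[of x] assms[of "x + 1"] assms[of "x + 2"] by simp
  show "finite (\<Lambda> \<inter> {x..x + 3})" by (rule finite_subset[OF sub fin])
  have "card (\<Lambda> \<inter> {x..x + 3}) \<le> card (?I x \<union> (?I (x + 1) \<union> ?I (x + 2)))"
    by (rule card_mono[OF fin sub])
  also have "\<dots> \<le> card (?I x) + (card (?I (x + 1)) + card (?I (x + 2)))"
    by (intro order_trans[OF card_Un_le] add_left_mono card_Un_le)
  also have "\<dots> \<le> 3 * N"
    using assms[of x] assms[of "x + 1"] assms[of "x + 2"] by linarith
  finally show "card (\<Lambda> \<inter> {x..x + 3}) \<le> 3 * N" .
qed

text \<open>Finitely many points of the limit in a unit interval have nearby points in some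
  translate of \<open>\<Lambda>\<close>. Taken closer than half the minimal distance, these are
  distinct, and they lie in an interval of length 3, which holds at most \<open>3 * N\<close>
  points.\<close>

lemma relatively_separated_weak_limit:
  assumes \<Lambda>: "relatively_separated \<Lambda>" and \<Gamma>: "\<Gamma> \<in> W\<^sub>Z \<Lambda>"
  shows "relatively_separated \<Gamma>"
proof -
  obtain N where N: "\<And>x. finite (\<Lambda> \<inter> {x..x + 1}) \<and> card (\<Lambda> \<inter> {x..x + 1}) \<le> N"
    using \<Lambda> unfolding relatively_separated_def by blast
  obtain k where k: "weakly_converges (\<lambda>n. (\<lambda>x. x + of_int (k n)) ` \<Lambda>) \<Gamma>"
    using \<Gamma> unfolding W\<^sub>Z_def by blast
  have card_le: "card F \<le> 3 * N" if F: "finite F" "F \<subseteq> \<Gamma> \<inter> {x..x + 1}" for F x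
  proof -
    \<comment> \<open>The inserted 1 keeps the minimum defined when \<open>F\<close> has fewer than
      two points, and caps the displacement so that length 3 suffices.\<close>
    define \<delta> where "\<delta> = Min (insert 1 ((\<lambda>(a, b). \<bar>a - b\<bar> / 2) ` {(a, b) \<in> F \<times> F. a \<noteq> b}))"
    have fin: "finite ((\<lambda>(a, b). \<bar>a - b\<bar> / 2) ` {(a, b) \<in> F \<times> F. a \<noteq> b})"
      using F by (intro finite_imageI) (auto intro: finite_subset[of _ "F \<times> F"])
    have \<delta>: "\<delta> > 0" "\<delta> \<le> 1"
      unfolding \<delta>_def using fin by (auto simp: Min_gr_iff)
    have sep: "2 * \<delta> \<le> \<bar>a - b\<bar>" if "a \<in> F" "b \<in> F" "a \<noteq> b" for a b
    proof -
      have "\<delta> \<le> \<bar>a - b\<bar> / 2"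
        unfolding \<delta>_def using fin that by (intro Min_le) auto
      then show ?thesis by simp
    qed
    have "\<forall>\<^sub>F n in sequentially. \<forall>z\<in>\<Gamma> \<inter> {x - 1<..<x + 2}. \<exists>y\<in>(\<lambda>x. x + of_int (k n)) ` \<Lambda>. \<bar>z - y\<bar> < \<delta>"
      using weakly_convergesD[OF k _ \<delta>(1), of "x - 1" "x + 2"] by (auto elim: eventually_mono)
    then obtain n where n: "\<forall>z\<in>\<Gamma> \<inter> {x - 1<..<x + 2}. \<exists>y\<in>\<Lambda>. \<bar>z - (y + of_int (k n))\<bar> < \<delta>"
      by (auto simp: eventually_sequentially)
    have "\<forall>z\<in>F. \<exists>y\<in>\<Lambda>. \<bar>z - (y + of_int (k n))\<bar> < \<delta>"
      using n F(2) by force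
    then obtain h where h: "\<And>z. z \<in> F \<Longrightarrow> h z \<in> \<Lambda>" "\<And>z. z \<in> F \<Longrightarrow> \<bar>z - (h z + of_int (k n))\<bar> < \<delta>"
      by metis
    have "inj_on h F"
    proof (rule inj_onI, rule ccontr)
      fix a b assume ab: "a \<in> F" "b \<in> F" "h a = h b" "a \<noteq> b"
      show False using sep[OF ab(1,2,4)] h(2)[OF ab(1)] h(2)[OF ab(2)] ab(3) by linarith
    qed
    have "h ` F \<subseteq> \<Lambda> \<inter> {(x - 1 - of_int (k n))..(x - 1 - of_int (k n)) + 3}"
    proof
      fix y assume "y \<in> h ` F"
      then obtain z where z: "z \<in> F" "y = h z" by blast
      then have "x \<le> z" "z \<le> x + 1" using F(2) by auto
      with h[OF z(1)] \<delta>(2) z(2) show "y \<in> \<Lambda> \<inter> {(x - 1 - of_int (k n))..(x - 1 - of_int (k n)) + 3}"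
        by auto
    qed
    then have "card (h ` F) \<le> card (\<Lambda> \<inter> {(x - 1 - of_int (k n))..(x - 1 - of_int (k n)) + 3})"
      by (intro card_mono card_inter_length_3(1)[OF N])
    also have "\<dots> \<le> 3 * N" by (rule card_inter_length_3(2)[OF N])
    finally show ?thesis using \<open>inj_on h F\<close> by (simp add: card_image)
  qed
  have "finite (\<Gamma> \<inter> {x..x + 1}) \<and> card (\<Gamma> \<inter> {x..x + 1}) \<le> 3 * N" for x
    using card_le[of _ x] by (intro finite_if_finite_subsets_card_bdd) blast
  then show ?thesis unfolding relatively_separated_def by blast
qed

section \<open>Sequential compactness of weak convergence\<close>

lemma convergent_01_eventually_const:
  fixes P :: "nat \<Rightarrow> bool"
  assumes "(\<lambda>n. if P n then 1 else 0 :: real) \<longlonglongrightarrow> l"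
  shows "(\<forall>\<^sub>F n in sequentially. P n) \<or> (\<forall>\<^sub>F n in sequentially. \<not> P n)"
proof (cases "l > 1 / 2")
  case True
  from order_tendstoD(1)[OF assms this] have "\<forall>\<^sub>F n in sequentially. P n"
    by (rule eventually_mono) (auto split: if_splits)
  then show ?thesis ..
next
  case False
  then have "l < 1" by simp
  from order_tendstoD(2)[OF assms this] have "\<forall>\<^sub>F n in sequentially. \<not> P n"
    by (rule eventually_mono) (auto split: if_splits)
  then show ?thesis ..
qed

lemma rational_interval:
  assumes "\<epsilon> > 0"
  obtains p q where "real_of_rat p < x" "x < real_of_rat q" "real_of_rat q - real_of_rat p < \<epsilon>"
proof -
  obtain p where "x - \<epsilon> / 2 < real_of_rat p" "real_of_rat p < x"
    using of_rat_dense[of "x - \<epsilon> / 2" x] assms by auto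
  moreover obtain q where "x < real_of_rat q" "real_of_rat q < x + \<epsilon> / 2"
    using of_rat_dense[of x "x + \<epsilon> / 2"] assms by auto
  ultimately show ?thesis by (intro that) auto
qed

text \<open>A diagonal subsequence decides, for every rational interval, whether it is eventually
  hit or eventually missed. The limit consists of the points all of whose rational neighbourhoods
  are eventually hit; it may be empty.\<close>

lemma weakly_convergent_subsequence:
  fixes L :: "nat \<Rightarrow> real set"
  obtains r \<Gamma> where "strict_mono (r :: nat \<Rightarrow> nat)" "weakly_converges (L \<circ> r) \<Gamma>"
proof -
  define I where "I pq = {real_of_rat (fst pq)<..<real_of_rat (snd pq)}" for pq
  define hit where "hit n pq \<longleftrightarrow> L n \<inter> I pq \<noteq> {}" for n pq
  have "\<exists>r. strict_mono (r :: nat \<Rightarrow> nat) \<and>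
      (\<forall>pq. \<exists>l. (\<lambda>n. if hit (r n) pq then 1 else 0 :: real) \<longlonglongrightarrow> l)"
    by (rule function_convergent_subsequence[of "UNIV :: (rat \<times> rat) set" "\<lambda>n pq. if hit n pq then 1 else 0 :: real" 1])
       (simp_all, blast)
  then obtain r where r: "strict_mono (r :: nat \<Rightarrow> nat)"
    and conv: "\<And>pq. \<exists>l. (\<lambda>n. if hit (r n) pq then 1 else 0 :: real) \<longlonglongrightarrow> l"
    by blast
  have dich: "(\<forall>\<^sub>F n in sequentially. hit (r n) pq) \<or> (\<forall>\<^sub>F n in sequentially. \<not> hit (r n) pq)" for pq
  proof -
    obtain l where "(\<lambda>n. if hit (r n) pq then 1 else 0 :: real) \<longlonglongrightarrow> l"
      using conv by blast
    then show ?thesis by (rule convergent_01_eventually_const)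
  qed
  define \<Gamma> where "\<Gamma> = {x. \<forall>pq. x \<in> I pq \<longrightarrow> (\<forall>\<^sub>F n in sequentially. hit (r n) pq)}"
  have open_I: "open (I pq)" for pq by (simp add: I_def)
  have "weakly_converges (L \<circ> r) \<Gamma>"
    unfolding weakly_converges_iff
  proof (intro allI impI eventually_conj)
    fix a b \<epsilon> :: real assume ab: "a < b \<and> 0 < \<epsilon>"
    \<comment> \<open>Points of \<open>[a, b]\<close> that are far from the limit form a compact
      set, so finitely many eventually missed intervals cover it, and a single index works for all
      of them.\<close>
    define K where "K = {a..b} - (\<Union>\<gamma>\<in>\<Gamma>. ball \<gamma> \<epsilon>)"
    have "compact K" unfolding K_def by (intro compact_diff open_UN ballI) auto
    define U where "U = {pq. \<forall>\<^sub>F n in sequentially. \<not> hit (r n) pq}"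
    have "K \<subseteq> (\<Union>pq\<in>U. I pq)"
    proof
      fix x assume "x \<in> K"
      then have "x \<notin> \<Gamma>" using ab by (auto simp: K_def)
      then obtain pq where pq: "x \<in> I pq" "\<not> (\<forall>\<^sub>F n in sequentially. hit (r n) pq)"
        unfolding \<Gamma>_def mem_Collect_eq by metis
      have "pq \<in> U" using dich[of pq] pq(2) by (simp add: U_def)
      then show "x \<in> (\<Union>pq\<in>U. I pq)" using pq(1) by (rule UN_I)
    qed
    then obtain T where T: "T \<subseteq> U" "finite T" "K \<subseteq> (\<Union>pq\<in>T. I pq)"
      by (rule compactE_image[OF \<open>compact K\<close> open_I])
    have "\<forall>\<^sub>F n in sequentially. \<forall>pq\<in>T. \<not> hit (r n) pq"
      using T by (intro eventually_ball_finite) (auto simp: U_def)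
    then show "\<forall>\<^sub>F n in sequentially. \<forall>x\<in>(L \<circ> r) n \<inter> {a<..<b}. \<exists>y\<in>\<Gamma>. \<bar>x - y\<bar> < \<epsilon>"
    proof eventually_elim
      case n: (elim n)
      show ?case
      proof (intro ballI, rule ccontr)
        fix x assume x: "x \<in> (L \<circ> r) n \<inter> {a<..<b}" and "\<not> (\<exists>y\<in>\<Gamma>. \<bar>x - y\<bar> < \<epsilon>)"
        then have "x \<in> K" by (auto simp: K_def dist_real_def abs_minus_commute)
        then obtain pq where pq: "pq \<in> T" "x \<in> I pq" using T(3) by blast
        then have "hit (r n) pq" using x by (auto simp: hit_def)
        with n pq(1) show False by blast
      qed
    qed
    \<comment> \<open>For the reverse inclusion, finitely many intervals shorter than
      \<open>\<epsilon>\<close> cover \<open>[a, b]\<close>. An interval of the cover that contains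
      a point of the limit is eventually hit, and the hitting point is then closer than
      \<open>\<epsilon>\<close>.\<close>
    define V where "V = {pq. real_of_rat (snd pq) - real_of_rat (fst pq) < \<epsilon>}"
    have "{a..b} \<subseteq> (\<Union>pq\<in>V. I pq)"
    proof
      fix x
      obtain p q where "real_of_rat p < x" "x < real_of_rat q" "real_of_rat q - real_of_rat p < \<epsilon>"
        using rational_interval[of \<epsilon> x] ab by metis
      then show "x \<in> (\<Union>pq\<in>V. I pq)"
        by (intro UN_I[of "(p, q)"]) (auto simp: V_def I_def)
    qed
    then obtain T' where T': "T' \<subseteq> V" "finite T'" "{a..b} \<subseteq> (\<Union>pq\<in>T'. I pq)"
      by (rule compactE_image[OF compact_Icc open_I])
    have "\<forall>\<^sub>F n in sequentially. \<forall>pq\<in>T' \<inter> {pq. \<forall>\<^sub>F n in sequentially. hit (r n) pq}. hit (r n) pq"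
      using T' by (intro eventually_ball_finite) auto
    then show "\<forall>\<^sub>F n in sequentially. \<forall>x\<in>\<Gamma> \<inter> {a<..<b}. \<exists>y\<in>(L \<circ> r) n. \<bar>x - y\<bar> < \<epsilon>"
    proof eventually_elim
      case n: (elim n)
      show ?case
      proof
        fix x assume x: "x \<in> \<Gamma> \<inter> {a<..<b}"
        then have "x \<in> {a..b}" by simp
        then obtain pq where pq: "pq \<in> T'" "x \<in> I pq" using T'(3) by blast
        have "\<forall>\<^sub>F n in sequentially. hit (r n) pq"
          using x pq(2) unfolding \<Gamma>_def by blast
        then have "hit (r n) pq" using n pq(1) by blast
        then obtain y where y: "y \<in> L (r n)" "y \<in> I pq" unfolding hit_def by blast
        have "real_of_rat (snd pq) - real_of_rat (fst pq) < \<epsilon>"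
          using T'(1) pq(1) unfolding V_def by blast
        then have "\<bar>x - y\<bar> < \<epsilon>"
          using pq(2) y(2) by (auto simp: I_def abs_less_iff)
        with y(1) show "\<exists>y\<in>(L \<circ> r) n. \<bar>x - y\<bar> < \<epsilon>" by auto
      qed
    qed
  qed
  with r that show ?thesis by blast
qed

section \<open>Lower bounds and uniqueness along weak limits\<close>

context
  fixes g :: "real \<Rightarrow> complex" and \<Lambda> :: "real set"
  assumes g: "g \<in> W0"
begin

text \<open>The translations that recentre the coefficients are applied to \<open>\<Lambda>\<close>
  as well. A point of the weak limit is then a limit of translated sampling points, and joint
  convergence of coefficients and points carries the vanishing of the samples over to the limit
  function.\<close>

theorem lower_bounded_samp_if_unique:
  assumes stable: "stable_integer_shifts g"
    and unique: "\<And>\<Gamma>. \<Gamma> \<in> W\<^sub>Z \<Lambda> \<Longrightarrow> uniqueness_set \<infinity> g \<Gamma>"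
  shows "lower_bounded (samp g \<Lambda>) \<infinity>"
proof (rule ccontr)
  interpret local_seminorms "samp g \<Lambda>" "wmax g"
    by (rule local_seminorms_samp[OF g])
  assume "\<not> lower_bounded (samp g \<Lambda>) \<infinity>"
  then show False
  proof (rule minimizing_sequence)
    fix C :: "nat \<Rightarrow> int \<Rightarrow> complex" and K c
    assume C: "\<And>n k. norm (C n k) \<le> 1" "\<And>k. (\<lambda>n. C n (k + K n)) \<longlonglongrightarrow> c k" "c 0 \<noteq> 0"
      "(\<lambda>n. SUP j. samp g \<Lambda> j (C n)) \<longlonglongrightarrow> 0"
    have "norm (c k) \<le> 1" for k
      by (rule Lim_norm_ubound[OF _ C(2)]) (auto simp: C(1))
    then have bc: "bounded (range c)" by (auto simp: bounded_iff)
    define L where "L n = (\<lambda>x. x + of_int (- K n)) ` \<Lambda>" for n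
    obtain r \<Gamma> where r: "strict_mono (r :: nat \<Rightarrow> nat)" and \<Gamma>: "weakly_converges (L \<circ> r) \<Gamma>"
      by (rule weakly_convergent_subsequence)
    have "\<Gamma> \<in> W\<^sub>Z \<Lambda>"
      using \<Gamma> unfolding W\<^sub>Z_def L_def o_def by (auto intro!: exI[of _ "\<lambda>n. - K (r n)"])
    have "shift_sum g c \<gamma> = 0" if \<gamma>: "\<gamma> \<in> \<Gamma>" for \<gamma>
    proof -
      \<comment> \<open>Requiring \<open>n \<ge> m\<close> sends the chosen indices to infinity, so
        that the limits of the coefficients and of the samples can be taken along them.\<close>
      have "\<exists>n x. n \<ge> m \<and> x \<in> L (r n) \<and> \<bar>x - \<gamma>\<bar> < 1 / (real m + 1)" for m :: nat
      proof -
        have "\<forall>\<^sub>F n in sequentially. \<forall>x\<in>\<Gamma> \<inter> {\<gamma> - 1<..<\<gamma> + 1}. \<exists>y\<in>(L \<circ> r) n. \<bar>x - y\<bar> < 1 / (real m + 1)"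
          using weakly_convergesD[OF \<Gamma>, of "\<gamma> - 1" "\<gamma> + 1" "1 / (real m + 1)"] by (auto elim: eventually_mono)
        then have "\<forall>\<^sub>F n in sequentially. n \<ge> m \<and> (\<exists>y\<in>L (r n). \<bar>\<gamma> - y\<bar> < 1 / (real m + 1))"
          using eventually_ge_at_top[of m] by eventually_elim (use \<gamma> in auto)
        then show ?thesis
          by (force simp: eventually_sequentially abs_minus_commute)
      qed
      then obtain n X where nX: "\<And>m. n m \<ge> m" "\<And>m. X m \<in> L (r (n m))" "\<And>m::nat. \<bar>X m - \<gamma>\<bar> < 1 / (real m + 1)"
        by metis
      have n_lim: "filterlim (\<lambda>m. r (n m)) sequentially sequentially"
      proof (rule filterlim_at_top_mono[OF filterlim_ident])
        show "\<forall>\<^sub>F m in sequentially. m \<le> r (n m)"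
          using nX(1) seq_suble[OF r] by (intro always_eventually allI) (meson le_trans)
      qed
      have "(\<lambda>m. 1 / (real m + 1)) \<longlonglongrightarrow> 0" by real_asymp
      then have "(\<lambda>m. X m - \<gamma>) \<longlonglongrightarrow> 0"
        by (rule Lim_null_comparison[rotated]) (use nX(3) in \<open>auto intro!: always_eventually simp: less_imp_le\<close>)
      then have X: "X \<longlonglongrightarrow> \<gamma>" by (simp add: LIM_zero_iff)
      have lim: "(\<lambda>m. shift_sum g (\<lambda>k. C (r (n m)) (k + K (r (n m)))) (X m)) \<longlonglongrightarrow> shift_sum g c \<gamma>"
        by (rule shift_sum_tendsto[OF g C(1) _ X]) (rule filterlim_compose[OF C(2) n_lim])
      have "(\<lambda>m. ennreal (norm (shift_sum g (\<lambda>k. C (r (n m)) (k + K (r (n m)))) (X m)))) \<longlonglongrightarrow> 0"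
      proof (rule tendsto_sandwich[OF _ _ tendsto_const filterlim_compose[OF C(4) n_lim]])
        show "\<forall>\<^sub>F m in sequentially. ennreal (norm (shift_sum g (\<lambda>k. C (r (n m)) (k + K (r (n m)))) (X m)))
           \<le> (SUP j. samp g \<Lambda> j (C (r (n m))))"
        proof (intro always_eventually allI)
          fix m
          have "X m + of_int (K (r (n m))) \<in> \<Lambda>" using nX(2)[of m] by (auto simp: L_def)
          then show "ennreal (norm (shift_sum g (\<lambda>k. C (r (n m)) (k + K (r (n m)))) (X m)))
             \<le> (SUP j. samp g \<Lambda> j (C (r (n m))))"
            using SUP_samp[of g \<Lambda> "C (r (n m))"] unfolding shift_sum_translate[OF g]
            by (auto simp: ell_norm_def intro!: SUP_upper)
        qed
      qed auto
      moreover have "(\<lambda>m. ennreal (norm (shift_sum g (\<lambda>k. C (r (n m)) (k + K (r (n m)))) (X m)))) \<longlonglongrightarrow> ennreal (norm (shift_sum g c \<gamma>))"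
        by (intro tendsto_ennrealI tendsto_norm lim)
      ultimately have "ennreal (norm (shift_sum g c \<gamma>)) = 0"
        using LIMSEQ_unique by blast
      then show ?thesis by simp
    qed
    moreover have "shift_sum g c \<in> V_space \<infinity> g"
      using ell_norm_finite_if_bounded[OF bc] by (auto simp: V_space_def ellp_UNIV_iff)
    ultimately have "shift_sum g c = (\<lambda>_. 0)"
      using unique[OF \<open>\<Gamma> \<in> W\<^sub>Z \<Lambda>\<close>] unfolding uniqueness_set_def by blast
    then show False
      using shift_sum_eq_zero_iff[OF g stable bc] C(3) by simp
  qed
qed

text \<open>The constant does not depend on the translate; this uniformity is what survives in a
  weak limit.\<close>

lemma translate_lower_bound:
  assumes A: "\<And>c. ell_norm \<infinity> (\<lambda>k. ennreal (norm (c k))) < \<infinity> \<Longrightarrow>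
      ennreal A * ell_norm \<infinity> (\<lambda>k. ennreal (norm (c k))) \<le> ell_norm \<infinity> (\<lambda>j. samp g \<Lambda> j c)"
    and fin: "ell_norm \<infinity> (\<lambda>k. ennreal (norm (c k))) < \<infinity>"
  shows "ennreal A * ell_norm \<infinity> (\<lambda>k. ennreal (norm (c k)))
      \<le> ell_norm \<infinity> (\<lambda>j. samp g ((\<lambda>x. x + of_int K) ` \<Lambda>) j c)"
proof -
  have sh: "ell_norm \<infinity> (\<lambda>k. ennreal (norm (c (k + K)))) = ell_norm \<infinity> (\<lambda>k. ennreal (norm (c k)))"
    by (rule shift_norm.shift[OF shift_norm_ell_norm, of \<infinity> "\<lambda>k. ennreal (norm (c k))" K]) simp
  have "ell_norm \<infinity> (\<lambda>j. samp g ((\<lambda>x. x + of_int K) ` \<Lambda>) j c) = ell_norm \<infinity> (\<lambda>j. samp g \<Lambda> j (\<lambda>k. c (k + K)))"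
    unfolding SUP_samp shift_sum_translate[OF g] by (simp add: image_image)
  with A[of "\<lambda>k. c (k + K)"] sh fin show ?thesis by simp
qed

text \<open>In the localised bound for the translates \<open>L n\<close>, the windowed seminorm at
  any fixed centre is, for suitable \<open>n\<close>, at most the supremum over
  \<open>\<Gamma>\<close> plus \<open>\<epsilon>\<close>. The resulting inequality no longer
  mentions \<open>n\<close>, and taking the supremum over centres and absorbing the error yields a
  bound for \<open>\<Gamma>\<close>.\<close>

theorem lower_bounded_samp_weak_limit:
  assumes lb: "lower_bounded (samp g \<Lambda>) \<infinity>" and \<Gamma>: "\<Gamma> \<in> W\<^sub>Z \<Lambda>"
  shows "lower_bounded (samp g \<Gamma>) \<infinity>"
proof -
  let ?N = "ell_norm \<infinity> :: (int \<Rightarrow> ennreal) \<Rightarrow> ennreal"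
  obtain A where A: "A > 0" "\<And>c. ?N (\<lambda>k. ennreal (norm (c k))) < \<infinity> \<Longrightarrow>
      ennreal A * ?N (\<lambda>k. ennreal (norm (c k))) \<le> ?N (\<lambda>j. samp g \<Lambda> j c)"
    using lb unfolding lower_bounded_def by blast
  obtain k where k: "weakly_converges (\<lambda>n. (\<lambda>x. x + of_int (k n)) ` \<Lambda>) \<Gamma>"
    using \<Gamma> unfolding W\<^sub>Z_def by blast
  define L where "L n = (\<lambda>x. x + of_int (k n)) ` \<Lambda>" for n
  have N: "shift_norm ?N" by (rule shift_norm_ell_norm) simp
  obtain \<theta> where \<theta>: "0 < \<theta>" "\<theta> < 1" "Sig (defect (wmax g) \<theta>) < ennreal (A / 4)"
    using local_seminorms.defect_small[OF local_seminorms_samp[OF g], of "ennreal (A / 4)"] A by auto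
  let ?e = "2 * Sig (defect (wmax g) \<theta>)"
  have "ennreal (A / 2) * ?N (\<lambda>k. ennreal (norm (c k))) \<le> ?N (\<lambda>j. samp g \<Gamma> j c)"
    if fin: "?N (\<lambda>k. ennreal (norm (c k))) < \<infinity>" for c
  proof -
    have c: "bounded (range c)" using bounded_if_ell_norm_finite[OF _ fin] by simp
    define a where "a = window_norm ?N \<theta> (\<lambda>k. ennreal (norm (c k)))"
    define Y where "Y = ?N (\<lambda>j. samp g \<Gamma> j c)"
    define B where "B = enn2real (Sig (wmax g) * ?N (\<lambda>k. ennreal (norm (c k))))"
    have B: "samp g (L n) j c \<le> ennreal B" for n j
    proof -
      have "samp g (L n) j c \<le> ?N (\<lambda>j. samp g (L n) j c)"
        by (rule ell_norm_point_le) simp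
      also have "\<dots> \<le> Sig (wmax g) * ?N (\<lambda>k. ennreal (norm (c k)))"
        by (rule local_seminorms.norm_S_le[OF local_seminorms_samp[OF g] N c])
      also have "\<dots> = ennreal B"
        using fin Sig_wmax_finite[OF g] unfolding B_def by (simp add: ennreal_mult_less_top less_top)
      finally show ?thesis .
    qed
    have B0: "B \<ge> 0" by (simp add: B_def)
    have window: "\<exists>n. window_norm ?N \<theta> (\<lambda>j. samp g (L n) j c) m \<le> Y + ennreal \<epsilon>" if \<epsilon>: "\<epsilon> > 0" for m \<epsilon>
    proof -
      have "(\<lambda>J. \<theta> ^ J * B) \<longlonglongrightarrow> 0 * B"
        using \<theta> by (intro tendsto_mult LIMSEQ_power_zero tendsto_const) auto
      then have "\<forall>\<^sub>F J in sequentially. \<theta> ^ J * B < \<epsilon>"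
        using \<epsilon> by (intro order_tendstoD(2)) auto
      then obtain J where J: "\<theta> ^ J * B < \<epsilon>" by (auto simp: eventually_sequentially)
      \<comment> \<open>The interval contains all cells at distance less than \<open>J\<close> from
        \<open>m\<close>. Uniform continuity is taken on an interval larger by 1 on each side,
        because nearby points of \<open>\<Gamma>\<close> may fall outside.\<close>
      define u v where "u = real_of_int m - real J - 1" and "v = real_of_int m + real J + 2"
      have "uniformly_continuous_on {u - 1..v + 1} (shift_sum g c)"
        by (intro compact_uniformly_continuous continuous_on_subset[OF shift_sum_continuous[OF g c]]) auto
      then obtain \<delta> where \<delta>: "\<delta> > 0" "\<And>x y. x \<in> {u - 1..v + 1} \<Longrightarrow> y \<in> {u - 1..v + 1} \<Longrightarrow> dist x y < \<delta> \<Longrightarrow>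
          dist (shift_sum g c x) (shift_sum g c y) < \<epsilon>"
        unfolding uniformly_continuous_on_def using \<epsilon> by metis
      have "\<forall>\<^sub>F n in sequentially. \<forall>x\<in>L n \<inter> {u<..<v}. \<exists>y\<in>\<Gamma>. \<bar>x - y\<bar> < min \<delta> 1"
        using weakly_convergesD[OF k, of u v "min \<delta> 1"] \<delta>(1) unfolding L_def u_def v_def
        by (auto elim: eventually_mono)
      then obtain n where n: "\<forall>x\<in>L n \<inter> {u<..<v}. \<exists>y\<in>\<Gamma>. \<bar>x - y\<bar> < min \<delta> 1"
        using eventually_happens'[OF sequentially_bot] by blast
      have "ennreal (exp_window \<theta> m j) * samp g (L n) j c \<le> Y + ennreal \<epsilon>" for j
      \<comment> \<open>In far cells the window is at most \<open>\<theta> ^ J\<close>, which beats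
        the uniform bound \<open>B\<close>; near cells are compared with \<open>\<Gamma>\<close>
        point by point.\<close>
      proof (cases "J \<le> nat \<bar>j - m\<bar>")
        case True
        have "ennreal (exp_window \<theta> m j) * samp g (L n) j c \<le> ennreal (\<theta> ^ J) * ennreal B"
          unfolding exp_window_def using \<theta> True by (intro mult_mono ennreal_leI power_decreasing B) auto
        also have "\<dots> \<le> ennreal \<epsilon>"
          using J B0 \<theta> by (simp flip: ennreal_mult add: ennreal_leI)
        finally show ?thesis by (rule order_trans) simp
      next
        case False
        have "samp g (L n) j c \<le> Y + ennreal \<epsilon>"
          unfolding samp_def
        proof (rule SUP_least)
          fix x assume x: "x \<in> L n \<inter> cell j"
          then have jx: "\<lfloor>x\<rfloor> = j" by (simp add: in_cell_iff)
          have "\<bar>j - m\<bar> < int J" using False by linarith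
          then have "m - int J < \<lfloor>x\<rfloor>" "\<lfloor>x\<rfloor> < m + int J" using jx by auto
          then have uv: "u < x" "x < v" unfolding u_def v_def by linarith+
          obtain y where y: "y \<in> \<Gamma>" "\<bar>x - y\<bar> < min \<delta> 1" using n uv x by force
          have "dist (shift_sum g c x) (shift_sum g c y) < \<epsilon>"
            using uv y by (intro \<delta>(2)) (auto simp: dist_real_def)
          then have "norm (shift_sum g c x) \<le> norm (shift_sum g c y) + \<epsilon>"
            by (metis add.commute dist_norm less_imp_le norm_triangle_ineq2 order_trans diff_le_eq)
          then have "ennreal (norm (shift_sum g c x)) \<le> ennreal (norm (shift_sum g c y)) + ennreal \<epsilon>"
            using \<epsilon> by (metis ennreal_leI ennreal_plus less_imp_le norm_ge_zero)
          also have "\<dots> \<le> Y + ennreal \<epsilon>"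
            unfolding Y_def SUP_samp by (intro add_right_mono SUP_upper y)
          finally show "ennreal (norm (shift_sum g c x)) \<le> Y + ennreal \<epsilon>" .
        qed
        then show ?thesis
          using mult_mono[of "ennreal (exp_window \<theta> m j)" 1 "samp g (L n) j c" "Y + ennreal \<epsilon>"]
            exp_window_le_1[OF \<theta>(1,2), of m j] by simp
      qed
      then show ?thesis
        by (intro exI[of _ n]) (auto simp: window_norm_def ell_norm_def intro: SUP_least)
    qed
    have am: "ennreal A * a m \<le> Y + ?e * ?N a" for m
    \<comment> \<open>The index \<open>n\<close> depends on \<open>m\<close> and on
      \<open>\<epsilon>\<close>, so the limit is taken through an arbitrary
      \<open>\<epsilon>\<close> for each centre separately.\<close>
    proof (rule ennreal_le_epsilon)
      fix \<epsilon> :: real assume "0 < \<epsilon>"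
      then obtain n where n: "window_norm ?N \<theta> (\<lambda>j. samp g (L n) j c) m \<le> Y + ennreal \<epsilon>"
        using window by blast
      have "ennreal A * a m \<le> window_norm ?N \<theta> (\<lambda>j. samp g (L n) j c) m
          + Sig (\<lambda>s. defect (wmax g) \<theta> s * (a m + a (m - s)))"
        unfolding a_def L_def
        by (rule local_seminorms.localized_lower_bound[OF local_seminorms_samp[OF g] N translate_lower_bound[OF A(2)] c \<theta>(1,2)])
      also have "Sig (\<lambda>s. defect (wmax g) \<theta> s * (a m + a (m - s))) \<le> Sig (\<lambda>s. defect (wmax g) \<theta> s * (?N a + ?N a))"
        by (intro nn_integral_mono mult_left_mono add_mono ell_norm_point_le) auto
      also have "\<dots> = Sig (defect (wmax g) \<theta>) * (?N a + ?N a)"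
        by (rule nn_integral_multc) auto
      also have "\<dots> = ?e * ?N a"
        by (simp only: mult_2 distrib_left distrib_right)
      finally have "ennreal A * a m \<le> window_norm ?N \<theta> (\<lambda>j. samp g (L n) j c) m + ?e * ?N a"
        by (simp add: add_left_mono)
      also have "\<dots> \<le> (Y + ennreal \<epsilon>) + ?e * ?N a" by (intro add_right_mono n)
      finally show "ennreal A * a m \<le> Y + ?e * ?N a + ennreal \<epsilon>" by (simp add: ac_simps)
    qed
    have "ennreal A * ?N a = ?N (\<lambda>m. ennreal A * a m)"
      by (rule ell_norm_cmult[symmetric]) simp
    also have "\<dots> \<le> Y + ?e * ?N a"
      using am by (auto simp: ell_norm_def intro!: SUP_least)
    finally have main: "ennreal A * ?N a \<le> Y + ?e * ?N a" .
    have "?N a \<le> Sig (\<lambda>l. ennreal (exp_window \<theta> 0 l)) * ?N (\<lambda>k. ennreal (norm (c k)))"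
      unfolding a_def by (rule norm_window_norm_le[OF N N \<theta>(1,2)])
    also have "\<dots> < \<infinity>"
      using Sig_exp_window_finite[OF \<theta>(1,2)] fin by (simp add: ennreal_mult_less_top)
    finally have "?N a < \<infinity>" .
    moreover have "2 * ?e \<le> ennreal A"
    proof -
      have "2 * ?e = 4 * Sig (defect (wmax g) \<theta>)" by (simp flip: mult.assoc)
      also have "\<dots> \<le> 4 * ennreal (A / 4)" using \<theta>(3) by (intro mult_left_mono) auto
      also have "\<dots> = ennreal A"
        by (metis ennreal_mult' ennreal_numeral nonzero_mult_div_cancel_left times_divide_eq_right zero_le_numeral zero_neq_numeral)
      finally show ?thesis .
    qed
    ultimately have half: "(ennreal A / 2) * ?N a \<le> Y"
      using absorb_ennreal[OF main] by simp
    have "ennreal (A / 2) = ennreal A / 2"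
      using A(1) by (metis divide_ennreal ennreal_numeral less_imp_le zero_less_numeral)
    moreover have "?N (\<lambda>k. ennreal (norm (c k))) \<le> ?N a"
      unfolding a_def by (intro shift_norm.mono[OF N] point_le_window_norm[OF N])
    ultimately have "ennreal (A / 2) * ?N (\<lambda>k. ennreal (norm (c k))) \<le> (ennreal A / 2) * ?N a"
      by (simp add: mult_left_mono)
    then show ?thesis
      using half unfolding Y_def by (rule order_trans)
  qed
  then show ?thesis
    unfolding lower_bounded_def using A(1) by (intro exI[of _ "A / 2"]) auto
qed

end

section \<open>Annihilators in \<open>\<ell>\<^sup>1\<close>\<close>

lemma ellp_norm_1:
  assumes "countable I"
  shows "ellp_norm 1 I c = (\<integral>\<^sup>+i. ennreal (norm (c i)) \<partial>count_space I)"
  by (simp add: ellp_norm_def infsum_ennreal_eq_nn_integral[OF assms])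

text \<open>Sublinearity relative to \<open>X\<close>; positive homogeneity follows from the stated inequality by scaling back.\<close>

definition sublinear_on :: "('i \<Rightarrow> complex) set \<Rightarrow> (('i \<Rightarrow> complex) \<Rightarrow> real) \<Rightarrow> bool" where
  "sublinear_on X s \<longleftrightarrow> s (\<lambda>_. 0) = 0 \<and>
    (\<forall>x\<in>X. \<forall>y\<in>X. s (\<lambda>i. x i + y i) \<le> s x + s y) \<and>
    (\<forall>x\<in>X. \<forall>t>0. s (\<lambda>i. of_real t * x i) \<le> t * s x)"

text \<open>
  The step makes a sublinear functional odd in the direction \<open>y\<close>. Iterating it over countably many directions
  that span a dense subspace replaces Zorn's lemma in the Hahn-Banach argument for \<open>\<ell>\<^sup>1\<close>.
\<close>

definition sublinear_step ::
    "(('i \<Rightarrow> complex) \<Rightarrow> real) \<Rightarrow> ('i \<Rightarrow> complex) \<Rightarrow> ('i \<Rightarrow> complex) \<Rightarrow> real" where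
  "sublinear_step s y x = (INF t\<in>{0..}. s (\<lambda>i. x i + of_real t * y i) - t * s y)"

text \<open>Real scalars, because the functionals of the construction are real-valued; complex
  coefficients are recovered from the real part of a pairing.\<close>

definition real_subspace :: "('i \<Rightarrow> complex) set \<Rightarrow> bool" where
  "real_subspace X \<longleftrightarrow> (\<lambda>_. 0) \<in> X \<and> (\<forall>x\<in>X. \<forall>y\<in>X. (\<lambda>i. x i + y i) \<in> X) \<and>
    (\<forall>x\<in>X. \<forall>t. (\<lambda>i. of_real t * x i) \<in> X)"

section \<open>Sublinear functionals and the step that makes them odd in one direction\<close>

context
  fixes X :: "('i \<Rightarrow> complex) set"
  assumes X: "real_subspace X"
begin

lemma subspace_add: "x \<in> X \<Longrightarrow> y \<in> X \<Longrightarrow> (\<lambda>i. x i + y i) \<in> X"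
  and subspace_scale: "x \<in> X \<Longrightarrow> (\<lambda>i. of_real t * x i) \<in> X"
  and subspace_zero: "(\<lambda>_. 0) \<in> X"
  using X by (auto simp: real_subspace_def)

lemma subspace_minus: "x \<in> X \<Longrightarrow> (\<lambda>i. - x i) \<in> X"
  using subspace_scale[of x "- 1"] by simp

lemma subspace_add_scale: "x \<in> X \<Longrightarrow> y \<in> X \<Longrightarrow> (\<lambda>i. x i + of_real t * y i) \<in> X"
  by (intro subspace_add subspace_scale)

lemma sublinear_scale:
  assumes "sublinear_on X s" "x \<in> X" "0 \<le> t"
  shows "s (\<lambda>i. of_real t * x i) = t * s x"
proof (cases "t = 0")
  case False
  then have t: "t > 0" using assms by simp
  have "s (\<lambda>i. of_real (1 / t) * (of_real t * x i)) \<le> 1 / t * s (\<lambda>i. of_real t * x i)"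
    using assms(1) subspace_scale[OF assms(2), of t] t unfolding sublinear_on_def
    by (metis zero_less_divide_1_iff)
  then have "s x \<le> 1 / t * s (\<lambda>i. of_real t * x i)" using t by simp
  then have "t * s x \<le> s (\<lambda>i. of_real t * x i)" using t by (simp add: field_simps)
  moreover have "s (\<lambda>i. of_real t * x i) \<le> t * s x"
    using assms t by (auto simp: sublinear_on_def)
  ultimately show ?thesis by simp
qed (use assms in \<open>simp add: sublinear_on_def\<close>)

lemma sublinear_add: "sublinear_on X s \<Longrightarrow> x \<in> X \<Longrightarrow> y \<in> X \<Longrightarrow> s (\<lambda>i. x i + y i) \<le> s x + s y"
  by (simp add: sublinear_on_def)

lemma sublinear_neg: "sublinear_on X s \<Longrightarrow> x \<in> X \<Longrightarrow> - s (\<lambda>i. - x i) \<le> s x"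
  using sublinear_add[of s x "\<lambda>i. - x i"] subspace_minus[of x] by (auto simp: sublinear_on_def)

context
  fixes s y
  assumes s: "sublinear_on X s" and y: "y \<in> X"
begin

text \<open>Subadditivity for \<open>t y = (x + t y) + (- x)\<close>. The bound is independent of
  \<open>t\<close>, so the infimum in \<open>sublinear_step\<close> is taken over a set bounded
  below.\<close>

lemma sublinear_step_lower:
  assumes "x \<in> X" "0 \<le> t"
  shows "- s (\<lambda>i. - x i) \<le> s (\<lambda>i. x i + of_real t * y i) - t * s y"
proof -
  have "t * s y = s (\<lambda>i. of_real t * y i)"
    by (rule sublinear_scale[OF s y assms(2), symmetric])
  also have "\<dots> = s (\<lambda>i. (x i + of_real t * y i) + - x i)" by simp
  also have "\<dots> \<le> s (\<lambda>i. x i + of_real t * y i) + s (\<lambda>i. - x i)"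
    by (intro sublinear_add[OF s] subspace_add_scale subspace_minus assms y)
  finally show ?thesis by simp
qed

lemma sublinear_step_bdd:
  assumes "x \<in> X"
  shows "bdd_below ((\<lambda>t. s (\<lambda>i. x i + of_real t * y i) - t * s y) ` {0..})"
  by (rule bdd_belowI2[of _ "- s (\<lambda>i. - x i)"]) (simp add: sublinear_step_lower assms)

lemma sublinear_step_le:
  "x \<in> X \<Longrightarrow> 0 \<le> t \<Longrightarrow> sublinear_step s y x \<le> s (\<lambda>i. x i + of_real t * y i) - t * s y"
  unfolding sublinear_step_def by (intro cINF_lower sublinear_step_bdd) auto

lemma sublinear_step_decreases: "x \<in> X \<Longrightarrow> sublinear_step s y x \<le> s x"
  using sublinear_step_le[of x 0] by simp

text \<open>The value at \<open>t = 1\<close>. Together with \<open>sublinear_step_decreases\<close>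
  and \<open>sublinear_neg\<close> for the new functional, it forces oddness in the direction
  \<open>y\<close> and leaves the value at \<open>y\<close> unchanged.\<close>

lemma sublinear_step_neg: "sublinear_step s y (\<lambda>i. - y i) \<le> - s y"
  using sublinear_step_le[of "\<lambda>i. - y i" 1] subspace_minus[OF y] s by (simp add: sublinear_on_def)

text \<open>Near-optimal parameters for two vectors combine to their sum, and scaling a vector by
  \<open>t\<close> scales the parameter by \<open>t\<close>.\<close>

lemma sublinear_on_step: "sublinear_on X (sublinear_step s y)"
  unfolding sublinear_on_def
proof (intro conjI ballI allI impI)
  have "sublinear_step s y (\<lambda>_. 0) = (INF t\<in>{0::real..}. 0)"
    unfolding sublinear_step_def
    by (rule INF_cong) (simp_all add: sublinear_scale[OF s y])
  then show "sublinear_step s y (\<lambda>_. 0) = 0" by simp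
next
  fix x1 x2 assume x: "x1 \<in> X" "x2 \<in> X"
  have "sublinear_step s y (\<lambda>i. x1 i + x2 i) - (s (\<lambda>i. x2 i + of_real t2 * y i) - t2 * s y) \<le> sublinear_step s y x1"
    if t2: "0 \<le> t2" for t2
    unfolding sublinear_step_def[of s y x1]
  proof (rule cINF_greatest)
    fix t1 :: real assume "t1 \<in> {0..}"
    then have t1: "0 \<le> t1" by simp
    have "sublinear_step s y (\<lambda>i. x1 i + x2 i) \<le> s (\<lambda>i. (x1 i + x2 i) + of_real (t1 + t2) * y i) - (t1 + t2) * s y"
      using x t1 t2 by (intro sublinear_step_le subspace_add) auto
    also have "(\<lambda>i. (x1 i + x2 i) + of_real (t1 + t2) * y i) = (\<lambda>i. (x1 i + of_real t1 * y i) + (x2 i + of_real t2 * y i))"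
      by (simp add: algebra_simps)
    also have "s \<dots> \<le> s (\<lambda>i. x1 i + of_real t1 * y i) + s (\<lambda>i. x2 i + of_real t2 * y i)"
      by (intro sublinear_add[OF s] subspace_add_scale x y)
    finally show "sublinear_step s y (\<lambda>i. x1 i + x2 i) - (s (\<lambda>i. x2 i + of_real t2 * y i) - t2 * s y)
        \<le> s (\<lambda>i. x1 i + of_real t1 * y i) - t1 * s y"
      by (simp add: algebra_simps)
  qed simp
  then have "sublinear_step s y (\<lambda>i. x1 i + x2 i) - sublinear_step s y x1 \<le> sublinear_step s y x2"
    unfolding sublinear_step_def[of s y x2] by (intro cINF_greatest) (auto simp: algebra_simps)
  then show "sublinear_step s y (\<lambda>i. x1 i + x2 i) \<le> sublinear_step s y x1 + sublinear_step s y x2"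
    by simp
next
  fix x and t :: real assume x: "x \<in> X" and t: "t > 0"
  have "sublinear_step s y (\<lambda>i. of_real t * x i) / t \<le> sublinear_step s y x"
    unfolding sublinear_step_def[of s y x]
  proof (rule cINF_greatest)
    fix u :: real assume "u \<in> {0..}"
    then have u: "0 \<le> u" by simp
    have "sublinear_step s y (\<lambda>i. of_real t * x i) \<le> s (\<lambda>i. of_real t * x i + of_real (t * u) * y i) - t * u * s y"
      using t u x by (intro sublinear_step_le subspace_scale) auto
    also have "(\<lambda>i. of_real t * x i + of_real (t * u) * y i) = (\<lambda>i. of_real t * (x i + of_real u * y i))"
      by (simp add: algebra_simps)
    also have "s \<dots> = t * s (\<lambda>i. x i + of_real u * y i)"
      using t by (intro sublinear_scale[OF s] subspace_add_scale x y) simp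
    finally show "sublinear_step s y (\<lambda>i. of_real t * x i) / t \<le> s (\<lambda>i. x i + of_real u * y i) - u * s y"
      using t by (simp add: field_simps)
  qed simp
  then show "sublinear_step s y (\<lambda>i. of_real t * x i) \<le> t * sublinear_step s y x"
    using t by (simp add: field_simps)
qed

end

text \<open>The step along \<open>z\<close> precedes all others and fixes the value at
  \<open>z\<close>. Oddness gained in one direction survives later steps, because these only
  decrease the functional at a vector and at its negative. The bound below by
  \<open>- q (- x)\<close> makes the decreasing sequence converge.\<close>

lemma sublinear_minorant:
  fixes y :: "nat \<Rightarrow> 'i \<Rightarrow> complex"
  assumes q: "sublinear_on X q" and y: "\<And>n. y n \<in> X" and z: "z \<in> X"
  shows "\<exists>u. sublinear_on X u \<and> (\<forall>x\<in>X. u x \<le> q x) \<and>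
    (\<forall>n. u (\<lambda>i. - y n i) = - u (y n)) \<and> q z \<le> u z"
proof -
  define s where "s n = rec_nat (sublinear_step q z) (\<lambda>n s. sublinear_step s (y n)) n" for n
  have s0: "s 0 = sublinear_step q z" and sS: "s (Suc n) = sublinear_step (s n) (y n)" for n
    by (simp_all add: s_def)
  have sub: "sublinear_on X (s n)" for n
    by (induction n) (simp_all add: s0 sS sublinear_on_step q z y)
  have dec: "decseq (\<lambda>n. s n x)" if "x \<in> X" for x
    by (rule decseq_SucI) (simp add: sS sublinear_step_decreases[OF sub y that])
  have le_q: "s n x \<le> q x" if "x \<in> X" for n x
  proof -
    have "s n x \<le> s 0 x" using dec[OF that] by (simp add: decseq_def)
    also have "\<dots> \<le> q x" unfolding s0 by (rule sublinear_step_decreases[OF q z that])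
    finally show ?thesis .
  qed
  have lower: "- q (\<lambda>i. - x i) \<le> s n x" if "x \<in> X" for n x
    using sublinear_neg[OF sub that, of n] le_q[OF subspace_minus[OF that], of n] by simp
  define u where "u x = lim (\<lambda>n. s n x)" for x
  have lim: "(\<lambda>n. s n x) \<longlonglongrightarrow> u x" if x: "x \<in> X" for x
  proof -
    obtain L where "(\<lambda>n. s n x) \<longlonglongrightarrow> L"
      by (rule decseq_convergent[OF dec[OF x], of "- q (\<lambda>i. - x i)"]) (use lower[OF x] in blast)+
    then show ?thesis unfolding u_def by (simp add: limI)
  qed
  have u_le: "u x \<le> s n x" if "x \<in> X" for x n
    by (rule decseq_ge[OF dec[OF that] lim[OF that]])
  have u_sub: "sublinear_on X u"
    unfolding sublinear_on_def
  proof (intro conjI ballI allI impI)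
    have "s n (\<lambda>_. 0) = 0" for n using sub[of n] by (simp add: sublinear_on_def)
    then show "u (\<lambda>_. 0) = 0"
      using lim[OF subspace_zero] by (simp add: LIMSEQ_const_iff)
  next
    fix x1 x2 assume x: "x1 \<in> X" "x2 \<in> X"
    show "u (\<lambda>i. x1 i + x2 i) \<le> u x1 + u x2"
      by (rule LIMSEQ_le[OF lim[OF subspace_add[OF x]] tendsto_add[OF lim[OF x(1)] lim[OF x(2)]]])
         (use sublinear_add[OF sub x] in blast)
  next
    fix x and t :: real assume x: "x \<in> X" and t: "0 < t"
    show "u (\<lambda>i. of_real t * x i) \<le> t * u x"
      by (rule LIMSEQ_le[OF lim[OF subspace_scale[OF x]] tendsto_mult[OF tendsto_const lim[OF x]]])
         (use sub x t in \<open>auto simp: sublinear_on_def\<close>)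
  qed
  show ?thesis
  proof (intro exI[of _ u] conjI ballI allI)
    show "sublinear_on X u" by (rule u_sub)
    show "u x \<le> q x" if "x \<in> X" for x
      using u_le[OF that, of 0] le_q[OF that, of 0] by simp
    show "u (\<lambda>i. - y n i) = - u (y n)" for n
    proof -
      have "u (\<lambda>i. - y n i) \<le> s (Suc n) (\<lambda>i. - y n i)"
        by (rule u_le[OF subspace_minus[OF y]])
      also have "\<dots> \<le> - s n (y n)" unfolding sS by (rule sublinear_step_neg[OF sub y])
      also have "\<dots> \<le> - u (y n)" using u_le[OF y[of n], of n] by simp
      finally show ?thesis
        using sublinear_neg[OF u_sub y[of n]] by simp
    qed
    have "u (\<lambda>i. - z i) \<le> s 0 (\<lambda>i. - z i)"
      by (rule u_le[OF subspace_minus[OF z]])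
    also have "\<dots> \<le> - q z" unfolding s0 by (rule sublinear_step_neg[OF q z])
    finally show "q z \<le> u z"
      using sublinear_neg[OF u_sub z] by simp
  qed
qed

end

section \<open>Bounded functionals on the absolutely summable sequences\<close>

definition ell1 :: "(int \<Rightarrow> complex) set" where
  "ell1 = {x. (\<lambda>k. norm (x k)) summable_on UNIV}"

definition norm1 :: "(int \<Rightarrow> complex) \<Rightarrow> real" where
  "norm1 x = (\<Sum>\<^sub>\<infinity>k. norm (x k))"

lemma norm1_nonneg: "0 \<le> norm1 x"
  by (simp add: norm1_def infsum_nonneg)

lemma ell1_add: "x \<in> ell1 \<Longrightarrow> y \<in> ell1 \<Longrightarrow> (\<lambda>k. x k + y k) \<in> ell1"
  and norm1_add: "x \<in> ell1 \<Longrightarrow> y \<in> ell1 \<Longrightarrow> norm1 (\<lambda>k. x k + y k) \<le> norm1 x + norm1 y"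
proof -
  assume xy: "x \<in> ell1" "y \<in> ell1"
  then have s: "(\<lambda>k. norm (x k) + norm (y k)) summable_on UNIV"
    by (auto simp: ell1_def intro: summable_on_add)
  show 1: "(\<lambda>k. x k + y k) \<in> ell1"
    unfolding ell1_def using s by (auto intro: summable_on_comparison_test norm_triangle_ineq)
  have "norm1 (\<lambda>k. x k + y k) \<le> (\<Sum>\<^sub>\<infinity>k. norm (x k) + norm (y k))"
    unfolding norm1_def using 1 s by (intro infsum_mono norm_triangle_ineq) (auto simp: ell1_def)
  also have "\<dots> = norm1 x + norm1 y"
    unfolding norm1_def using xy by (intro infsum_add) (auto simp: ell1_def)
  finally show "norm1 (\<lambda>k. x k + y k) \<le> norm1 x + norm1 y" .
qed

lemma ell1_scale: "x \<in> ell1 \<Longrightarrow> (\<lambda>k. z * x k) \<in> ell1"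
  by (simp add: ell1_def norm_mult summable_on_cmult_right)

lemma norm1_scale: "norm1 (\<lambda>k. z * x k) = norm z * norm1 x"
  by (simp add: norm1_def norm_mult infsum_cmult_right')

lemma ell1_finite_support:
  assumes "finite F"
  shows "(\<lambda>k. if k \<in> F then x k else 0) \<in> ell1"
proof -
  have "(\<lambda>k. norm (if k \<in> F then x k else 0)) summable_on UNIV \<longleftrightarrow> (\<lambda>k. norm (x k)) summable_on F"
    by (rule summable_on_cong_neutral) auto
  then show ?thesis using assms by (simp add: ell1_def)
qed

lemma real_subspace_ell1: "real_subspace ell1"
  by (auto simp: real_subspace_def ell1_add ell1_scale) (simp add: ell1_def)

lemma ell1_minus: "x \<in> ell1 \<Longrightarrow> (\<lambda>k. - x k) \<in> ell1"
  by (rule subspace_minus[OF real_subspace_ell1])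

lemma norm1_minus: "norm1 (\<lambda>k. - x k) = norm1 x"
  by (simp add: norm1_def)

lemma ell1_truncation_tendsto:
  assumes "x \<in> ell1"
  shows "((\<lambda>F. norm1 (\<lambda>k. x k - (if k \<in> F then x k else 0))) \<longlongrightarrow> 0) (finite_subsets_at_top UNIV)"
proof -
  have s: "(\<lambda>k. norm (x k)) summable_on UNIV" using assms by (simp add: ell1_def)
  have eq: "norm1 (\<lambda>k. x k - (if k \<in> F then x k else 0)) = norm1 x - (\<Sum>k\<in>F. norm (x k))" if "finite F" for F
  proof -
    have "norm1 (\<lambda>k. x k - (if k \<in> F then x k else 0)) = (\<Sum>\<^sub>\<infinity>k\<in>UNIV - F. norm (x k))"
      unfolding norm1_def by (rule infsum_cong_neutral) auto
    also have "\<dots> = norm1 x - (\<Sum>k\<in>F. norm (x k))"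
      unfolding norm1_def using that s by (subst infsum_Diff) auto
    finally show ?thesis .
  qed
  have "((\<lambda>F. \<Sum>k\<in>F. norm (x k)) \<longlongrightarrow> norm1 x) (finite_subsets_at_top UNIV)"
    using has_sum_infsum[OF s] by (simp add: has_sum_def norm1_def)
  then have "((\<lambda>F. norm1 x - (\<Sum>k\<in>F. norm (x k))) \<longlongrightarrow> norm1 x - norm1 x) (finite_subsets_at_top UNIV)"
    by (intro tendsto_intros)
  then have "((\<lambda>F. norm1 x - (\<Sum>k\<in>F. norm (x k))) \<longlongrightarrow> 0) (finite_subsets_at_top UNIV)" by simp
  then show ?thesis
    by (rule tendsto_cong[THEN iffD1, rotated])
       (auto simp: eventually_finite_subsets_at_top_weakI eq)
qed

lemma bounded_times_ell1_summable:
  assumes "bounded (range c)" "x \<in> ell1"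
  shows "(\<lambda>k. c k * x k) summable_on UNIV"
proof -
  obtain B where B: "\<And>k. norm (c k) \<le> B"
    using assms(1) by (auto simp: bounded_iff)
  have "(\<lambda>k. B * norm (x k)) summable_on UNIV"
    using assms(2) by (intro summable_on_cmult_right) (simp add: ell1_def)
  then have "(\<lambda>k. norm (c k * x k)) summable_on UNIV"
    by (rule summable_on_comparison_test) (simp_all add: norm_mult mult_right_mono B)
  then show ?thesis by (rule abs_summable_summable)
qed

text \<open>The distance to \<open>M\<close> is sublinear, vanishes on \<open>M\<close> and is at
  least \<open>\<epsilon>\<close> at \<open>d\<close>. A minorant that is odd along the real and
  imaginary unit sequences is linear on finitely supported sequences; bounded by the norm, it is the
  real part of a pairing with a bounded sequence.\<close>

theorem ell1_annihilator:
  assumes M: "M \<subseteq> ell1" "(\<lambda>_. 0) \<in> M"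
      "\<And>x y. x \<in> M \<Longrightarrow> y \<in> M \<Longrightarrow> (\<lambda>k. x k + y k) \<in> M"
      "\<And>x z. x \<in> M \<Longrightarrow> (\<lambda>k. z * x k) \<in> M"
    and d: "d \<in> ell1" and \<epsilon>: "0 < \<epsilon>" "\<And>y. y \<in> M \<Longrightarrow> \<epsilon> \<le> norm1 (\<lambda>k. d k - y k)"
  obtains c where "bounded (range c)" "(\<Sum>\<^sub>\<infinity>k. c k * d k) \<noteq> 0" "\<And>y. y \<in> M \<Longrightarrow> (\<Sum>\<^sub>\<infinity>k. c k * y k) = 0"
proof -
  \<comment> \<open>The distance from \<open>x\<close> to \<open>M\<close>; the plus sign is
    immaterial since \<open>M\<close> is closed under negation.\<close>
  define q where "q x = (INF y\<in>M. norm1 (\<lambda>k. x k + y k))" for x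
  have bdd: "bdd_below ((\<lambda>y. norm1 (\<lambda>k. x k + y k)) ` M)" for x
    by (rule bdd_belowI2[of _ 0]) (simp add: norm1_nonneg)
  have q_le: "q x \<le> norm1 (\<lambda>k. x k + y k)" if "y \<in> M" for x y
    unfolding q_def by (rule cINF_lower[OF bdd that])
  have q_nonneg: "0 \<le> q x" for x
    unfolding q_def using M(2) by (intro cINF_greatest) (auto simp: norm1_nonneg)
  have q_le_norm: "q x \<le> norm1 x" for x
    using q_le[OF M(2), of x] by simp
  have q_M: "q y \<le> 0" if "y \<in> M" for y
    using q_le[OF M(4)[OF that, of "- 1"], of y] by (simp add: norm1_def)
  have q_d: "\<epsilon> \<le> q d"
    unfolding q_def
  proof (rule cINF_greatest)
    fix y assume "y \<in> M"
    then show "\<epsilon> \<le> norm1 (\<lambda>k. d k + y k)" using \<epsilon>(2)[OF M(4)[of y "- 1"]] by simp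
  qed (use M(2) in auto)
  have q: "sublinear_on ell1 q"
    unfolding sublinear_on_def
  proof (intro conjI ballI allI impI)
    show "q (\<lambda>_. 0) = 0"
      using q_le_norm[of "\<lambda>_. 0"] q_nonneg[of "\<lambda>_. 0"] by (simp add: norm1_def)
  next
    fix x1 x2 assume x: "x1 \<in> ell1" "x2 \<in> ell1"
    have "q (\<lambda>k. x1 k + x2 k) - norm1 (\<lambda>k. x2 k + y2 k) \<le> q x1" if y2: "y2 \<in> M" for y2
      unfolding q_def[of x1]
    proof (rule cINF_greatest)
      fix y1 assume y1: "y1 \<in> M"
      have "q (\<lambda>k. x1 k + x2 k) \<le> norm1 (\<lambda>k. (x1 k + x2 k) + (y1 k + y2 k))"
        by (rule q_le[OF M(3)[OF y1 y2]])
      also have "(\<lambda>k. (x1 k + x2 k) + (y1 k + y2 k)) = (\<lambda>k. (x1 k + y1 k) + (x2 k + y2 k))"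
        by (simp add: algebra_simps)
      also have "norm1 \<dots> \<le> norm1 (\<lambda>k. x1 k + y1 k) + norm1 (\<lambda>k. x2 k + y2 k)"
        using x y1 y2 M(1) by (intro norm1_add ell1_add) auto
      finally show "q (\<lambda>k. x1 k + x2 k) - norm1 (\<lambda>k. x2 k + y2 k) \<le> norm1 (\<lambda>k. x1 k + y1 k)"
        by simp
    qed (use M(2) in auto)
    then have "q (\<lambda>k. x1 k + x2 k) - q x1 \<le> q x2"
      unfolding q_def[of x2] using M(2) by (intro cINF_greatest) (auto simp: algebra_simps)
    then show "q (\<lambda>k. x1 k + x2 k) \<le> q x1 + q x2" by simp
  next
    fix x and t :: real assume x: "x \<in> ell1" and t: "0 < t"
    have "q (\<lambda>k. of_real t * x k) / t \<le> q x"
      unfolding q_def[of x]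
    proof (rule cINF_greatest)
      fix y assume y: "y \<in> M"
      have "q (\<lambda>k. of_real t * x k) \<le> norm1 (\<lambda>k. of_real t * x k + of_real t * y k)"
        by (rule q_le[OF M(4)[OF y]])
      also have "\<dots> = t * norm1 (\<lambda>k. x k + y k)"
        using norm1_scale[of "of_real t" "\<lambda>k. x k + y k"] t by (simp add: distrib_left)
      finally show "q (\<lambda>k. of_real t * x k) / t \<le> norm1 (\<lambda>k. x k + y k)"
        using t by (simp add: field_simps)
    qed (use M(2) in auto)
    then show "q (\<lambda>k. of_real t * x k) \<le> t * q x" using t by (simp add: field_simps)
  qed
  define e :: "int \<Rightarrow> complex \<Rightarrow> int \<Rightarrow> complex" where "e k z = (\<lambda>l. if l \<in> {k} then z else 0)" for k z
  have e_ell1: "e k z \<in> ell1" for k z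
    unfolding e_def by (rule ell1_finite_support) simp
  \<comment> \<open>An enumeration of the unit sequences at all places, each once with value 1 and
    once with value \<open>\<i>\<close>, as only real scalars are at hand.\<close>
  define b where "b n = (case from_nat n :: int \<times> bool of (k, \<beta>) \<Rightarrow> e k (if \<beta> then 1 else \<i>))" for n
  have b_ell1: "b n \<in> ell1" for n
    by (simp add: b_def e_ell1 split: prod.split)
  obtain u where u: "sublinear_on ell1 u" and u_q: "\<And>x. x \<in> ell1 \<Longrightarrow> u x \<le> q x"
    and u_b: "\<And>n. u (\<lambda>i. - b n i) = - u (b n)" and u_d: "q d \<le> u d"
    using sublinear_minorant[where y = b, OF real_subspace_ell1 q b_ell1 d] by blast
  note u_add = sublinear_add[OF real_subspace_ell1 u]
  \<comment> \<open>The vectors at which \<open>u\<close> is odd. Additivity holds as soon as one of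
    the two summands is such a vector; the other may be arbitrary, which is used for the tails of a
    sequence.\<close>
  define Od where "Od = {x\<in>ell1. u (\<lambda>i. - x i) = - u x}"
  have Od_ell1: "x \<in> ell1" if "x \<in> Od" for x using that by (simp add: Od_def)
  have add: "u (\<lambda>i. x i + y i) = u x + u y" if x: "x \<in> Od" and y: "y \<in> ell1" for x y
  proof -
    have "u (\<lambda>i. (x i + y i) + - x i) \<le> u (\<lambda>i. x i + y i) + u (\<lambda>i. - x i)"
      by (rule u_add[OF ell1_add[OF Od_ell1[OF x] y] ell1_minus[OF Od_ell1[OF x]]])
    then have "u y \<le> u (\<lambda>i. x i + y i) - u x" using x by (simp add: Od_def)
    then show ?thesis using u_add[OF Od_ell1[OF x] y] by simp
  qed
  have Od_add: "(\<lambda>i. x i + y i) \<in> Od" if x: "x \<in> Od" and y: "y \<in> Od" for x y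
  proof -
    have "(\<lambda>i. - x i) \<in> Od" using x by (simp add: Od_def ell1_minus)
    from add[OF this ell1_minus[OF Od_ell1[OF y]]]
    have "u (\<lambda>i. - x i + - y i) = - u x - u y" using x y by (simp add: Od_def)
    then show ?thesis
      using add[OF x Od_ell1[OF y]] ell1_add[OF Od_ell1[OF x] Od_ell1[OF y]] by (simp add: Od_def)
  qed
  have scale: "u (\<lambda>i. of_real t * x i) = t * u x" and Od_scale: "(\<lambda>i. of_real t * x i) \<in> Od"
    if x: "x \<in> Od" for x t
  proof -
    have all: "u (\<lambda>i. of_real t * x i) = t * u x" for t
    proof (cases "0 \<le> t")
      case False
      have "u (\<lambda>i. of_real (- t) * (- x i)) = (- t) * u (\<lambda>i. - x i)"
        using False by (intro sublinear_scale[OF real_subspace_ell1 u] ell1_minus Od_ell1 x) simp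
      then show ?thesis using x by (simp add: Od_def)
    qed (simp add: sublinear_scale[OF real_subspace_ell1 u Od_ell1[OF x]])
    show "u (\<lambda>i. of_real t * x i) = t * u x" by (rule all)
    show "(\<lambda>i. of_real t * x i) \<in> Od"
      using all[of t] all[of "- t"] ell1_scale[OF Od_ell1[OF x]] by (simp add: Od_def)
  qed
  have e_Od: "e k 1 \<in> Od" "e k \<i> \<in> Od" for k
  proof -
    have "e k 1 = b (to_nat (k, True))" "e k \<i> = b (to_nat (k, False))" by (simp_all add: b_def)
    then show "e k 1 \<in> Od" "e k \<i> \<in> Od"
      using u_b[of "to_nat (k, True)"] u_b[of "to_nat (k, False)"] by (simp_all add: Od_def b_ell1)
  qed
  \<comment> \<open>Chosen so that the real part of \<open>c k * z\<close> is the value of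
    \<open>u\<close> at the unit sequence at \<open>k\<close> with entry \<open>z\<close>.\<close>
  define c where "c k = of_real (u (e k 1)) - \<i> * of_real (u (e k \<i>))" for k
  have e_z: "e k z \<in> Od \<and> u (e k z) = Re (c k * z)" for k z
  proof -
    have eq: "e k z = (\<lambda>i. of_real (Re z) * e k 1 i + of_real (Im z) * e k \<i> i)"
      by (auto simp: e_def fun_eq_iff complex_eq_iff)
    have Re: "Re (c k * z) = Re z * u (e k 1) + Im z * u (e k \<i>)"
      by (simp add: c_def mult.commute)
    show ?thesis
      unfolding eq Re using add[OF Od_scale[OF e_Od(1)] Od_ell1[OF Od_scale[OF e_Od(2)]]]
        Od_add[OF Od_scale[OF e_Od(1)] Od_scale[OF e_Od(2)]]
      by (simp add: scale e_Od)
  qed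
  have fin: "(\<lambda>k. if k \<in> F then x k else 0) \<in> Od \<and> u (\<lambda>k. if k \<in> F then x k else 0) = (\<Sum>k\<in>F. Re (c k * x k))"
    if "finite F" for F x
    using that
  proof (induction F)
    case empty
    show ?case using e_z[of 0 0] by (simp add: e_def)
  next
    case (insert l F)
    have eq: "(\<lambda>k. if k \<in> insert l F then x k else 0) = (\<lambda>k. e l (x l) k + (if k \<in> F then x k else 0))"
      using insert(2) by (auto simp: e_def)
    show ?case
      unfolding eq using insert e_z[of l "x l"] by (auto intro!: Od_add simp: add[OF _ Od_ell1])
  qed
  have abs_le: "\<bar>u x\<bar> \<le> norm1 x" if x: "x \<in> ell1" for x
  proof -
    have "u x \<le> norm1 x" using u_q[OF x] q_le_norm[of x] by simp
    moreover have "u (\<lambda>i. - x i) \<le> norm1 x"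
      using u_q[OF ell1_minus[OF x]] q_le_norm[of "\<lambda>i. - x i"] by (simp add: norm1_minus)
    ultimately show ?thesis
      using sublinear_neg[OF real_subspace_ell1 u x] by simp
  qed
  have c_bdd: "norm (c k) \<le> 2" for k
  proof -
    have n: "norm1 (e k z) = norm z" for z
    proof -
      have "norm1 (e k z) = (\<Sum>\<^sub>\<infinity>l\<in>{k}. norm z)"
        unfolding norm1_def by (rule infsum_cong_neutral) (auto simp: e_def)
      then show ?thesis by simp
    qed
    have "norm (c k) \<le> \<bar>u (e k 1)\<bar> + \<bar>u (e k \<i>)\<bar>"
      unfolding c_def by (rule order_trans[OF norm_triangle_ineq4]) (simp add: norm_mult)
    also have "\<dots> \<le> 2"
      using abs_le[OF e_ell1, of k 1] abs_le[OF e_ell1, of k \<i>] by (simp add: n)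
    finally show ?thesis .
  qed
  then have bc: "bounded (range c)" by (auto simp: bounded_iff)
  note cs = bounded_times_ell1_summable[OF bc]
  have u_eq: "u x = Re (\<Sum>\<^sub>\<infinity>k. c k * x k)" if x: "x \<in> ell1" for x
  proof (rule tendsto_unique[OF finite_subsets_at_top_neq_bot])
    let ?t = "\<lambda>F k. if k \<in> F then x k else 0"
    have "((\<lambda>F. Re (\<Sum>k\<in>F. c k * x k)) \<longlongrightarrow> Re (\<Sum>\<^sub>\<infinity>k. c k * x k)) (finite_subsets_at_top UNIV)"
      using has_sum_infsum[OF cs[OF x]] by (intro tendsto_Re) (simp add: has_sum_def)
    then show "((\<lambda>F. \<Sum>k\<in>F. Re (c k * x k)) \<longlongrightarrow> Re (\<Sum>\<^sub>\<infinity>k. c k * x k)) (finite_subsets_at_top UNIV)"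
      by simp
    \<comment> \<open>The difference is \<open>u\<close> of the tail, since the truncation lies in
      \<open>Od\<close>, and the norm of the tail tends to 0.\<close>
    have "((\<lambda>F. u x - (\<Sum>k\<in>F. Re (c k * x k))) \<longlongrightarrow> 0) (finite_subsets_at_top UNIV)"
    proof (rule Lim_null_comparison[OF eventually_finite_subsets_at_top_weakI ell1_truncation_tendsto[OF x]])
      fix F :: "int set" assume F: "finite F"
      have r: "(\<lambda>k. x k - ?t F k) \<in> ell1"
        using ell1_add[OF x ell1_minus[OF ell1_finite_support[OF F, of x]]] by simp
      have "u (\<lambda>k. ?t F k + (x k - ?t F k)) = u (?t F) + u (\<lambda>k. x k - ?t F k)"
        using fin[OF F, of x] by (intro add r) simp
      moreover have "(\<lambda>k. ?t F k + (x k - ?t F k)) = x" by auto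
      ultimately have "u x - (\<Sum>k\<in>F. Re (c k * x k)) = u (\<lambda>k. x k - ?t F k)"
        using fin[OF F, of x] by simp
      then show "norm (u x - (\<Sum>k\<in>F. Re (c k * x k))) \<le> norm1 (\<lambda>k. x k - ?t F k)"
        using abs_le[OF r] by simp
    qed
    then have "((\<lambda>F. u x - (u x - (\<Sum>k\<in>F. Re (c k * x k)))) \<longlongrightarrow> u x - 0) (finite_subsets_at_top UNIV)"
      by (intro tendsto_intros)
    then show "((\<lambda>F. \<Sum>k\<in>F. Re (c k * x k)) \<longlongrightarrow> u x) (finite_subsets_at_top UNIV)" by simp
  qed
  have re0: "Re (\<Sum>\<^sub>\<infinity>k. c k * y k) = 0" if y: "y \<in> M" for y
  proof -
    have ye: "y \<in> ell1" using M(1) y by blast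
    have "u y \<le> 0" using u_q[OF ye] q_M[OF y] by simp
    moreover have "u (\<lambda>k. - y k) \<le> 0"
      using u_q[OF ell1_minus[OF ye]] q_M[OF M(4)[OF y, of "- 1"]] by simp
    moreover have "u (\<lambda>k. - y k) = - u y"
      using u_eq[OF ye] u_eq[OF ell1_minus[OF ye]] by (simp add: infsum_uminus)
    ultimately show ?thesis using u_eq[OF ye] by simp
  qed
  show ?thesis
  proof
    show "bounded (range c)" by (rule bc)
    show "(\<Sum>\<^sub>\<infinity>k. c k * d k) \<noteq> 0"
      using u_eq[OF d] u_d q_d \<epsilon>(1) by auto
    show "(\<Sum>\<^sub>\<infinity>k. c k * y k) = 0" if y: "y \<in> M" for y
    proof (rule complex_eqI)
      \<comment> \<open>\<open>M\<close> is a complex subspace, so the vanishing of the real part at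
        \<open>\<i> y\<close> gives that of the imaginary part at \<open>y\<close>.\<close>
      have "(\<Sum>\<^sub>\<infinity>k. c k * (\<i> * y k)) = \<i> * (\<Sum>\<^sub>\<infinity>k. c k * y k)"
        by (subst infsum_cmult_right'[symmetric]) (simp add: mult_ac)
      then show "Im (\<Sum>\<^sub>\<infinity>k. c k * y k) = Im 0"
        using re0[OF M(4)[OF y, of \<i>]] by simp
    qed (simp add: re0[OF y])
  qed
qed

section \<open>The sampling matrices\<close>

lemma in_ellp_1_iff:
  assumes "countable I"
  shows "c \<in> ellp 1 I \<longleftrightarrow> (\<forall>i. i \<notin> I \<longrightarrow> c i = 0) \<and> (\<integral>\<^sup>+i. ennreal (norm (c i)) \<partial>count_space I) < \<infinity>"
  by (simp add: ellp_def ellp_norm_1[OF assms])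

lemma ellp_1_add:
  assumes "countable I" "c \<in> ellp 1 I" "d \<in> ellp 1 I"
  shows "(\<lambda>i. c i + d i) \<in> ellp 1 I"
proof -
  have "(\<integral>\<^sup>+i. ennreal (norm (c i + d i)) \<partial>count_space I)
      \<le> (\<integral>\<^sup>+i. ennreal (norm (c i)) + ennreal (norm (d i)) \<partial>count_space I)"
    by (intro nn_integral_mono ennreal_norm_triangle)
  also have "\<dots> < \<infinity>"
    using assms by (simp add: nn_integral_add in_ellp_1_iff)
  finally show ?thesis using assms by (simp add: in_ellp_1_iff)
qed

lemma ellp_1_scale:
  assumes "countable I" "c \<in> ellp 1 I"
  shows "(\<lambda>i. z * c i) \<in> ellp 1 I"
  using assms by (simp add: in_ellp_1_iff norm_mult ennreal_mult nn_integral_cmult ennreal_mult_less_top)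

lemma ellp_1_summable:
  "countable I \<Longrightarrow> c \<in> ellp 1 I \<Longrightarrow> (\<lambda>i. norm (c i)) summable_on I"
  by (intro abs_summable_on_ennreal) (simp add: in_ellp_1_iff)

lemma ellp_1_UNIV: "ellp 1 UNIV = ell1"
proof (intro set_eqI iffI)
  fix x :: "int \<Rightarrow> complex" assume "x \<in> ell1"
  then show "x \<in> ellp 1 UNIV"
    by (simp add: in_ellp_1_iff ell1_def nn_integral_count_space_infsum)
qed (auto simp: ell1_def intro: ellp_1_summable)

lemma ellp_norm_1_eq_norm1: "x \<in> ell1 \<Longrightarrow> ellp_norm 1 UNIV x = ennreal (norm1 x)"
  by (simp add: ellp_norm_1 ell1_def norm1_def nn_integral_count_space_infsum)

lemma ellp_top_UNIV:
  fixes c :: "'i::countable \<Rightarrow> complex"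
  shows "c \<in> ellp \<infinity> UNIV \<longleftrightarrow> bounded (range c)"
  using bounded_if_ell_norm_finite[of \<infinity> c] ell_norm_finite_if_bounded[of c] by (auto simp: ellp_UNIV_iff)

lemma uniqueness_set_top_iff:
  "uniqueness_set \<infinity> g \<Gamma> \<longleftrightarrow>
    (\<forall>c. bounded (range c) \<longrightarrow> (\<forall>\<gamma>\<in>\<Gamma>. shift_sum g c \<gamma> = 0) \<longrightarrow> shift_sum g c = (\<lambda>_. 0))"
  unfolding uniqueness_set_def V_space_def using ellp_top_UNIV by blast

context
  fixes g :: "real \<Rightarrow> complex"
  assumes g: "g \<in> W0"
begin

lemma uniqueness_if_lower_bounded:
  assumes "lower_bounded (samp g \<Gamma>) \<infinity>"
  shows "uniqueness_set \<infinity> g \<Gamma>"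
  unfolding uniqueness_set_top_iff
proof (intro allI impI)
  fix c assume c: "bounded (range c)" and zero: "\<forall>\<gamma>\<in>\<Gamma>. shift_sum g c \<gamma> = 0"
  obtain A where A: "A > 0" "\<And>c. ell_norm \<infinity> (\<lambda>k. ennreal (norm (c k))) < \<infinity> \<Longrightarrow>
      ennreal A * ell_norm \<infinity> (\<lambda>k. ennreal (norm (c k))) \<le> ell_norm \<infinity> (\<lambda>j. samp g \<Gamma> j c)"
    using assms unfolding lower_bounded_def by auto
  have "ell_norm \<infinity> (\<lambda>j. samp g \<Gamma> j c) \<le> 0"
    unfolding SUP_samp using zero by (intro SUP_least) simp
  with A(2)[OF ell_norm_finite_if_bounded[OF c]] A(1)
  have "ell_norm \<infinity> (\<lambda>k. ennreal (norm (c k))) = 0" by simp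
  then have "ennreal (norm (c k)) \<le> 0" for k
    using ell_norm_point_le[of \<infinity> "\<lambda>k. ennreal (norm (c k))" k] by simp
  then have "c = (\<lambda>_. 0)" by auto
  then show "shift_sum g c = (\<lambda>_. 0)" by (simp add: shift_sum_zero[OF g])
qed

section \<open>The two matrices as operators and the duality between them\<close>

lemma mat_apply_P_mat:
  "mat_apply (P_mat g) \<Gamma> UNIV c = (\<lambda>\<gamma>. if \<gamma> \<in> \<Gamma> then shift_sum g c \<gamma> else 0)"
  by (simp add: mat_apply_def P_mat_def shift_sum_def mult.commute fun_eq_iff)

lemma ellp_norm_P_mat_le:
  "ellp_norm \<infinity> \<Gamma> (mat_apply (P_mat g) \<Gamma> UNIV c) \<le> Sig (wmax g) * ellp_norm \<infinity> UNIV c"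
proof -
  let ?N = "SUP k. ennreal (norm (c k))"
  have "ennreal (norm (shift_sum g c \<gamma>)) \<le> Sig (wmax g) * ?N" for \<gamma>
  proof -
    have "ennreal (norm (shift_sum g c \<gamma>)) \<le> Sig (\<lambda>k. wmax g (\<lfloor>\<gamma>\<rfloor> - k) * ennreal (norm (c k)))"
      by (rule norm_shift_sum_le[OF g])
    also have "\<dots> \<le> Sig (\<lambda>k. wmax g (\<lfloor>\<gamma>\<rfloor> - k) * ?N)"
      by (intro nn_integral_mono mult_left_mono SUP_upper) auto
    also have "\<dots> = Sig (wmax g) * ?N"
      by (simp add: nn_integral_multc Sig_reflect)
    finally show ?thesis .
  qed
  then show ?thesis
    by (auto simp: ellp_norm_def mat_apply_P_mat intro: SUP_least)
qed

lemma P_mat_operator: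
  "defines_operator \<infinity> (P_mat g) \<Gamma> UNIV" "bounded_operator \<infinity> (P_mat g) \<Gamma> UNIV"
proof -
  have W: "Sig (wmax g) < \<infinity>" by (rule Sig_wmax_finite[OF g])
  show "defines_operator \<infinity> (P_mat g) \<Gamma> UNIV"
    unfolding defines_operator_def
  proof (intro ballI conjI)
    fix c :: "int \<Rightarrow> complex" assume c: "c \<in> ellp \<infinity> UNIV"
    then have "bounded (range c)" unfolding ellp_top_UNIV .
    then show "(\<lambda>k. P_mat g \<gamma> k * c k) summable_on UNIV" for \<gamma>
      using shift_sum_summable[OF g, of c \<gamma>] by (simp add: P_mat_def mult.commute)
    have "ellp_norm \<infinity> UNIV c < \<infinity>" using c by (simp add: ellp_def)
    then have "Sig (wmax g) * ellp_norm \<infinity> UNIV c < \<infinity>" using W by (simp add: ennreal_mult_less_top)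
    then show "mat_apply (P_mat g) \<Gamma> UNIV c \<in> ellp \<infinity> \<Gamma>"
      using ellp_norm_P_mat_le[of \<Gamma> c] by (auto simp: ellp_def mat_apply_P_mat intro: le_less_trans)
  qed
  have "ennreal (enn2real (Sig (wmax g))) = Sig (wmax g)" using W by (simp add: less_top)
  then show "bounded_operator \<infinity> (P_mat g) \<Gamma> UNIV"
    unfolding bounded_operator_def using ellp_norm_P_mat_le by metis
qed

lemma norm_le_Sig_wmax: "ennreal (norm (g x)) \<le> Sig (wmax g)"
proof -
  have "ennreal (norm (g x)) \<le> wmax g \<lfloor>x\<rfloor>"
    using norm_le_wmax[OF g diff_int_in_unit_interval[of x 0]] by simp
  also have "\<dots> \<le> Sig (wmax g)" by (rule nn_integral_ge_point) simp
  finally show ?thesis .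
qed

lemma Sig_norm_shifts_le: "Sig (\<lambda>k. ennreal (norm (g (x - of_int k)))) \<le> Sig (wmax g)"
  using order_trans[OF Sig_terms_le[OF g, of "\<lambda>_. 1" x] Sig_wmax_bounded_le[OF g, of "\<lambda>_. 1" 1 "\<lfloor>x\<rfloor>"]]
  by simp

lemma P_mat_transpose_summable:
  assumes \<Gamma>: "countable \<Gamma>" and a: "a \<in> ellp 1 \<Gamma>"
  shows "(\<lambda>\<gamma>. P_mat_transpose g k \<gamma> * a \<gamma>) summable_on \<Gamma>"
proof (rule abs_summable_summable[OF abs_summable_on_ennreal])
  have "(\<integral>\<^sup>+\<gamma>. ennreal (norm (P_mat_transpose g k \<gamma> * a \<gamma>)) \<partial>count_space \<Gamma>)
      \<le> (\<integral>\<^sup>+\<gamma>. Sig (wmax g) * ennreal (norm (a \<gamma>)) \<partial>count_space \<Gamma>)"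
    by (intro nn_integral_mono)
       (simp add: P_mat_transpose_def norm_mult ennreal_mult mult_right_mono norm_le_Sig_wmax)
  also have "\<dots> < \<infinity>"
    using a Sig_wmax_finite[OF g] by (simp add: nn_integral_cmult in_ellp_1_iff[OF \<Gamma>] ennreal_mult_less_top)
  finally show "(\<integral>\<^sup>+\<gamma>. ennreal (norm (P_mat_transpose g k \<gamma> * a \<gamma>)) \<partial>count_space \<Gamma>) < \<infinity>" .
qed

lemma P_mat_transpose_in_ell1:
  assumes \<Gamma>: "countable \<Gamma>" and a: "a \<in> ellp 1 \<Gamma>"
  shows "mat_apply (P_mat_transpose g) UNIV \<Gamma> a \<in> ell1"
proof -
  have "Sig (\<lambda>k. ennreal (norm (mat_apply (P_mat_transpose g) UNIV \<Gamma> a k)))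
      \<le> Sig (\<lambda>k. \<integral>\<^sup>+\<gamma>. ennreal (norm (P_mat_transpose g k \<gamma> * a \<gamma>)) \<partial>count_space \<Gamma>)"
    by (intro nn_integral_mono) (simp add: mat_apply_def norm_infsum_le_nn_integral)
  also have "\<dots> = (\<integral>\<^sup>+\<gamma>. Sig (\<lambda>k. ennreal (norm (P_mat_transpose g k \<gamma> * a \<gamma>))) \<partial>count_space \<Gamma>)"
    by (rule nn_integral_count_space_nn_integral[symmetric]) auto
  also have "\<dots> = (\<integral>\<^sup>+\<gamma>. Sig (\<lambda>k. ennreal (norm (g (\<gamma> - of_int k)))) * ennreal (norm (a \<gamma>)) \<partial>count_space \<Gamma>)"
    by (simp add: P_mat_transpose_def norm_mult ennreal_mult nn_integral_multc)
  also have "\<dots> \<le> (\<integral>\<^sup>+\<gamma>. Sig (wmax g) * ennreal (norm (a \<gamma>)) \<partial>count_space \<Gamma>)"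
    by (intro nn_integral_mono mult_right_mono Sig_norm_shifts_le) auto
  also have "\<dots> < \<infinity>"
    using a Sig_wmax_finite[OF g] by (simp add: nn_integral_cmult in_ellp_1_iff[OF \<Gamma>] ennreal_mult_less_top)
  finally show ?thesis
    by (simp add: ellp_1_UNIV[symmetric] in_ellp_1_iff)
qed

lemma P_mat_transpose_defines_operator:
  "countable \<Gamma> \<Longrightarrow> defines_operator 1 (P_mat_transpose g) UNIV \<Gamma>"
  by (simp add: defines_operator_def P_mat_transpose_summable P_mat_transpose_in_ell1 ellp_1_UNIV)

text \<open>Fubini for a double series that is absolutely convergent: the inner sums are at most a
  constant times the modulus of \<open>a\<close>.\<close>

lemma P_mat_duality:
  assumes \<Gamma>: "countable \<Gamma>" and a: "a \<in> ellp 1 \<Gamma>" and c: "bounded (range c)"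
  shows "(\<Sum>\<^sub>\<infinity>k. c k * mat_apply (P_mat_transpose g) UNIV \<Gamma> a k) = (\<Sum>\<^sub>\<infinity>\<gamma>\<in>\<Gamma>. shift_sum g c \<gamma> * a \<gamma>)"
proof -
  define f where "f \<gamma> k = c k * g (\<gamma> - of_int k) * a \<gamma>" for \<gamma> k
  obtain B where B: "\<And>k. norm (c k) \<le> B"
    using c by (auto simp: bounded_iff)
  have inner: "(\<lambda>k. norm (f \<gamma> k)) summable_on UNIV" for \<gamma>
    unfolding f_def norm_mult[of _ "a \<gamma>"] by (intro summable_on_cmult_left shift_sum_abs_summable[OF g c])
  have inner_le: "ennreal (norm (\<Sum>\<^sub>\<infinity>k. norm (f \<gamma> k))) \<le> Sig (wmax g) * ennreal B * ennreal (norm (a \<gamma>))" for \<gamma>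
  proof -
    have "ennreal (norm (\<Sum>\<^sub>\<infinity>k. norm (f \<gamma> k))) \<le> Sig (\<lambda>k. ennreal (norm (f \<gamma> k)))"
      using norm_infsum_le_nn_integral[of "\<lambda>k. norm (f \<gamma> k)" UNIV] by simp
    also have "\<dots> = Sig (\<lambda>k. ennreal (norm (c k * g (\<gamma> - of_int k)))) * ennreal (norm (a \<gamma>))"
      by (simp add: f_def norm_mult[of _ "a \<gamma>"] ennreal_mult nn_integral_multc)
    also have "\<dots> \<le> Sig (wmax g) * ennreal B * ennreal (norm (a \<gamma>))"
      by (intro mult_right_mono order_trans[OF Sig_terms_le[OF g] Sig_wmax_bounded_le[OF g B]]) simp
    finally show ?thesis .
  qed
  have "(\<lambda>\<gamma>. norm (\<Sum>\<^sub>\<infinity>k. norm (f \<gamma> k))) summable_on \<Gamma>"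
  proof (rule abs_summable_on_ennreal)
    have "(\<integral>\<^sup>+\<gamma>. ennreal (norm (\<Sum>\<^sub>\<infinity>k. norm (f \<gamma> k))) \<partial>count_space \<Gamma>)
        \<le> (\<integral>\<^sup>+\<gamma>. Sig (wmax g) * ennreal B * ennreal (norm (a \<gamma>)) \<partial>count_space \<Gamma>)"
      by (intro nn_integral_mono inner_le)
    also have "\<dots> < \<infinity>"
      using a Sig_wmax_finite[OF g] by (simp add: nn_integral_cmult in_ellp_1_iff[OF \<Gamma>] ennreal_mult_less_top)
    finally show "(\<integral>\<^sup>+\<gamma>. ennreal (norm (\<Sum>\<^sub>\<infinity>k. norm (f \<gamma> k))) \<partial>count_space \<Gamma>) < \<infinity>" .
  qed
  then have "(\<lambda>x. norm (case x of (\<gamma>, k) \<Rightarrow> f \<gamma> k)) summable_on \<Gamma> \<times> UNIV"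
    using inner
    by (subst Infinite_Sum.abs_summable_on_Sigma_iff[of "\<lambda>(\<gamma>, k). f \<gamma> k" \<Gamma> "\<lambda>_. UNIV"]) simp
  then have "(\<lambda>(\<gamma>, k). f \<gamma> k) summable_on \<Gamma> \<times> UNIV"
    by (rule abs_summable_summable)
  from infsum_swap_banach[OF this]
  have "(\<Sum>\<^sub>\<infinity>\<gamma>\<in>\<Gamma>. \<Sum>\<^sub>\<infinity>k. f \<gamma> k) = (\<Sum>\<^sub>\<infinity>k. \<Sum>\<^sub>\<infinity>\<gamma>\<in>\<Gamma>. f \<gamma> k)" .
  moreover have "(\<Sum>\<^sub>\<infinity>k. f \<gamma> k) = shift_sum g c \<gamma> * a \<gamma>" for \<gamma>
    unfolding f_def shift_sum_def by (rule infsum_cmult_left')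
  moreover have "(\<Sum>\<^sub>\<infinity>\<gamma>\<in>\<Gamma>. f \<gamma> k) = c k * mat_apply (P_mat_transpose g) UNIV \<Gamma> a k" for k
    unfolding f_def mat_apply_def P_mat_transpose_def mult.assoc
    by (simp only: infsum_cmult_right' if_True UNIV_I)
  ultimately show ?thesis by simp
qed

section \<open>Injectivity, uniqueness and density of the range\<close>

context
  fixes \<Gamma> :: "real set"
  assumes stable: "stable_integer_shifts g" and \<Gamma>: "countable \<Gamma>"
begin

text \<open>Injectivity concerns coefficients and uniqueness concerns functions; stability makes a
  bounded coefficient sequence vanish together with its function.\<close>

lemma injective_iff_uniqueness:
  "injective_operator \<infinity> (P_mat g) \<Gamma> UNIV \<longleftrightarrow> uniqueness_set \<infinity> g \<Gamma>"
proof
  assume inj: "injective_operator \<infinity> (P_mat g) \<Gamma> UNIV"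
  show "uniqueness_set \<infinity> g \<Gamma>"
    unfolding uniqueness_set_top_iff
  proof (intro allI impI)
    fix c assume c: "bounded (range c)" and zero: "\<forall>\<gamma>\<in>\<Gamma>. shift_sum g c \<gamma> = 0"
    have z: "(\<lambda>_::int. 0::complex) \<in> ellp \<infinity> UNIV" unfolding ellp_top_UNIV by simp
    have c': "c \<in> ellp \<infinity> UNIV" unfolding ellp_top_UNIV by (rule c)
    have "mat_apply (P_mat g) \<Gamma> UNIV c = mat_apply (P_mat g) \<Gamma> UNIV (\<lambda>_. 0)"
      using zero by (auto simp: mat_apply_P_mat shift_sum_zero[OF g])
    from inj_onD[OF inj[unfolded injective_operator_def] this c' z] have "c = (\<lambda>_. 0)" .
    then show "shift_sum g c = (\<lambda>_. 0)" by (simp add: shift_sum_zero[OF g])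
  qed
next
  assume uniq: "uniqueness_set \<infinity> g \<Gamma>"
  show "injective_operator \<infinity> (P_mat g) \<Gamma> UNIV"
    unfolding injective_operator_def
  proof (rule inj_onI)
    fix c d :: "int \<Rightarrow> complex"
    assume cd: "c \<in> ellp \<infinity> UNIV" "d \<in> ellp \<infinity> UNIV"
      and eq: "mat_apply (P_mat g) \<Gamma> UNIV c = mat_apply (P_mat g) \<Gamma> UNIV d"
    have c: "bounded (range c)" using cd(1) unfolding ellp_top_UNIV .
    have d: "bounded (range (\<lambda>k. - 1 * d k))"
      using cd(2) unfolding ellp_top_UNIV by (rule bounded_range_mult)
    have diff: "shift_sum g (\<lambda>k. c k + - 1 * d k) x = shift_sum g c x - shift_sum g d x" for x
      unfolding shift_sum_add[OF g c d] shift_sum_scale[OF g] by simp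
    have bd: "bounded (range (\<lambda>k. c k + - 1 * d k))"
      using bounded_plus_comp[OF c d] .
    have "shift_sum g (\<lambda>k. c k + - 1 * d k) \<gamma> = 0" if "\<gamma> \<in> \<Gamma>" for \<gamma>
      using fun_cong[OF eq, of \<gamma>] that by (simp only: diff) (simp add: mat_apply_P_mat)
    then have "shift_sum g (\<lambda>k. c k + - 1 * d k) = (\<lambda>_. 0)"
      using uniq bd unfolding uniqueness_set_top_iff by blast
    then have "(\<lambda>k. c k + - 1 * d k) = (\<lambda>_. 0)"
      using shift_sum_eq_zero_iff[OF g stable bd] by simp
    then show "c = d" by (simp add: fun_eq_iff)
  qed
qed

lemma uniqueness_if_dense_range:
  assumes dense: "dense_range 1 (P_mat_transpose g) UNIV \<Gamma>"
  shows "uniqueness_set \<infinity> g \<Gamma>"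
  unfolding uniqueness_set_top_iff
proof (intro allI impI)
  fix c assume c: "bounded (range c)" and zero: "\<forall>\<gamma>\<in>\<Gamma>. shift_sum g c \<gamma> = 0"
  obtain B where B: "B > 0" "\<And>k. norm (c k) \<le> B"
    using c by (auto simp: bounded_pos)
  have "c k0 = 0" for k0
  proof (rule ccontr)
    assume nz: "c k0 \<noteq> 0"
    define d where "d k = (if k \<in> {k0} then 1 else 0 :: complex)" for k
    have d: "d \<in> ell1" unfolding d_def by (rule ell1_finite_support) simp
    \<comment> \<open>Pairing with \<open>c\<close> annihilates the range and has norm at most
      \<open>B\<close>, so nothing in the range can be closer than this to a sequence whose pairing
      is \<open>c k0\<close>.\<close>
    have "norm (c k0) / B > 0" using nz B by simp
    then obtain a where a: "a \<in> ellp 1 \<Gamma>"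
      and lt: "ellp_norm 1 UNIV (\<lambda>k. d k - mat_apply (P_mat_transpose g) UNIV \<Gamma> a k) < ennreal (norm (c k0) / B)"
      using dense d unfolding dense_range_def ellp_1_UNIV by blast
    let ?P = "mat_apply (P_mat_transpose g) UNIV \<Gamma> a"
    have P: "?P \<in> ell1" by (rule P_mat_transpose_in_ell1[OF \<Gamma> a])
    have "(\<Sum>\<^sub>\<infinity>k. c k * ?P k) = (\<Sum>\<^sub>\<infinity>\<gamma>\<in>\<Gamma>. shift_sum g c \<gamma> * a \<gamma>)"
      by (rule P_mat_duality[OF \<Gamma> a c])
    also have "\<dots> = 0" using zero by (simp cong: infsum_cong)
    finally have P0: "(\<Sum>\<^sub>\<infinity>k. c k * ?P k) = 0" .
    have "(\<Sum>\<^sub>\<infinity>k. c k * d k) = (\<Sum>\<^sub>\<infinity>k\<in>{k0}. c k)"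
      by (rule infsum_cong_neutral) (auto simp: d_def)
    then have d1: "(\<Sum>\<^sub>\<infinity>k. c k * d k) = c k0" by simp
    have "(\<Sum>\<^sub>\<infinity>k. c k * (d k - ?P k)) = (\<Sum>\<^sub>\<infinity>k. c k * d k + - (c k * ?P k))"
      by (simp add: right_diff_distrib)
    also have "\<dots> = c k0"
      using infsum_add[OF bounded_times_ell1_summable[OF c d]
          summable_on_uminus[THEN iffD2, OF bounded_times_ell1_summable[OF c P]]]
      by (simp add: d1 P0 infsum_uminus)
    finally have eq: "(\<Sum>\<^sub>\<infinity>k. c k * (d k - ?P k)) = c k0" .
    have "ennreal (norm (c k0)) \<le> Sig (\<lambda>k. ennreal (norm (c k * (d k - ?P k))))"
      using norm_infsum_le_nn_integral[of "\<lambda>k. c k * (d k - ?P k)" UNIV] unfolding eq .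
    also have "\<dots> \<le> Sig (\<lambda>k. ennreal B * ennreal (norm (d k - ?P k)))"
      by (intro nn_integral_mono) (simp add: norm_mult ennreal_mult mult_right_mono B ennreal_leI)
    also have "\<dots> = ennreal B * ellp_norm 1 UNIV (\<lambda>k. d k - ?P k)"
      by (simp add: nn_integral_cmult ellp_norm_1)
    also have "\<dots> < ennreal B * ennreal (norm (c k0) / B)"
      using lt B by (intro ennreal_mult_strict_left_mono) auto
    also have "\<dots> = ennreal (norm (c k0))" using B by (simp flip: ennreal_mult)
    finally show False by simp
  qed
  then have "c = (\<lambda>_. 0)" by auto
  then show "shift_sum g c = (\<lambda>_. 0)" by (simp add: shift_sum_zero[OF g])
qed

text \<open>A bounded sequence annihilating a non-dense range pairs to zero with each column of the
  matrix, which says that its shift sum vanishes on \<open>\<Gamma>\<close>.\<close>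

lemma dense_range_if_uniqueness:
  assumes uniq: "uniqueness_set \<infinity> g \<Gamma>"
  shows "dense_range 1 (P_mat_transpose g) UNIV \<Gamma>"
proof (rule ccontr)
  let ?P = "mat_apply (P_mat_transpose g) UNIV \<Gamma>"
  assume "\<not> dense_range 1 (P_mat_transpose g) UNIV \<Gamma>"
  then obtain d \<epsilon> where d: "d \<in> ell1" and \<epsilon>: "\<epsilon> > 0"
    and far: "\<And>a. a \<in> ellp 1 \<Gamma> \<Longrightarrow> \<not> ellp_norm 1 UNIV (\<lambda>k. d k - ?P a k) < ennreal \<epsilon>"
    unfolding dense_range_def ellp_1_UNIV by blast
  have far': "\<epsilon> \<le> norm1 (\<lambda>k. d k - y k)" if "y \<in> ?P ` ellp 1 \<Gamma>" for y
  proof -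
    obtain a where a: "a \<in> ellp 1 \<Gamma>" "y = ?P a" using \<open>y \<in> _\<close> by blast
    have "(\<lambda>k. d k - ?P a k) \<in> ell1"
      using ell1_add[OF d ell1_minus[OF P_mat_transpose_in_ell1[OF \<Gamma> a(1)]]] by simp
    then show ?thesis
      using far[OF a(1)] a(2) \<epsilon> by (simp add: ellp_norm_1_eq_norm1 not_less norm1_nonneg)
  qed
  have P_add: "?P (\<lambda>\<gamma>. a \<gamma> + b \<gamma>) = (\<lambda>k. ?P a k + ?P b k)" if "a \<in> ellp 1 \<Gamma>" "b \<in> ellp 1 \<Gamma>" for a b
    using infsum_add[OF P_mat_transpose_summable[OF \<Gamma> that(1)] P_mat_transpose_summable[OF \<Gamma> that(2)]]
    by (simp add: mat_apply_def distrib_left fun_eq_iff)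
  have P_scale: "?P (\<lambda>\<gamma>. z * a \<gamma>) = (\<lambda>k. z * ?P a k)" for z a
    by (simp add: mat_apply_def fun_eq_iff mult.left_commute[of _ z] infsum_cmult_right')
  have zero_in: "(\<lambda>_. 0) \<in> ellp 1 \<Gamma>" by (simp add: in_ellp_1_iff[OF \<Gamma>])
  obtain c where c: "bounded (range c)" and cd: "(\<Sum>\<^sub>\<infinity>k. c k * d k) \<noteq> 0"
    and ann: "\<And>y. y \<in> ?P ` ellp 1 \<Gamma> \<Longrightarrow> (\<Sum>\<^sub>\<infinity>k. c k * y k) = 0"
  proof (rule ell1_annihilator[of "?P ` ellp 1 \<Gamma>", OF _ _ _ _ d \<epsilon> far'])
    show "?P ` ellp 1 \<Gamma> \<subseteq> ell1" using P_mat_transpose_in_ell1[OF \<Gamma>] by blast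
    show "(\<lambda>_. 0) \<in> ?P ` ellp 1 \<Gamma>"
      using P_scale[of 0 "\<lambda>_. 0"] zero_in by (intro image_eqI[of _ _ "\<lambda>_. 0"]) simp_all
    show "(\<lambda>k. x k + y k) \<in> ?P ` ellp 1 \<Gamma>" if "x \<in> ?P ` ellp 1 \<Gamma>" "y \<in> ?P ` ellp 1 \<Gamma>" for x y
    proof -
      from that obtain a b where ab: "a \<in> ellp 1 \<Gamma>" "x = ?P a" "b \<in> ellp 1 \<Gamma>" "y = ?P b" by blast
      show ?thesis
        unfolding ab P_add[OF ab(1,3), symmetric] by (intro imageI ellp_1_add[OF \<Gamma>] ab)
    qed
    show "(\<lambda>k. z * x k) \<in> ?P ` ellp 1 \<Gamma>" if "x \<in> ?P ` ellp 1 \<Gamma>" for x z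
    proof -
      from that obtain a where a: "a \<in> ellp 1 \<Gamma>" "x = ?P a" by blast
      show ?thesis
        unfolding a P_scale[symmetric] by (intro imageI ellp_1_scale[OF \<Gamma>] a)
    qed
  qed blast+
  have "shift_sum g c \<gamma> = 0" if "\<gamma> \<in> \<Gamma>" for \<gamma>
  proof -
    define a where "a = (\<lambda>x. if x = \<gamma> then 1 else 0 :: complex)"
    have "(\<integral>\<^sup>+x. ennreal (norm (a x)) \<partial>count_space \<Gamma>) = 1"
      using that by (subst nn_integral_count_space'[of "{\<gamma>}"]) (auto simp: a_def)
    then have a: "a \<in> ellp 1 \<Gamma>" using that by (auto simp: in_ellp_1_iff[OF \<Gamma>] a_def)
    have "?P a k = g (\<gamma> - of_int k)" for k
    proof -
      have "?P a k = (\<Sum>\<^sub>\<infinity>x\<in>\<Gamma>. g (x - of_int k) * a x)"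
        by (simp add: mat_apply_def P_mat_transpose_def)
      also have "\<dots> = (\<Sum>\<^sub>\<infinity>x\<in>{\<gamma>}. g (x - of_int k))"
        by (rule infsum_cong_neutral) (use that in \<open>auto simp: a_def\<close>)
      finally show ?thesis by simp
    qed
    then show ?thesis
      using ann[OF imageI[OF a]] by (simp add: shift_sum_def)
  qed
  then have "shift_sum g c = (\<lambda>_. 0)"
    using uniq c unfolding uniqueness_set_top_iff by blast
  then have "c = (\<lambda>_. 0)" using shift_sum_eq_zero_iff[OF g stable c] by simp
  with cd show False by simp
qed

end

end

theorem theorem3p1:
  fixes g :: "real \<Rightarrow> complex" and \<Lambda> :: "real set"
  assumes "g \<in> W0"
    and "stable_integer_shifts g"
    and "relatively_separated \<Lambda>"
  shows "((\<exists>p::ennreal. 1 \<le> p \<and> sampling_set p g \<Lambda>)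
            \<longleftrightarrow> (\<forall>p::ennreal. 1 \<le> p \<longrightarrow> sampling_set p g \<Lambda>)) \<and>
         ((\<forall>p::ennreal. 1 \<le> p \<longrightarrow> sampling_set p g \<Lambda>)
            \<longleftrightarrow> (\<forall>\<Gamma>\<in>W\<^sub>Z \<Lambda>. sampling_set \<infinity> g \<Gamma>)) \<and>
         ((\<forall>\<Gamma>\<in>W\<^sub>Z \<Lambda>. sampling_set \<infinity> g \<Gamma>)
            \<longleftrightarrow> (\<forall>\<Gamma>\<in>W\<^sub>Z \<Lambda>. uniqueness_set \<infinity> g \<Gamma>)) \<and>
         ((\<forall>\<Gamma>\<in>W\<^sub>Z \<Lambda>. uniqueness_set \<infinity> g \<Gamma>)
            \<longleftrightarrow> (\<forall>\<Gamma>\<in>W\<^sub>Z \<Lambda>. defines_operator \<infinity> (P_mat g) \<Gamma> UNIV \<and>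
                             bounded_operator \<infinity> (P_mat g) \<Gamma> UNIV \<and>
                             injective_operator \<infinity> (P_mat g) \<Gamma> UNIV)) \<and>
         ((\<forall>\<Gamma>\<in>W\<^sub>Z \<Lambda>. defines_operator \<infinity> (P_mat g) \<Gamma> UNIV \<and>
                    bounded_operator \<infinity> (P_mat g) \<Gamma> UNIV \<and>
                    injective_operator \<infinity> (P_mat g) \<Gamma> UNIV)
            \<longleftrightarrow> (\<forall>\<Gamma>\<in>W\<^sub>Z \<Lambda>. defines_operator 1 (P_mat_transpose g) UNIV \<Gamma> \<and>
                             dense_range 1 (P_mat_transpose g) UNIV \<Gamma>))"
    (is "(?a \<longleftrightarrow> ?b) \<and> (?b \<longleftrightarrow> ?c) \<and> (?c \<longleftrightarrow> ?d) \<and> (?d \<longleftrightarrow> ?e) \<and> (?e \<longleftrightarrow> ?f)")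
proof -
  note g = assms(1) and stable = assms(2) and \<Lambda> = assms(3)
  note sampling = sampling_set_iff_lower_bounded[OF g stable]
  have rel: "relatively_separated \<Gamma>" if "\<Gamma> \<in> W\<^sub>Z \<Lambda>" for \<Gamma>
    by (rule relatively_separated_weak_limit[OF \<Lambda> that])
  have cnt: "countable \<Gamma>" if "\<Gamma> \<in> W\<^sub>Z \<Lambda>" for \<Gamma>
    by (rule relatively_separated_countable[OF rel[OF that]])
  have one_le_top: "(1::ennreal) \<le> \<infinity>" by simp
  \<comment> \<open>The first four statements are linked in a cycle; the two matrix statements are
    compared with uniqueness for each weak limit separately.\<close>
  have "?a \<longrightarrow> ?b"
    using local_seminorms.lower_bounded_transfer[OF local_seminorms_samp[OF g]] sampling[OF \<Lambda>] by metis
  moreover have "?b \<longrightarrow> ?c"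
  proof (intro impI ballI)
    fix \<Gamma> assume ?b and \<Gamma>: "\<Gamma> \<in> W\<^sub>Z \<Lambda>"
    then have "lower_bounded (samp g \<Lambda>) \<infinity>" using sampling[OF \<Lambda> one_le_top] one_le_top by blast
    then show "sampling_set \<infinity> g \<Gamma>"
      using lower_bounded_samp_weak_limit[OF g _ \<Gamma>] sampling[OF rel[OF \<Gamma>] one_le_top] by blast
  qed
  moreover have "?c \<longrightarrow> ?d"
    using uniqueness_if_lower_bounded[OF g] sampling[OF rel one_le_top] by blast
  moreover have "?d \<longrightarrow> ?a"
    using lower_bounded_samp_if_unique[OF g stable] sampling[OF \<Lambda> one_le_top] one_le_top by blast
  moreover have "?d \<longleftrightarrow> ?e"
    using injective_iff_uniqueness[OF g stable cnt] P_mat_operator[OF g] by blast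
  moreover have "?d \<longleftrightarrow> ?f"
    using uniqueness_if_dense_range[OF g stable cnt] dense_range_if_uniqueness[OF g stable cnt]
      P_mat_transpose_defines_operator[OF g cnt] by blast
  ultimately show ?thesis by argo
qed

end
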